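(* Fix the domain $U$, $A>0$ and $T_0>0$. For each $B>AT_0$ let $p=p_B$ be the positive classical solution of the ideal gas Darcy problem and $p_0=p_{0,B}$ the auxiliary pressure (both defined in the context). Assume there is a constant $C<\infty$, independent of $B$, such that for all $x\in U$ and $0\le t\le T_0$ $$|\nabla p(x,t)|+\Delta p(x,t)\le C,\qquad |p_t(x,t)|\le C.$$ Then for $0\le t\le T_0$ $$J[p](t)-J[p_0]\to0\quad\text{as } B\to\infty.$$
   Context: $U\subset\mathbb{R}^n$ is a bounded domain with $C^2$ boundary $\partial U=\Gamma_e\cup\Gamma_i$, with outward unit normal $N$. Darcy flow of an ideal gas (normalized): $p>0$ is a classical solution of $$p_t=\nabla\cdot(p\nabla p)=\tfrac12\Delta(p^2)\ \text{in }U\times(0,T_0],\qquad p=B-At\ \text{on }\Gamma_i,\qquad p\,\nabla p\cdot N=0\ \text{on }\Gamma_e,\qquad p(x,0)=p_0(x,0)=\sqrt{B^2+2W(x)},$$ where $T_0<T_{crit}=B/A$. Here $W$ solves $-\Delta W=A$ in $U$, $W=0$ on $\Gamma_i$, $\nabla W\cdot N=0$ on $\Gamma_e$ (so $W\ge0$), and the auxiliary pressure is $$p_0(x,t)=\sqrt{(B-At)^2+2W(x)}.$$ The productivity index of a pressure $p$ is $$J[p](t)=\frac{Q(t)}{\frac1{|U|}\int_Up^2dx-\frac1{|\Gamma_i|}\int_{\Gamma_i}p^2ds},\qquad Q(t)=-\int_{\Gamma_i}p\nabla p\cdot N\,ds,$$ and for $p_0$ it equals the constant $J[p_0]=\dfrac{Q_0}{\frac1{|U|}\int_U2W\,dx}$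 with $Q_0=A|U|$. *)

theory Defs
  imports "HOL-Analysis.Analysis"
begin

section \<open>Differential operators and regularity classes\<close>

definition grad :: "('a::euclidean_space \<Rightarrow> real) \<Rightarrow> 'a \<Rightarrow> 'a" where
  "grad f x = (\<Sum>b\<in>Basis. frechet_derivative f (at x) b *\<^sub>R b)"

definition divergence :: "('a::euclidean_space \<Rightarrow> 'a) \<Rightarrow> 'a \<Rightarrow> real" where
  "divergence F x = (\<Sum>b\<in>Basis. frechet_derivative F (at x) b \<bullet> b)"

definition laplacian :: "('a::euclidean_space \<Rightarrow> real) \<Rightarrow> 'a \<Rightarrow> real" where
  "laplacian f = divergence (grad f)"

text \<open>One-sided at the end points of the time interval.\<close>

definition time_deriv :: "real \<Rightarrow> ('a \<Rightarrow> real \<Rightarrow> real) \<Rightarrow> 'a \<Rightarrow> real \<Rightarrow> real" where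
  "time_deriv T p x t = vector_derivative (p x) (at t within {0..T})"

definition C2_on :: "'a::euclidean_space set \<Rightarrow> ('a \<Rightarrow> real) \<Rightarrow> bool" where
  "C2_on U f \<longleftrightarrow>
     (\<forall>x\<in>U. f differentiable (at x)) \<and>
     (\<forall>x\<in>U. grad f differentiable (at x)) \<and>
     (\<forall>b\<in>Basis. continuous_on U (\<lambda>x. frechet_derivative (grad f) (at x) b))"

text \<open>The class \<open>C\<^sup>1\<close> of the closure of an open set \<open>U\<close>: the function, and its gradient on \<open>U\<close>,
  extend continuously to the closure. The gradient at a boundary point is the limit of the
  gradient from inside \<open>U\<close>.\<close>

definition C1_closure :: "'a::euclidean_space set \<Rightarrow> ('a \<Rightarrow> real) \<Rightarrow> bool" where
  "C1_closure U f \<longleftrightarrow>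
     continuous_on (closure U) f \<and>
     (\<forall>x\<in>U. f differentiable (at x)) \<and>
     (\<exists>G. continuous_on (closure U) G \<and> (\<forall>x\<in>U. G x = grad f x))"

definition grad_bd :: "'a::euclidean_space set \<Rightarrow> ('a \<Rightarrow> real) \<Rightarrow> 'a \<Rightarrow> 'a" where
  "grad_bd U f x = Lim (at x within U) (grad f)"


section \<open>Domains with \<open>C\<^sup>2\<close> boundary, outward normal and surface integral\<close>

text \<open>Inside the ball, \<open>U\<close> is the strict epigraph, in the coordinate direction \<open>e\<close> (of either
  sign), of a \<open>C\<^sup>2\<close> function of the remaining coordinates. Such a function is encoded as a
  function \<open>\<gamma>\<close> on the whole space that is constant along \<open>e\<close>.\<close>

definition graph_chart ::
  "'a::euclidean_space set \<Rightarrow> 'a \<Rightarrow> real \<Rightarrow> 'a \<Rightarrow> ('a \<Rightarrow> real) \<Rightarrow> bool" where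
  "graph_chart U c r e \<gamma> \<longleftrightarrow>
     r > 0 \<and> (e \<in> Basis \<or> - e \<in> Basis) \<and>
     (\<forall>y s. \<gamma> (y + s *\<^sub>R e) = \<gamma> y) \<and> C2_on UNIV \<gamma> \<and>
     U \<inter> ball c r = {x \<in> ball c r. \<gamma> x < x \<bullet> e}"

definition bounded_C2_domain :: "'a::euclidean_space set \<Rightarrow> bool" where
  "bounded_C2_domain U \<longleftrightarrow>
     open U \<and> connected U \<and> U \<noteq> {} \<and> bounded U \<and>
     (\<forall>c\<in>frontier U. \<exists>r e \<gamma>. graph_chart U c r e \<gamma>)"

text \<open>The unit vector \<open>\<nu>\<close> such that, to first order at \<open>x\<close>, the set \<open>U\<close> is the half-space
  \<open>{x + h | h. h \<bullet> \<nu> < 0}\<close>.\<close>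

definition outward_normal :: "'a::euclidean_space set \<Rightarrow> 'a \<Rightarrow> 'a" where
  "outward_normal U x = (THE \<nu>. norm \<nu> = 1 \<and>
     (\<forall>\<epsilon>>0. \<exists>\<delta>>0. \<forall>h. norm h < \<delta> \<longrightarrow>
        (h \<bullet> \<nu> < - \<epsilon> * norm h \<longrightarrow> x + h \<in> U) \<and>
        (h \<bullet> \<nu> > \<epsilon> * norm h \<longrightarrow> x + h \<notin> U)))"

definition graph_lift :: "'a::euclidean_space \<Rightarrow> ('a \<Rightarrow> real) \<Rightarrow> 'a \<Rightarrow> 'a" where
  "graph_lift e \<gamma> y = y + (\<gamma> y - y \<bullet> e) *\<^sub>R e"

text \<open>The integral of \<open>f\<close> over the graph of \<open>\<gamma>\<close> with respect to the surface element
  \<open>sqrt (1 + \<bar>\<nabla>\<gamma>\<bar>\<^sup>2)\<close>. The integral over the hyperplane orthogonal to \<open>e\<close> is written as an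
  integral over the slab of thickness 1 above it, on which the integrand is constant
  along \<open>e\<close>.\<close>

definition graph_integral ::
  "'a::euclidean_space \<Rightarrow> ('a \<Rightarrow> real) \<Rightarrow> ('a \<Rightarrow> real) \<Rightarrow> real" where
  "graph_integral e \<gamma> f =
     (LINT y:{y. 0 \<le> y \<bullet> e \<and> y \<bullet> e \<le> 1}|lborel.
        f (graph_lift e \<gamma> y) * sqrt (1 + (norm (grad \<gamma> y))\<^sup>2))"

text \<open>A finite family of graph charts \<open>(c k, r k, e k, \<gamma> k)\<close>, \<open>k < m\<close>, covering the boundary, with
  a subordinate partition of unity \<open>\<eta> k\<close>.\<close>

definition boundary_atlas ::
  "'a::euclidean_space set \<Rightarrow> nat \<Rightarrow> (nat \<Rightarrow> 'a) \<Rightarrow> (nat \<Rightarrow> real) \<Rightarrow> (nat \<Rightarrow> 'a) \<Rightarrow>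
     (nat \<Rightarrow> 'a \<Rightarrow> real) \<Rightarrow> (nat \<Rightarrow> 'a \<Rightarrow> real) \<Rightarrow> bool" where
  "boundary_atlas U m c r e \<gamma> \<eta> \<longleftrightarrow>
     (\<forall>k<m. graph_chart U (c k) (r k) (e k) (\<gamma> k) \<and>
            C2_on UNIV (\<eta> k) \<and> (\<forall>x. 0 \<le> \<eta> k x) \<and>
            closure {x. \<eta> k x \<noteq> 0} \<subseteq> ball (c k) (r k)) \<and>
     (\<forall>x\<in>frontier U. (\<Sum>k<m. \<eta> k x) = 1)"

text \<open>The surface integral of \<open>f\<close> over a Borel part \<open>\<Gamma>\<close> of the boundary of \<open>U\<close>, computed with one
  (arbitrary) atlas and partition of unity; the usual value does not depend on that choice.\<close>

definition surface_integral ::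
  "'a::euclidean_space set \<Rightarrow> 'a set \<Rightarrow> ('a \<Rightarrow> real) \<Rightarrow> real" where
  "surface_integral U \<Gamma> f =
     (case (SOME (m, c, r, e, \<gamma>, \<eta>). boundary_atlas U m c r e \<gamma> \<eta>) of (m, c, r, e, \<gamma>, \<eta>) \<Rightarrow>
        (\<Sum>k<m. graph_integral (e k) (\<gamma> k) (\<lambda>x. indicator \<Gamma> x * \<eta> k x * f x)))"


section \<open>Darcy flow of an ideal gas\<close>

definition steady_solution ::
  "'a::euclidean_space set \<Rightarrow> 'a set \<Rightarrow> 'a set \<Rightarrow> real \<Rightarrow> ('a \<Rightarrow> real) \<Rightarrow> bool" where
  "steady_solution U \<Gamma>e \<Gamma>i A W \<longleftrightarrow>
     C2_on U W \<and> C1_closure U W \<and>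
     (\<forall>x\<in>U. - laplacian W x = A) \<and>
     (\<forall>x\<in>\<Gamma>i. W x = 0) \<and>
     (\<forall>x\<in>\<Gamma>e. grad_bd U W x \<bullet> outward_normal U x = 0)"

definition aux_pressure :: "real \<Rightarrow> ('a \<Rightarrow> real) \<Rightarrow> real \<Rightarrow> 'a \<Rightarrow> real \<Rightarrow> real" where
  "aux_pressure A W B x t = sqrt ((B - A * t)\<^sup>2 + 2 * W x)"

text \<open>Class \<open>C\<^sup>2\<^sup>,\<^sup>1\<close> in the interior (up to \<open>t = 0\<close>, so that the derivatives of \<open>p\<close> make sense for
  \<open>0 \<le> t \<le> T\<close>), continuous up to the boundary and the initial time, and with spatial gradient
  continuous up to the boundary for \<open>0 < t \<le> T\<close>, so that the fluxes make sense.\<close>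

definition classical_regularity ::
  "'a::euclidean_space set \<Rightarrow> real \<Rightarrow> ('a \<Rightarrow> real \<Rightarrow> real) \<Rightarrow> bool" where
  "classical_regularity U T p \<longleftrightarrow>
     continuous_on (closure U \<times> {0..T}) (\<lambda>(x, t). p x t) \<and>
     (\<forall>x\<in>U. \<forall>t\<in>{0..T}. p x differentiable (at t within {0..T})) \<and>
     continuous_on (U \<times> {0..T}) (\<lambda>(x, t). time_deriv T p x t) \<and>
     (\<forall>t\<in>{0..T}. C2_on U (\<lambda>y. p y t)) \<and>
     continuous_on (U \<times> {0..T}) (\<lambda>(x, t). grad (\<lambda>y. p y t) x) \<and>
     (\<forall>b\<in>Basis. continuous_on (U \<times> {0..T})
        (\<lambda>(x, t). frechet_derivative (grad (\<lambda>y. p y t)) (at x) b)) \<and>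
     (\<exists>G. continuous_on (closure U \<times> {0<..T}) G \<and>
        (\<forall>x\<in>U. \<forall>t\<in>{0<..T}. G (x, t) = grad (\<lambda>y. p y t) x))"

definition gas_solution ::
  "'a::euclidean_space set \<Rightarrow> 'a set \<Rightarrow> 'a set \<Rightarrow> real \<Rightarrow> ('a \<Rightarrow> real) \<Rightarrow> real \<Rightarrow> real \<Rightarrow>
     ('a \<Rightarrow> real \<Rightarrow> real) \<Rightarrow> bool" where
  "gas_solution U \<Gamma>e \<Gamma>i A W T B p \<longleftrightarrow>
     classical_regularity U T p \<and>
     (\<forall>x\<in>closure U. \<forall>t\<in>{0..T}. p x t > 0) \<and>
     (\<forall>x\<in>U. \<forall>t\<in>{0<..T}.
        time_deriv T p x t = divergence (\<lambda>y. p y t *\<^sub>R grad (\<lambda>z. p z t) y) x) \<and>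
     (\<forall>x\<in>\<Gamma>i. \<forall>t\<in>{0<..T}. p x t = B - A * t) \<and>
     (\<forall>x\<in>\<Gamma>e. \<forall>t\<in>{0<..T}. p x t * (grad_bd U (\<lambda>y. p y t) x \<bullet> outward_normal U x) = 0) \<and>
     (\<forall>x\<in>U. p x 0 = aux_pressure A W B x 0)"

definition flux ::
  "'a::euclidean_space set \<Rightarrow> 'a set \<Rightarrow> ('a \<Rightarrow> real \<Rightarrow> real) \<Rightarrow> real \<Rightarrow> real" where
  "flux U \<Gamma>i p t =
     - surface_integral U \<Gamma>i (\<lambda>x. p x t * (grad_bd U (\<lambda>y. p y t) x \<bullet> outward_normal U x))"

definition productivity_index ::
  "'a::euclidean_space set \<Rightarrow> 'a set \<Rightarrow> ('a \<Rightarrow> real \<Rightarrow> real) \<Rightarrow> real \<Rightarrow> real" where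
  "productivity_index U \<Gamma>i p t =
     flux U \<Gamma>i p t /
       (1 / measure lborel U * (LINT x:U|lborel. (p x t)\<^sup>2)
        - 1 / surface_integral U \<Gamma>i (\<lambda>_. 1) * surface_integral U \<Gamma>i (\<lambda>x. (p x t)\<^sup>2))"

end

theory Submission
  imports Defs
begin

text \<open>Write \<open>v = p\<^sup>2\<close> and \<open>q = p\<^sub>t + A\<close>. The flow equation says \<open>\<Delta>v = 2 p\<^sub>t\<close>, while the square
\<open>(B - A t)\<^sup>2 + 2 W\<close> of the auxiliary pressure has the Laplacian \<open>- 2 A\<close> and the same boundary
data; so \<open>q\<close> measures how far \<open>p\<close> is from the auxiliary pressure. By the divergence theorem the
flux of \<open>p\<close> is \<open>A |U| - \<integral>q\<close>, and the flux of the auxiliary pressure is \<open>A |U|\<close>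
(\<open>flux_eq\<close>, \<open>aux_flux\<close>). The difference \<open>u\<close> of the two squares satisfies the homogeneous mixed
boundary conditions, as \<open>W\<close> does, and \<open>\<Delta>u = 2 q\<close>; Green's second identity for \<open>u\<close> and \<open>W\<close>
gives \<open>A \<integral>u = - 2 \<integral>W q\<close> (\<open>mean_square_near\<close>). Thus numerator and denominator of the two
indices differ by at most constant multiples of \<open>\<integral>|q|\<close>, and the limiting denominator is not zero because
\<open>A \<integral>W = \<integral>|\<nabla>W|\<^sup>2 > 0\<close> (\<open>integral_W_pos\<close>). At \<open>t = 0\<close> the two indices agree.

It remains to show that \<open>\<integral>|q|\<close> is small at each single time \<open>t\<close> (\<open>rate_L1\<close>). Differentiating the
equation in time is not possible for a classical solution, so difference quotients take the place
of \<open>q\<close>. For \<open>h > 0\<close> let \<open>d = p(t + h) - p(t) + A h\<close> and \<open>P = p(t + h) + p(t)\<close>. The increment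
\<open>v(t + h) - v(t)\<close>, less its constant value on \<open>\<Gamma>\<^sub>i\<close>, is a function \<open>w\<close> with homogeneous boundary
conditions and \<open>\<Delta>w = 2 d\<^sub>t\<close>; hence \<open>\<integral>w d\<^sub>t = - 1/2 \<integral>|\<nabla>w|\<^sup>2 \<le> 0\<close> (\<open>energy_dissipation\<close>). On the other
hand \<open>w = P d - A h S\<close>, where \<open>S\<close> is the deviation of \<open>P\<close> from its boundary value. The bound on
\<open>p\<^sub>t\<close> makes \<open>S\<close> bounded and \<open>d\<close> of order \<open>h\<close>, uniformly in \<open>B\<close>, so that \<open>\<integral>P d\<^sup>2\<close> can grow in time
by at most a constant times \<open>h\<^sup>2\<close> (\<open>shifted_energy\<close>). Dividing by \<open>h\<^sup>2\<close> and letting \<open>h\<close> tend to \<open>0\<close>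
removes the initial term, since \<open>q = 0\<close> initially, and leaves \<open>2 (B - const) \<integral>q\<^sup>2 \<le> const\<close>
(\<open>rate_L2\<close>).

The divergence theorem is needed for fields that are only continuous up to a \<open>C\<^sup>2\<close> boundary and have a
bounded divergence, with the surface integral computed in an arbitrary atlas. It is reduced to one
fact about the whole space: a directional derivative of a compactly supported function has integral
zero (\<open>integral_directional_derivative_eq_0\<close>). A partition of unity splits the field. The part
inside a chart is multiplied by a cut-off function of the height above the boundary graph, and the
gradient of the cut-off concentrates on the graph (\<open>divergence_chart\<close>). The remaining part carries a
factor that vanishes on the boundary and contributes nothing (\<open>integral_divergence_vanishing_square\<close>).\<close>

section \<open>Gradient, divergence and Laplacian\<close>

lemma has_derivative_grad:
  assumes "f differentiable (at x)"
  shows "(f has_derivative (\<lambda>h. grad f x \<bullet> h)) (at x)"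
proof -
  have lin: "linear (frechet_derivative f (at x))"
    using assms frechet_derivative_works has_derivative_linear by blast
  have "frechet_derivative f (at x) h = grad f x \<bullet> h" for h
  proof -
    have "frechet_derivative f (at x) h
        = frechet_derivative f (at x) (\<Sum>b\<in>Basis. (h \<bullet> b) *\<^sub>R b)"
      by (simp add: euclidean_representation)
    also have "\<dots> = (\<Sum>b\<in>Basis. (h \<bullet> b) * frechet_derivative f (at x) b)"
      by (simp add: linear_sum[OF lin] linear_cmul[OF lin])
    also have "\<dots> = grad f x \<bullet> h"
      by (simp add: grad_def inner_sum_left inner_commute[of h] mult.commute)
    finally show ?thesis .
  qed
  then show ?thesis
    using assms frechet_derivative_works by (metis (no_types, lifting) ext)
qed

lemma grad_eqI:
  assumes "(f has_derivative (\<lambda>h. g \<bullet> h)) (at x)"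
  shows "grad f x = g"
proof -
  have "frechet_derivative f (at x) = (\<lambda>h. g \<bullet> h)"
    using assms frechet_derivative_at by metis
  then show ?thesis
    by (simp add: grad_def euclidean_representation)
qed

lemma divergence_eqI:
  assumes "(F has_derivative F') (at x)"
  shows "divergence F x = (\<Sum>b\<in>Basis. F' b \<bullet> b)"
  using assms frechet_derivative_at unfolding divergence_def by metis

text \<open>Continuity of the derivative is tested on basis vectors, as in the class \<open>C\<^sup>2\<close> of scalar functions, so
that the gradient of a \<open>C\<^sup>2\<close> function is a \<open>C\<^sup>1\<close> field without further argument.\<close>

definition C1_field :: "'a::euclidean_space set \<Rightarrow> ('a \<Rightarrow> 'a) \<Rightarrow> bool" where
  "C1_field U F \<longleftrightarrow> (\<forall>x\<in>U. F differentiable (at x)) \<and>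
     (\<forall>b\<in>Basis. continuous_on U (\<lambda>x. frechet_derivative F (at x) b))"

definition C1_scalar :: "'a::euclidean_space set \<Rightarrow> ('a \<Rightarrow> real) \<Rightarrow> bool" where
  "C1_scalar U f \<longleftrightarrow> (\<forall>x\<in>U. f differentiable (at x)) \<and> continuous_on U (grad f)"

lemma C1_scalarI:
  assumes "\<And>x. x \<in> U \<Longrightarrow> (f has_derivative (\<lambda>h. g x \<bullet> h)) (at x)" "continuous_on U g"
  shows "C1_scalar U f" "\<And>x. x \<in> U \<Longrightarrow> grad f x = g x"
proof -
  show e: "grad f x = g x" if "x \<in> U" for x using grad_eqI[OF assms(1)[OF that]] .
  show "C1_scalar U f" unfolding C1_scalar_def
    using e assms continuous_on_cong differentiableI by metis
qed

lemma C1_fieldI: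
  assumes "\<And>x. x \<in> U \<Longrightarrow> (F has_derivative F' x) (at x)"
    and "\<And>b. b \<in> Basis \<Longrightarrow> continuous_on U (\<lambda>x. F' x b)"
  shows "C1_field U F"
proof -
  have "frechet_derivative F (at x) = F' x" if "x \<in> U" for x
    using frechet_derivative_at[OF assms(1)[OF that]] by simp
  then have "continuous_on U (\<lambda>x. frechet_derivative F (at x) b)" if "b \<in> Basis" for b
    using assms(2)[OF that] by (simp cong: continuous_on_cong)
  then show ?thesis unfolding C1_field_def
    using assms(1) differentiableI by blast
qed

lemma C1_fieldD:
  assumes "C1_field U F" "x \<in> U"
  shows "(F has_derivative frechet_derivative F (at x)) (at x)"
  using assms unfolding C1_field_def by (simp add: frechet_derivative_works[symmetric])

lemma C1_field_imp_continuous_on: "C1_field U F \<Longrightarrow> continuous_on U F"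
  unfolding C1_field_def
  by (meson continuous_at_imp_continuous_on differentiable_imp_continuous_within)

lemma C1_scalar_imp_continuous_on: "C1_scalar U f \<Longrightarrow> continuous_on U f"
  unfolding C1_scalar_def
  by (meson continuous_at_imp_continuous_on differentiable_imp_continuous_within)

lemma continuous_on_divergence: "C1_field U F \<Longrightarrow> continuous_on U (divergence F)"
  unfolding C1_field_def divergence_def[abs_def] by (intro continuous_intros) auto

lemma C1_scalar_subset: "C1_scalar U f \<Longrightarrow> V \<subseteq> U \<Longrightarrow> C1_scalar V f"
  unfolding C1_scalar_def using continuous_on_subset by blast

lemma scaled_field:
  assumes f: "C1_scalar U f" and F: "C1_field U F"
  shows C1_field_scaleR: "C1_field U (\<lambda>x. f x *\<^sub>R F x)"
    and divergence_scaleR: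
      "\<And>x. x \<in> U \<Longrightarrow> divergence (\<lambda>x. f x *\<^sub>R F x) x = f x * divergence F x + grad f x \<bullet> F x"
proof -
  let ?H = "\<lambda>x h. f x *\<^sub>R frechet_derivative F (at x) h + (grad f x \<bullet> h) *\<^sub>R F x"
  have d: "((\<lambda>x. f x *\<^sub>R F x) has_derivative ?H x) (at x)" if "x \<in> U" for x
    using has_derivative_scaleR[OF has_derivative_grad C1_fieldD[OF F that], of f] f that
    by (simp add: C1_scalar_def)
  show "C1_field U (\<lambda>x. f x *\<^sub>R F x)"
    by (rule C1_fieldI[OF d])
      (use f F C1_field_imp_continuous_on[OF F] C1_scalar_imp_continuous_on[OF f] in
        \<open>auto simp: C1_scalar_def C1_field_def intro!: continuous_intros\<close>)
  show "divergence (\<lambda>x. f x *\<^sub>R F x) x = f x * divergence F x + grad f x \<bullet> F x" if "x \<in> U" for x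
  proof -
    have "(\<Sum>b\<in>Basis. (grad f x \<bullet> b) * (F x \<bullet> b)) = grad f x \<bullet> F x"
      by (rule euclidean_inner[symmetric])
    then show ?thesis unfolding divergence_eqI[OF d[OF that]] unfolding divergence_def
      by (simp add: inner_add_left sum.distrib sum_distrib_left)
  qed
qed

lemma added_field:
  assumes F: "C1_field U F" and G: "C1_field U G"
  shows C1_field_add: "C1_field U (\<lambda>x. F x + G x)"
    and divergence_add: "\<And>x. x \<in> U \<Longrightarrow> divergence (\<lambda>x. F x + G x) x = divergence F x + divergence G x"
proof -
  have d: "((\<lambda>x. F x + G x) has_derivative
      (\<lambda>h. frechet_derivative F (at x) h + frechet_derivative G (at x) h)) (at x)" if "x \<in> U" for x
    by (intro has_derivative_add C1_fieldD[OF F that] C1_fieldD[OF G that])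
  show "C1_field U (\<lambda>x. F x + G x)"
    by (rule C1_fieldI[OF d]) (use F G in \<open>auto simp: C1_field_def intro!: continuous_intros\<close>)
  show "divergence (\<lambda>x. F x + G x) x = divergence F x + divergence G x" if "x \<in> U" for x
    unfolding divergence_eqI[OF d[OF that]] unfolding divergence_def
    by (simp add: inner_add_left sum.distrib)
qed

lemma divergence_sum:
  assumes "\<And>i. i \<in> I \<Longrightarrow> C1_field U (F i)" "x \<in> U"
  shows "divergence (\<lambda>x. \<Sum>i\<in>I. F i x) x = (\<Sum>i\<in>I. divergence (F i) x)"
proof -
  have d: "((\<lambda>x. \<Sum>i\<in>I. F i x) has_derivative (\<lambda>h. \<Sum>i\<in>I. frechet_derivative (F i) (at x) h)) (at x)"
    by (intro has_derivative_sum C1_fieldD[OF assms(1)] assms(2))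
  show ?thesis
    unfolding divergence_eqI[OF d] unfolding divergence_def inner_sum_left by (rule sum.swap)
qed

text \<open>All differential operators are local. This allows a field on \<open>U\<close> to be exchanged with its continuous
extension to the closure, or with its extension by zero.\<close>

lemma fields_agree:
  assumes "open U" "\<And>x. x \<in> U \<Longrightarrow> F x = G x" and F: "C1_field U F"
  shows C1_field_cong: "C1_field U G"
    and divergence_cong: "\<And>x. x \<in> U \<Longrightarrow> divergence G x = divergence F x"
proof -
  have d: "(G has_derivative frechet_derivative F (at x)) (at x)" if "x \<in> U" for x
    using has_derivative_transform_within_open[OF C1_fieldD[OF F that] assms(1) that assms(2)] by simp
  show "C1_field U G"
    by (rule C1_fieldI[OF d]) (use F in \<open>auto simp: C1_field_def\<close>)
  show "divergence G x = divergence F x" if "x \<in> U" for x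
    unfolding divergence_eqI[OF d[OF that]] unfolding divergence_def ..
qed

lemma C2_on_grad_field: "C2_on U f \<Longrightarrow> C1_field U (grad f)"
  by (auto simp: C2_on_def C1_field_def)

lemma C2_on_imp_C1_scalar: "C2_on U f \<Longrightarrow> C1_scalar U f"
  using C2_on_grad_field[of U f] C1_field_imp_continuous_on by (auto simp: C2_on_def C1_scalar_def)

lemma C2_onI:
  assumes "open U" "\<And>x. x \<in> U \<Longrightarrow> (f has_derivative (\<lambda>h. g x \<bullet> h)) (at x)" "C1_field U g"
  shows "C2_on U f" "\<And>x. x \<in> U \<Longrightarrow> grad f x = g x" "\<And>x. x \<in> U \<Longrightarrow> laplacian f x = divergence g x"
proof -
  show e: "grad f x = g x" if "x \<in> U" for x using grad_eqI[OF assms(2)[OF that]] .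
  have "C1_field U (grad f)" using C1_field_cong[OF assms(1) e[symmetric] assms(3)] .
  then show "C2_on U f" unfolding C2_on_def C1_field_def using assms(2) differentiableI by metis
  show "laplacian f x = divergence g x" if "x \<in> U" for x
    unfolding laplacian_def using divergence_cong[OF assms(1) e[symmetric] assms(3) that] .
qed

lemma C2_on_const: "open U \<Longrightarrow> C2_on U (\<lambda>x. c)"
  by (rule C2_onI(1)[where g = "\<lambda>x. 0"]) (auto intro!: C1_fieldI[where F'="\<lambda>x h. 0"])

lemma C2_on_add:
  assumes U: "open U" and f: "C2_on U f" and g: "C2_on U g"
  shows "C2_on U (\<lambda>x. f x + g x)"
proof (rule C2_onI(1)[OF U])
  show "((\<lambda>x. f x + g x) has_derivative (\<lambda>h. (grad f x + grad g x) \<bullet> h)) (at x)" if "x \<in> U" for x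
    using has_derivative_add[OF has_derivative_grad has_derivative_grad, of f x g] f g that
    by (simp add: C2_on_def inner_add_left)
qed (intro C1_field_add C2_on_grad_field f g)

lemma C2_on_mult:
  assumes U: "open U" and f: "C2_on U f" and g: "C2_on U g"
  shows "C2_on U (\<lambda>x. f x * g x)"
    and "\<And>x. x \<in> U \<Longrightarrow> grad (\<lambda>x. f x * g x) x = f x *\<^sub>R grad g x + g x *\<^sub>R grad f x"
    and "\<And>x. x \<in> U \<Longrightarrow> laplacian (\<lambda>x. f x * g x) x
           = f x * laplacian g x + g x * laplacian f x + 2 * (grad f x \<bullet> grad g x)"
proof -
  have d: "((\<lambda>x. f x * g x) has_derivative (\<lambda>h. (f x *\<^sub>R grad g x + g x *\<^sub>R grad f x) \<bullet> h)) (at x)"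
    if "x \<in> U" for x
    using has_derivative_mult[OF has_derivative_grad has_derivative_grad, of f x g] f g that
    by (simp add: C2_on_def inner_add_left mult.commute)
  note 1 = scaled_field[OF C2_on_imp_C1_scalar[OF f] C2_on_grad_field[OF g]]
  note 2 = scaled_field[OF C2_on_imp_C1_scalar[OF g] C2_on_grad_field[OF f]]
  note a = added_field[OF 1(1) 2(1)]
  note r = C2_onI[OF U d a(1)]
  show "C2_on U (\<lambda>x. f x * g x)" using r(1) by simp
  show "\<And>x. x \<in> U \<Longrightarrow> grad (\<lambda>x. f x * g x) x = f x *\<^sub>R grad g x + g x *\<^sub>R grad f x" using r(2) by simp
  show "laplacian (\<lambda>x. f x * g x) x
           = f x * laplacian g x + g x * laplacian f x + 2 * (grad f x \<bullet> grad g x)" if "x \<in> U" for x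
    using r(3)[of x] a(2)[OF that] 1(2)[OF that] 2(2)[OF that] that
    by (simp add: laplacian_def inner_commute)
qed

lemma C2_on_sum:
  assumes U: "open U" and "finite I" and f: "\<And>i. i \<in> I \<Longrightarrow> C2_on U (f i)"
  shows "C2_on U (\<lambda>x. \<Sum>i\<in>I. f i x)"
  using assms(2) f by (induction I) (auto simp: C2_on_const[OF U] intro: C2_on_add[OF U])

lemma C1_scalar_compose:
  assumes f: "C1_scalar U f"
    and g: "\<And>s. s \<in> f ` U \<Longrightarrow> (g has_real_derivative g' s) (at s)" and c: "continuous_on (f ` U) g'"
  shows "C1_scalar U (\<lambda>x. g (f x))"
    and "\<And>x. x \<in> U \<Longrightarrow> grad (\<lambda>x. g (f x)) x = g' (f x) *\<^sub>R grad f x"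
    and "\<And>x. x \<in> U \<Longrightarrow> ((\<lambda>x. g (f x)) has_derivative (\<lambda>h. (g' (f x) *\<^sub>R grad f x) \<bullet> h)) (at x)"
proof -
  show d: "((\<lambda>x. g (f x)) has_derivative (\<lambda>h. (g' (f x) *\<^sub>R grad f x) \<bullet> h)) (at x)" if "x \<in> U" for x
  proof -
    have "(g has_derivative (*) (g' (f x))) (at (f x))"
      using g that by (simp add: has_field_derivative_def)
    from has_derivative_compose[where f=f and f'="\<lambda>h. grad f x \<bullet> h" and s=UNIV, OF _ this] show ?thesis
      using f that has_derivative_grad[of f x] by (simp add: C1_scalar_def)
  qed
  have c': "continuous_on U (\<lambda>x. g' (f x) *\<^sub>R grad f x)"
    using f C1_scalar_imp_continuous_on[OF f] continuous_on_compose[of U f g'] c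
    by (auto simp: C1_scalar_def o_def intro!: continuous_intros)
  show "C1_scalar U (\<lambda>x. g (f x))" 
    and "\<And>x. x \<in> U \<Longrightarrow> grad (\<lambda>x. g (f x)) x = g' (f x) *\<^sub>R grad f x"
    using C1_scalarI[OF d c'] by auto
qed

lemma C2_on_compose:
  assumes U: "open U" and f: "C2_on U f"
    and g: "\<And>s. s \<in> f ` U \<Longrightarrow> (g has_real_derivative g' s) (at s)"
    and g': "\<And>s. s \<in> f ` U \<Longrightarrow> (g' has_real_derivative g'' s) (at s)"
    and c: "continuous_on (f ` U) g''"
  shows "C2_on U (\<lambda>x. g (f x))"
proof -
  have c': "continuous_on (f ` U) g'"
    using g' by (meson DERIV_isCont continuous_at_imp_continuous_on)
  note f1 = C2_on_imp_C1_scalar[OF f]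
  show ?thesis
    by (rule C2_onI(1)[OF U C1_scalar_compose(3)[OF f1 g c']
      C1_field_scaleR[OF C1_scalar_compose(1)[OF f1 g' c] C2_on_grad_field[OF f]]])
qed

text \<open>Powers of the positive part are the building blocks of all cut-off functions below: the power \<open>n + 1\<close>
is of class \<open>C\<^sup>n\<close> across \<open>0\<close>.\<close>

lemma pos_part_power_derivative:
  assumes "n > 0"
  shows "((\<lambda>s::real. (max 0 s) ^ Suc n) has_real_derivative of_nat (Suc n) * (max 0 s) ^ n) (at s)"
proof (cases s "0::real" rule: linorder_cases)
  case less
  have "((\<lambda>s::real. 0) has_real_derivative 0) (at s)" by simp
  then have "((\<lambda>s::real. (max 0 s) ^ Suc n) has_real_derivative 0) (at s)"
    by (rule has_field_derivative_transform_within_open[where S="{..<0}"]) (use less in auto)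
  then show ?thesis using less assms by (simp add: power_0_left del: power_Suc)
next
  case greater
  have "((\<lambda>s::real. s ^ Suc n) has_real_derivative of_nat (Suc n) * s ^ n) (at s)"
    using DERIV_pow[of "Suc n" s UNIV] by (simp del: power_Suc)
  then have "((\<lambda>s::real. (max 0 s) ^ Suc n) has_real_derivative of_nat (Suc n) * s ^ n) (at s)"
    by (rule has_field_derivative_transform_within_open[where S="{0<..}"]) (use greater in auto)
  then show ?thesis using greater by simp
next
  case equal
  have "((\<lambda>h::real. (max 0 h) ^ Suc n / h) \<longlongrightarrow> 0) (at 0)"
  proof (rule Lim_null_comparison)
    show "\<forall>\<^sub>F h::real in at 0. norm ((max 0 h) ^ Suc n / h) \<le> \<bar>h\<bar> ^ n"
    proof (intro always_eventually allI)
      fix h :: real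
      show "norm ((max 0 h) ^ Suc n / h) \<le> \<bar>h\<bar> ^ n" by (cases "h \<le> 0") (auto simp: max_def)
    qed
    show "((\<lambda>h::real. \<bar>h\<bar> ^ n) \<longlongrightarrow> 0) (at 0)"
      using assms by (auto intro!: tendsto_eq_intros)
  qed
  then show ?thesis using equal assms by (simp add: DERIV_def power_0_left del: power_Suc)
qed

section \<open>Integrals of divergences over the whole space\<close>

lemma integrable_bounded_support:
  fixes f :: "'a::euclidean_space \<Rightarrow> real"
  assumes [measurable]: "f \<in> borel_measurable borel"
    and M: "\<And>x. \<bar>f x\<bar> \<le> M" and R: "\<And>x. norm x > R \<Longrightarrow> f x = 0"
  shows "integrable lborel f"
proof -
  have "integrable lborel (\<lambda>x. indicator (cball 0 R) x *\<^sub>R f x)"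
    using emeasure_lborel_cball_finite[of 0 R]
    by (intro integrableI_bounded_set_indicator[where B=M]) (use M in auto)
  moreover have "(\<lambda>x. indicator (cball 0 R) x *\<^sub>R f x) = f"
    using R by (auto simp: indicator_def fun_eq_iff not_le)
  ultimately show ?thesis by simp
qed

lemma lborel_integral_translate:
  fixes f :: "'a::euclidean_space \<Rightarrow> real"
  assumes f: "f \<in> borel_measurable borel"
  shows "(LINT x|lborel. f (x + c)) = (LINT x|lborel. f x)"
proof -
  have "(LINT x|lborel. f x) = (LINT x|distr lborel borel ((+) c). f x)"
    by (simp add: lborel_distr_plus)
  also have "\<dots> = (LINT x|lborel. f (c + x))"
    using f by (subst integral_distr) auto
  finally show ?thesis by (simp add: add.commute)
qed

text \<open>The difference quotients of \<open>f\<close> in the direction \<open>b\<close> have integral zero because Lebesgue measure is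
translation invariant, and they converge boundedly to the derivative.\<close>

lemma integral_directional_derivative_eq_0:
  fixes f :: "'a::euclidean_space \<Rightarrow> real"
  assumes d: "\<And>x. (f has_derivative f' x) (at x)"
    and M: "\<And>x. \<bar>f' x b\<bar> \<le> M" and R: "\<And>x. norm x > R \<Longrightarrow> f x = 0"
  shows "integrable lborel (\<lambda>x. f' x b)" and "(LINT x|lborel. f' x b) = 0"
proof -
  define q where "q n x = (f (x + inverse (real (Suc n)) *\<^sub>R b) - f x) / inverse (real (Suc n))" for n x
  have cont: "continuous_on UNIV f"
    by (intro continuous_at_imp_continuous_on ballI has_derivative_continuous[OF d])
  then have [measurable]: "f \<in> borel_measurable borel"
    by (rule borel_measurable_continuous_onI)
  have q_meas: "q n \<in> borel_measurable borel" for n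
    unfolding q_def[abs_def] by measurable
  obtain K where K: "\<And>x. \<bar>f x\<bar> \<le> K"
  proof -
    have "compact (f ` cball 0 R)"
      by (intro compact_continuous_image continuous_on_subset[OF cont]) auto
    then obtain K where "\<And>x. x \<in> cball 0 R \<Longrightarrow> \<bar>f x\<bar> \<le> K"
      using compact_imp_bounded[of "f ` cball 0 R"] unfolding bounded_iff real_norm_def by (metis imageI)
    then have "\<bar>f x\<bar> \<le> max K 0" for x
      using R[of x] by (cases "norm x \<le> R") (force simp: not_le)+
    then show ?thesis using that by blast
  qed
  have f_int: "integrable lborel (\<lambda>x. f (x + c))" for c
    using K R by (intro integrable_bounded_support[where M=K and R="R + norm c"])
      (measurable, smt (verit) norm_diff_ineq add.commute add_diff_cancel)
  have q_0: "(LINT x|lborel. q n x) = 0" for n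
    using f_int[of 0] f_int lborel_integral_translate[of f]
    unfolding q_def by (simp del: of_nat_Suc)
  have lim: "(\<lambda>n. q n x) \<longlonglongrightarrow> f' x b" for x
  proof -
    have lin: "linear (f' x)" using d has_derivative_linear by blast
    have "((\<lambda>s. x + s *\<^sub>R b) has_derivative (\<lambda>s. s *\<^sub>R b)) (at 0)"
      by (auto intro!: derivative_eq_intros)
    from has_derivative_compose[OF this, of f "f' x"] d[of x]
    have "((\<lambda>s. f (x + s *\<^sub>R b)) has_derivative (\<lambda>s. f' x b * s)) (at 0)"
      by (simp add: linear_cmul[OF lin] mult.commute)
    then have "((\<lambda>s. f (x + s *\<^sub>R b)) has_real_derivative f' x b) (at 0)"
      by (simp add: has_field_derivative_def)
    then have "((\<lambda>h. (f (x + h *\<^sub>R b) - f x) / h) \<longlongrightarrow> f' x b) (at 0)"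
      by (simp add: DERIV_def)
    moreover have "filterlim (\<lambda>n. inverse (real (Suc n))) (at 0) sequentially"
      using LIMSEQ_inverse_real_of_nat by (auto simp: filterlim_at simp del: of_nat_Suc)
    ultimately show ?thesis
      unfolding q_def by (rule filterlim_compose)
  qed
  have bound: "\<bar>q n x\<bar> \<le> M" for n x
  proof -
    let ?h = "inverse (real (Suc n))"
    have h: "?h > 0" by simp
    have "\<exists>s. 0 < s \<and> s < ?h \<and> f (x + ?h *\<^sub>R b) - f (x + 0 *\<^sub>R b) = (?h - 0) * f' (x + s *\<^sub>R b) b"
    proof (rule MVT2[OF h])
      fix s :: real
      have lin: "linear (f' (x + s *\<^sub>R b))" using d has_derivative_linear by blast
      have "((\<lambda>s. x + s *\<^sub>R b) has_derivative (\<lambda>s. s *\<^sub>R b)) (at s)"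
        by (auto intro!: derivative_eq_intros)
      from has_derivative_compose[OF this d]
      have "((\<lambda>s. f (x + s *\<^sub>R b)) has_derivative (\<lambda>t. f' (x + s *\<^sub>R b) b * t)) (at s)"
        by (simp add: linear_cmul[OF lin] mult.commute)
      then show "((\<lambda>s. f (x + s *\<^sub>R b)) has_real_derivative f' (x + s *\<^sub>R b) b) (at s)"
        by (simp add: has_field_derivative_def)
    qed
    then obtain s where "f (x + ?h *\<^sub>R b) - f x = ?h * f' (x + s *\<^sub>R b) b" by auto
    then have "q n x = f' (x + s *\<^sub>R b) b" unfolding q_def using h by (simp del: of_nat_Suc)
    then show ?thesis using M by simp
  qed
  have supp: "q n x = 0" if "norm x > R + norm b" for n x
  proof -
    have "norm (inverse (real (Suc n)) *\<^sub>R b) \<le> norm b"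
      by (simp add: mult_left_le_one_le inverse_le_1_iff del: of_nat_Suc)
    moreover have "norm x \<le> norm (x + inverse (real (Suc n)) *\<^sub>R b) + norm (inverse (real (Suc n)) *\<^sub>R b)"
      using norm_triangle_ineq4[of "x + inverse (real (Suc n)) *\<^sub>R b" "inverse (real (Suc n)) *\<^sub>R b"] by simp
    ultimately have "norm (x + inverse (real (Suc n)) *\<^sub>R b) > R" "norm x > R"
      using that norm_ge_zero[of b] by linarith+
    then show ?thesis using R by (simp add: q_def)
  qed
  let ?w = "\<lambda>x::'a. indicator (cball 0 (R + norm b)) x * M"
  have M0: "0 \<le> M" using M[of 0] by linarith
  have w: "integrable lborel ?w"
    using M0 by (intro integrable_bounded_support[where M=M and R="R + norm b"]) (auto simp: indicator_def)
  have qw: "norm (q n x) \<le> ?w x" for n x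
    using bound[of n x] supp[of x n] by (auto simp: indicator_def not_le)
  have m': "(\<lambda>x. f' x b) \<in> borel_measurable lborel"
    by (rule borel_measurable_LIMSEQ_metric[where f = q]) (use q_meas lim in auto)
  show "integrable lborel (\<lambda>x. f' x b)"
    by (rule integrable_dominated_convergence[where s = q and w = ?w])
      (use q_meas m' w qw lim in auto)
  have "(\<lambda>n. LINT x|lborel. q n x) \<longlonglongrightarrow> (LINT x|lborel. f' x b)"
    by (rule integral_dominated_convergence[where w = ?w])
      (use q_meas m' w qw lim in auto)
  then show "(LINT x|lborel. f' x b) = 0"
    using q_0 by (simp add: LIMSEQ_const_iff)
qed

lemma divergence_eq_0_outside:
  assumes "closed K" "\<And>x. x \<notin> K \<Longrightarrow> F x = 0" "x \<notin> K"
  shows "(F has_derivative (\<lambda>h. 0)) (at x)" "divergence F x = 0"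
proof -
  show d: "(F has_derivative (\<lambda>h. 0)) (at x)"
    by (rule has_derivative_transform_within_open[of "\<lambda>x. 0" _ _ _ "- K"]) (use assms in auto)
  show "divergence F x = 0" using divergence_eqI[OF d] by simp
qed

lemma integral_divergence_compact_support:
  fixes F :: "'a::euclidean_space \<Rightarrow> 'a"
  assumes F: "C1_field V F" and K: "compact K" "K \<subseteq> V" and 0: "\<And>x. x \<notin> K \<Longrightarrow> F x = 0"
  shows "(LINT x:V|lborel. divergence F x) = 0"
proof -
  define F' where "F' x = (if x \<in> K then frechet_derivative F (at x) else (\<lambda>h. 0))" for x
  have d: "(F has_derivative F' x) (at x)" for x
    using C1_fieldD[OF F, of x] K divergence_eq_0_outside(1)[OF compact_imp_closed[OF K(1)] 0]
    by (auto simp: F'_def)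
  obtain R where R: "\<And>x. x \<in> K \<Longrightarrow> norm x \<le> R"
    using compact_imp_bounded[OF K(1)] unfolding bounded_iff by auto
  have b: "integrable lborel (\<lambda>x. F' x b \<bullet> b) \<and> (LINT x|lborel. F' x b \<bullet> b) = 0" if b: "b \<in> Basis" for b
  proof -
    have "continuous_on K (\<lambda>x. frechet_derivative F (at x) b \<bullet> b)"
      using F b K(2) unfolding C1_field_def by (auto intro!: continuous_intros intro: continuous_on_subset)
    then have "bounded ((\<lambda>x. frechet_derivative F (at x) b \<bullet> b) ` K)"
      using K(1) compact_continuous_image compact_imp_bounded by blast
    then obtain M where "\<And>x. x \<in> K \<Longrightarrow> \<bar>frechet_derivative F (at x) b \<bullet> b\<bar> \<le> M"
      unfolding bounded_iff by auto
    then have M: "\<bar>F' x b \<bullet> b\<bar> \<le> max M 0" for x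
      by (force simp: F'_def)
    have d': "((\<lambda>x. F x \<bullet> b) has_derivative (\<lambda>h. F' x h \<bullet> b)) (at x)" for x
      using has_derivative_inner_left[OF d] .
    show ?thesis
      using integral_directional_derivative_eq_0[OF d', of b "max M 0" R] M R 0
      by (metis inner_zero_left not_less)
  qed
  have "divergence F x = (\<Sum>b\<in>Basis. F' x b \<bullet> b)" for x
    using divergence_eqI[OF d] .
  moreover have "indicator V x *\<^sub>R divergence F x = divergence F x" for x
    using divergence_eq_0_outside(2)[OF compact_imp_closed[OF K(1)], of F x] 0 K by (auto simp: indicator_def)
  ultimately have "(LINT x:V|lborel. divergence F x) = (LINT x|lborel. (\<Sum>b\<in>Basis. F' x b \<bullet> b))"
    unfolding set_lebesgue_integral_def by (simp only:)
  also have "\<dots> = 0" using b by simp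
  finally show ?thesis .
qed

text \<open>Integration along the lines in the direction \<open>e\<close> without a splitting of the coordinates. Insert the
factor \<open>1 = |{s. 0 \<le> (x - s e) \<bullet> e \<le> 1}|\<close>, exchange the two integrals and translate by \<open>s e\<close>. The slab
is the one that represents the orthogonal hyperplane in the surface integral of a graph.\<close>

lemma integral_slab_lines:
  fixes g :: "'a::euclidean_space \<Rightarrow> real"
  assumes g[measurable]: "g \<in> borel_measurable borel"
    and M: "\<And>x. \<bar>g x\<bar> \<le> M" and R: "\<And>x. norm x > R \<Longrightarrow> g x = 0" and e: "norm e = 1"
  shows "(LINT x|lborel. g x)
    = (LINT y:{y. 0 \<le> y \<bullet> e \<and> y \<bullet> e \<le> 1}|lborel. LINT s|lborel. g (y + s *\<^sub>R e))"
proof -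
  let ?S = "{y::'a. 0 \<le> y \<bullet> e \<and> y \<bullet> e \<le> 1}"
  define k where "k x s = indicator ?S (x - s *\<^sub>R e) * g x" for x s
  define h where "h y s = indicator ?S y * g (y + s *\<^sub>R e)" for y s
  have S[measurable]: "?S \<in> sets borel" by measurable
  have ee: "e \<bullet> e = 1" using e by (simp add: dot_square_norm)
  have M0: "M \<ge> 0" using M[of 0] by linarith
  have xe: "\<bar>x \<bullet> e\<bar> \<le> norm x" for x using Cauchy_Schwarz_ineq2[of x e] e by simp
  have kb: "\<bar>k x s\<bar> \<le> M" "\<bar>h x s\<bar> \<le> M" for x s
    using M M0 by (auto simp: k_def h_def indicator_def)
  have ks: "norm x \<le> R \<and> \<bar>s\<bar> \<le> R + 1" if "k x s \<noteq> 0" for x s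
  proof -
    have "norm x \<le> R" "0 \<le> (x - s *\<^sub>R e) \<bullet> e \<and> (x - s *\<^sub>R e) \<bullet> e \<le> 1"
      using that R[of x] by (force simp: k_def indicator_def split: if_splits)+
    then show ?thesis using xe[of x] ee by (auto simp: inner_diff_left)
  qed
  have hs: "norm y \<le> R + (R + 1) \<and> \<bar>s\<bar> \<le> R + 1" if "h y s \<noteq> 0" for y s
  proof -
    have *: "norm (y + s *\<^sub>R e) \<le> R" "0 \<le> y \<bullet> e \<and> y \<bullet> e \<le> 1"
      using that R[of "y + s *\<^sub>R e"] by (force simp: h_def indicator_def split: if_splits)+
    then have s: "\<bar>s\<bar> \<le> R + 1" using xe[of "y + s *\<^sub>R e"] ee by (auto simp: inner_add_left)
    have "norm y \<le> norm (y + s *\<^sub>R e) + norm (s *\<^sub>R e)"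
      using norm_triangle_ineq4[of "y + s *\<^sub>R e" "s *\<^sub>R e"] by simp
    then show ?thesis using * s e by simp
  qed
  have pair: "integrable (lborel \<Otimes>\<^sub>M lborel) (\<lambda>(y, s). f y s)"
    if [measurable]: "(\<lambda>(y, s). f y s) \<in> borel_measurable borel" and "\<And>y s. \<bar>f y s\<bar> \<le> M"
      "\<And>y s. f y s \<noteq> 0 \<Longrightarrow> norm y \<le> R + (R + 1) \<and> \<bar>s\<bar> \<le> R + 1" for f :: "'a \<Rightarrow> real \<Rightarrow> real"
    unfolding lborel_prod
  proof (rule integrable_bounded_support[where M = M and R = "(R + (R + 1)) + (R + 1)"])
    fix z :: "'a \<times> real" assume z: "norm z > (R + (R + 1)) + (R + 1)"
    show "(case z of (y, s) \<Rightarrow> f y s) = 0"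
      using that(3)[of "fst z" "snd z"] norm_Pair_le[of "fst z" "snd z"] z
      by (fastforce simp: split_beta)
  qed (use that in \<open>auto simp: split_beta\<close>)
  have km: "(\<lambda>(y, s). k y s) \<in> borel_measurable (borel \<Otimes>\<^sub>M borel)"
    unfolding k_def split_beta' by measurable
  have hm: "(\<lambda>(y, s). h y s) \<in> borel_measurable (borel \<Otimes>\<^sub>M borel)"
    unfolding h_def split_beta' by measurable
  have ki: "integrable (lborel \<Otimes>\<^sub>M lborel) (\<lambda>(y, s). k y s)"
    proof (intro pair kb)
    show "norm y \<le> R + (R + 1) \<and> \<bar>s\<bar> \<le> R + 1" if "k y s \<noteq> 0" for y s using ks[OF that] by linarith
  qed (use km in \<open>simp add: borel_prod\<close>)
  have hi: "integrable (lborel \<Otimes>\<^sub>M lborel) (\<lambda>(y, s). h y s)"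
    using hm by (intro pair kb hs) (simp add: borel_prod)
  have "(LINT x|lborel. g x) = (LINT x|lborel. LINT s|lborel. k x s)"
  proof (rule Bochner_Integration.integral_cong[OF refl])
    fix x
    have "k x = (\<lambda>s. indicator {x \<bullet> e - 1 .. x \<bullet> e} s * g x)"
      using ee by (auto simp: k_def fun_eq_iff indicator_def inner_diff_left)
    then show "g x = (LINT s|lborel. k x s)" by simp
  qed
  also have "\<dots> = (LINT s|lborel. LINT x|lborel. k x s)"
    using lborel_pair.Fubini_integral[OF ki] by simp
  also have "\<dots> = (LINT s|lborel. LINT y|lborel. h y s)"
  proof (rule Bochner_Integration.integral_cong[OF refl])
    fix s
    have "(\<lambda>x. k x s) \<in> borel_measurable borel" unfolding k_def by measurable
    from lborel_integral_translate[OF this, of "s *\<^sub>R e"]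
    show "(LINT x|lborel. k x s) = (LINT y|lborel. h y s)"
      by (simp add: k_def h_def)
  qed
  also have "\<dots> = (LINT y|lborel. LINT s|lborel. h y s)"
    using lborel_pair.Fubini_integral[OF hi] by simp
  also have "\<dots> = (LINT y:?S|lborel. LINT s|lborel. g (y + s *\<^sub>R e))"
    unfolding set_lebesgue_integral_def h_def by simp
  finally show ?thesis .
qed

section \<open>Bounded open sets\<close>

lemma set_integrable_bounded_open:
  fixes f :: "'a::euclidean_space \<Rightarrow> real"
  assumes "open U" "bounded U" "continuous_on U f" "\<And>x. x \<in> U \<Longrightarrow> \<bar>f x\<bar> \<le> M"
  shows "set_integrable lborel U f"
proof -
  obtain R where R: "\<And>x. x \<in> U \<Longrightarrow> norm x \<le> R"
    using assms(2) unfolding bounded_iff by auto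
  have "(\<lambda>x. indicator U x *\<^sub>R f x) \<in> borel_measurable borel"
    using assms(1,3) by (intro borel_measurable_continuous_on_indicator) auto
  then show ?thesis
    unfolding set_integrable_def
    by (rule integrable_bounded_support[where M = "max M 0" and R = R])
      (use assms(4) R in \<open>auto simp: indicator_def le_max_iff_disj not_le[symmetric]\<close>)
qed

lemma set_integral_const_bounded:
  fixes U :: "'a::euclidean_space set"
  assumes "open U" "bounded U"
  shows "set_integrable lborel U (\<lambda>x. c::real)" "(LINT x:U|lborel. c) = c * measure lborel U"
proof -
  show "set_integrable lborel U (\<lambda>x. c)" by (rule set_integrable_bounded_open[OF assms, where M = "\<bar>c\<bar>"]) auto
  show "(LINT x:U|lborel. c) = c * measure lborel U"
    using assms by (simp add: set_lebesgue_integral_def mult.commute)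
qed

lemma set_integral_bounded_convergence:
  fixes f :: "nat \<Rightarrow> 'a::euclidean_space \<Rightarrow> real"
  assumes U: "open U" "bounded U" and f: "\<And>n. set_integrable lborel U (f n)"
    and M: "\<And>n x. x \<in> U \<Longrightarrow> \<bar>f n x\<bar> \<le> M" and lim: "\<And>x. x \<in> U \<Longrightarrow> (\<lambda>n. f n x) \<longlonglongrightarrow> g x"
  shows "(\<lambda>n. LINT x:U|lborel. f n x) \<longlonglongrightarrow> (LINT x:U|lborel. g x)"
  unfolding set_lebesgue_integral_def
proof (rule integral_dominated_convergence[where w = "\<lambda>x. indicator U x *\<^sub>R M"])
  have m: "(\<lambda>x. indicator U x *\<^sub>R f n x) \<in> borel_measurable lborel" for n
    using f[of n] unfolding set_integrable_def by (rule borel_measurable_integrable)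
  then show "(\<lambda>x. indicator U x *\<^sub>R f n x) \<in> borel_measurable lborel" for n .
  have l: "(\<lambda>n. indicator U x *\<^sub>R f n x) \<longlonglongrightarrow> indicator U x *\<^sub>R g x" for x
    using lim[of x] by (cases "x \<in> U") auto
  then show "AE x in lborel. (\<lambda>n. indicator U x *\<^sub>R f n x) \<longlonglongrightarrow> indicator U x *\<^sub>R g x" by simp
  show "(\<lambda>x. indicator U x *\<^sub>R g x) \<in> borel_measurable lborel"
    by (rule borel_measurable_LIMSEQ_metric[OF m l])
  show "integrable lborel (\<lambda>x. indicator U x *\<^sub>R M)"
    using set_integral_const_bounded(1)[OF U] by (simp add: set_integrable_def)
  show "AE x in lborel. norm (indicator U x *\<^sub>R f n x) \<le> indicator U x *\<^sub>R M" for n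
    using M by (auto simp: indicator_def)
qed

section \<open>Boundary charts and the outward normal\<close>

lemma graph_chartD:
  assumes "graph_chart U c r e \<gamma>"
  shows "r > 0" "norm e = 1" "e \<bullet> e = 1" "\<And>y s. \<gamma> (y + s *\<^sub>R e) = \<gamma> y" "C2_on UNIV \<gamma>"
    and "\<And>x. (\<gamma> has_derivative (\<lambda>h. grad \<gamma> x \<bullet> h)) (at x)"
    and "continuous_on UNIV \<gamma>" "continuous_on UNIV (grad \<gamma>)"
    and "\<And>x. x \<in> ball c r \<Longrightarrow> x \<in> U \<longleftrightarrow> \<gamma> x < x \<bullet> e"
proof -
  show "r > 0" "\<And>y s. \<gamma> (y + s *\<^sub>R e) = \<gamma> y" "C2_on UNIV \<gamma>"
    and "\<And>x. x \<in> ball c r \<Longrightarrow> x \<in> U \<longleftrightarrow> \<gamma> x < x \<bullet> e"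
    using assms unfolding graph_chart_def by auto
  show "norm e = 1" using assms unfolding graph_chart_def by (metis norm_Basis norm_minus_cancel)
  then show "e \<bullet> e = 1" by (simp add: dot_square_norm)
  show "(\<gamma> has_derivative (\<lambda>h. grad \<gamma> x \<bullet> h)) (at x)" for x
    using \<open>C2_on UNIV \<gamma>\<close> by (intro has_derivative_grad) (auto simp: C2_on_def)
  show "continuous_on UNIV \<gamma>" "continuous_on UNIV (grad \<gamma>)"
    using C2_on_imp_C1_scalar[OF \<open>C2_on UNIV \<gamma>\<close>] C1_scalar_imp_continuous_on
    by (auto simp: C1_scalar_def)
qed

lemma graph_chart_grad_invariant:
  assumes "graph_chart U c r e \<gamma>"
  shows "grad \<gamma> x \<bullet> e = 0" and "grad \<gamma> (y + s *\<^sub>R e) = grad \<gamma> y"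
proof -
  note g = graph_chartD[OF assms]
  have "((\<lambda>s. x + s *\<^sub>R e) has_derivative (\<lambda>s. s *\<^sub>R e)) (at 0)"
    by (auto intro!: derivative_eq_intros)
  from has_derivative_compose[OF this, of \<gamma> "\<lambda>h. grad \<gamma> x \<bullet> h"]
  have "((\<lambda>s::real. \<gamma> x) has_derivative (\<lambda>s. s * (grad \<gamma> x \<bullet> e))) (at 0)"
    using g(4,6) by simp
  then have "((\<lambda>s::real. \<gamma> x) has_real_derivative (grad \<gamma> x \<bullet> e)) (at 0)"
    by (simp add: has_field_derivative_def mult.commute[of _ "grad \<gamma> x \<bullet> e"])
  then show "grad \<gamma> x \<bullet> e = 0"
    using DERIV_unique DERIV_const by blast
  have "((\<lambda>z. z + (- s) *\<^sub>R e) has_derivative (\<lambda>h. h)) (at (y + s *\<^sub>R e))"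
    by (auto intro!: derivative_eq_intros)
  from has_derivative_compose[OF this, of \<gamma> "\<lambda>h. grad \<gamma> y \<bullet> h"]
  have "((\<lambda>z. \<gamma> (z + (- s) *\<^sub>R e)) has_derivative (\<lambda>h. grad \<gamma> y \<bullet> h)) (at (y + s *\<^sub>R e))"
    using g(6)[of y] by simp
  then show "grad \<gamma> (y + s *\<^sub>R e) = grad \<gamma> y"
    unfolding g(4) by (rule grad_eqI)
qed

lemma graph_chart_closure:
  assumes U: "open U" and g: "graph_chart U c r e \<gamma>" and x: "x \<in> ball c r"
  shows "x \<in> closure U \<longleftrightarrow> \<gamma> x \<le> x \<bullet> e" and "x \<in> frontier U \<longleftrightarrow> \<gamma> x = x \<bullet> e"
proof -
  note gD = graph_chartD[OF g]
  show cl: "x \<in> closure U \<longleftrightarrow> \<gamma> x \<le> x \<bullet> e"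
  proof
    assume cx: "x \<in> closure U"
    show "\<gamma> x \<le> x \<bullet> e"
    proof (rule ccontr)
      assume "\<not> \<gamma> x \<le> x \<bullet> e"
      then have xV: "x \<in> ball c r \<inter> {z. z \<bullet> e < \<gamma> z}" using x by auto
      have "open (ball c r \<inter> {z. z \<bullet> e < \<gamma> z})"
        using gD(7) by (intro open_Int open_ball open_Collect_less) (auto intro!: continuous_intros)
      then have "U \<inter> (ball c r \<inter> {z. z \<bullet> e < \<gamma> z}) \<noteq> {}"
        using cx xV open_Int_closure_eq_empty by blast
      then show False using gD(9) by force
    qed
  next
    assume le: "\<gamma> x \<le> x \<bullet> e"
    have "\<exists>y\<in>U. dist y x < d" if d: "d > 0" for d
    proof -
      define s where "s = min d (r - dist c x) / 2"
      have s: "0 < s" "s < d" "s < r - dist c x"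
        using d x unfolding s_def by auto
      have dx: "dist (x + s *\<^sub>R e) x = s" using gD(2) s by (simp add: dist_norm)
      then have b: "x + s *\<^sub>R e \<in> ball c r"
        using s dist_triangle[of c "x + s *\<^sub>R e" x] by (simp add: dist_commute)
      have "\<gamma> (x + s *\<^sub>R e) < (x + s *\<^sub>R e) \<bullet> e"
        using gD(3,4) le s by (simp add: inner_add_left)
      then show ?thesis using gD(9)[OF b] dx s by (intro bexI[of _ "x + s *\<^sub>R e"]) auto
    qed
    then show "x \<in> closure U" by (simp add: closure_approachable)
  qed
  show "x \<in> frontier U \<longleftrightarrow> \<gamma> x = x \<bullet> e"
    using cl gD(9)[OF x] U by (auto simp: frontier_def interior_open)
qed

text \<open>Two different unit vectors cannot both be normals: along \<open>\<mu> - \<nu>\<close> the half-space condition for \<open>\<nu>\<close> puts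
nearby points inside \<open>U\<close>, and the one for \<open>\<mu>\<close> puts them outside.\<close>

lemma outward_normal_eqI:
  fixes x \<nu> :: "'a::euclidean_space"
  assumes n: "norm \<nu> = 1"
    and P: "\<forall>\<epsilon>>0. \<exists>\<delta>>0. \<forall>h. norm h < \<delta> \<longrightarrow>
        (h \<bullet> \<nu> < - \<epsilon> * norm h \<longrightarrow> x + h \<in> U) \<and> (h \<bullet> \<nu> > \<epsilon> * norm h \<longrightarrow> x + h \<notin> U)"
  shows "outward_normal U x = \<nu>"
  unfolding outward_normal_def
proof (rule the_equality)
  show "norm \<nu> = 1 \<and> (\<forall>\<epsilon>>0. \<exists>\<delta>>0. \<forall>h. norm h < \<delta> \<longrightarrow>
      (h \<bullet> \<nu> < - \<epsilon> * norm h \<longrightarrow> x + h \<in> U) \<and> (h \<bullet> \<nu> > \<epsilon> * norm h \<longrightarrow> x + h \<notin> U))"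
    using assms by blast
  fix \<mu>
  assume \<mu>: "norm \<mu> = 1 \<and> (\<forall>\<epsilon>>0. \<exists>\<delta>>0. \<forall>h. norm h < \<delta> \<longrightarrow>
      (h \<bullet> \<mu> < - \<epsilon> * norm h \<longrightarrow> x + h \<in> U) \<and> (h \<bullet> \<mu> > \<epsilon> * norm h \<longrightarrow> x + h \<notin> U))"
  show "\<mu> = \<nu>"
  proof (rule ccontr)
    assume ne: "\<mu> \<noteq> \<nu>"
    define k where "k = \<mu> - \<nu>"
    define a where "a = 1 - \<mu> \<bullet> \<nu>"
    have k: "norm k > 0" using ne by (simp add: k_def)
    have "(norm k)\<^sup>2 = 2 * a"
      using n \<mu> by (simp add: k_def a_def power2_norm_eq_inner inner_diff_left inner_diff_right
          inner_commute norm_eq_1)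
    then have a: "a > 0" using k by (smt (verit) zero_less_power)
    have kn: "k \<bullet> \<nu> = - a" "k \<bullet> \<mu> = a"
      using n conjunct1[OF \<mu>] inner_commute[of \<nu> \<mu>] by (simp_all add: k_def a_def inner_diff_left norm_eq_1)
    define \<epsilon> where "\<epsilon> = a / (2 * norm k)"
    have \<epsilon>: "\<epsilon> > 0" using a k by (simp add: \<epsilon>_def)
    obtain \<delta>1 where 1: "\<delta>1 > 0" "\<And>h. norm h < \<delta>1 \<Longrightarrow> h \<bullet> \<nu> < - \<epsilon> * norm h \<Longrightarrow> x + h \<in> U"
      using P \<epsilon> by meson
    obtain \<delta>2 where 2: "\<delta>2 > 0" "\<And>h. norm h < \<delta>2 \<Longrightarrow> h \<bullet> \<mu> > \<epsilon> * norm h \<Longrightarrow> x + h \<notin> U"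
      using \<mu> \<epsilon> by meson
    define s where "s = min \<delta>1 \<delta>2 / (2 * norm k)"
    have s: "s > 0" using 1 2 k by (simp add: s_def)
    have "norm (s *\<^sub>R k) = min \<delta>1 \<delta>2 / 2" using 1(1) 2(1) k by (simp add: s_def)
    then have "norm (s *\<^sub>R k) < \<delta>1" "norm (s *\<^sub>R k) < \<delta>2" using 1(1) 2(1) by auto
    moreover have "\<epsilon> * norm (s *\<^sub>R k) = s * a / 2" using s k by (simp add: \<epsilon>_def)
    moreover have "s * a > 0" using s a by simp
    ultimately show False
      using 1(2)[of "s *\<^sub>R k"] 2(2)[of "s *\<^sub>R k"] kn by simp
  qed
qed

lemma norm_graph_normal:
  assumes "graph_chart U c r e \<gamma>"
  shows "norm (grad \<gamma> x - e) = sqrt (1 + (norm (grad \<gamma> x))\<^sup>2)"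
  using graph_chartD(3)[OF assms] graph_chart_grad_invariant(1)[OF assms, of x]
  by (simp add: norm_eq_sqrt_inner inner_diff_left inner_diff_right inner_commute add.commute)

text \<open>The set \<open>U\<close> is locally the sublevel set of \<open>\<gamma>(x) - x \<bullet> e\<close>, so the normal is the normalised gradient of
this function. Its length is the surface element, which therefore cancels in flux integrals.\<close>

lemma outward_normal_graph:
  assumes U: "open U" and g: "graph_chart U c r e \<gamma>" and x: "x \<in> ball c r" "x \<in> frontier U"
  shows "sqrt (1 + (norm (grad \<gamma> x))\<^sup>2) *\<^sub>R outward_normal U x = grad \<gamma> x - e"
proof -
  note gD = graph_chartD[OF g]
  define n where "n = grad \<gamma> x - e"
  define L where "L = norm n"
  have L: "L = sqrt (1 + (norm (grad \<gamma> x))\<^sup>2)"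
    using norm_graph_normal[OF g] by (simp add: L_def n_def)
  then have L0: "L > 0" by (simp add: add_pos_nonneg)
  have gx: "\<gamma> x = x \<bullet> e" using graph_chart_closure(2)[OF U g x(1)] x(2) by simp
  have "outward_normal U x = (1 / L) *\<^sub>R n"
  proof (rule outward_normal_eqI)
    show "norm ((1 / L) *\<^sub>R n) = 1" using L0 by (simp add: L_def)
    show "\<forall>\<epsilon>>0. \<exists>\<delta>>0. \<forall>h. norm h < \<delta> \<longrightarrow>
        (h \<bullet> ((1 / L) *\<^sub>R n) < - \<epsilon> * norm h \<longrightarrow> x + h \<in> U) \<and>
        (h \<bullet> ((1 / L) *\<^sub>R n) > \<epsilon> * norm h \<longrightarrow> x + h \<notin> U)"
    proof (intro allI impI)
      fix \<epsilon> :: real assume \<epsilon>: "\<epsilon> > 0"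
      then have "\<epsilon> * L > 0" using L0 by simp
      then obtain d where d: "d > 0" "\<And>y. norm (y - x) < d \<Longrightarrow>
          norm (\<gamma> y - \<gamma> x - grad \<gamma> x \<bullet> (y - x)) \<le> \<epsilon> * L * norm (y - x)"
        using gD(6)[of x] unfolding has_derivative_at_alt by meson
      let ?\<delta> = "min d (r - dist c x)"
      have "(h \<bullet> ((1 / L) *\<^sub>R n) < - \<epsilon> * norm h \<longrightarrow> x + h \<in> U) \<and>
        (h \<bullet> ((1 / L) *\<^sub>R n) > \<epsilon> * norm h \<longrightarrow> x + h \<notin> U)" if h: "norm h < ?\<delta>" for h
      proof -
        have b: "x + h \<in> ball c r"
          using h dist_triangle[of c "x + h" x] by (simp add: dist_norm)
        have "\<bar>\<gamma> (x + h) - \<gamma> x - grad \<gamma> x \<bullet> h\<bar> \<le> \<epsilon> * L * norm h"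
          using d(2)[of "x + h"] h by simp
        then have r: "\<bar>\<gamma> (x + h) - (x + h) \<bullet> e - n \<bullet> h\<bar> \<le> \<epsilon> * L * norm h"
          using gx by (simp add: n_def inner_diff_left inner_add_left inner_commute algebra_simps)
        have e: "h \<bullet> ((1 / L) *\<^sub>R n) = (n \<bullet> h) / L" by (simp add: inner_commute)
        show ?thesis
          unfolding e gD(9)[OF b] using r L0 by (auto simp: field_simps)
      qed
      moreover have "?\<delta> > 0" using d x by simp
      ultimately show "\<exists>\<delta>>0. \<forall>h. norm h < \<delta> \<longrightarrow>
        (h \<bullet> ((1 / L) *\<^sub>R n) < - \<epsilon> * norm h \<longrightarrow> x + h \<in> U) \<and>
        (h \<bullet> ((1 / L) *\<^sub>R n) > \<epsilon> * norm h \<longrightarrow> x + h \<notin> U)" by blast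
    qed
  qed
  then show ?thesis using L0 by (simp add: L[symmetric] n_def[symmetric])
qed

text \<open>A continuous density on \<open>[1, 3]\<close> with integral \<open>1\<close>. Its primitive \<open>ramp\<close> is a \<open>C\<^sup>1\<close> function that
vanishes up to \<open>1\<close>, so that \<open>ramp(\<sigma> / \<epsilon>)\<close> cuts off a whole neighbourhood of \<open>\<sigma> = 0\<close>.\<close>

definition tent :: "real \<Rightarrow> real" where
  "tent s = max 0 (s - 1) - 2 * max 0 (s - 2) + max 0 (s - 3)"

definition ramp :: "real \<Rightarrow> real" where
  "ramp s = ((max 0 (s - 1))\<^sup>2 - 2 * (max 0 (s - 2))\<^sup>2 + (max 0 (s - 3))\<^sup>2) / 2"

lemma pos_part_square_derivative:
  "((\<lambda>s::real. (max 0 (s - a))\<^sup>2) has_real_derivative 2 * max 0 (s - a)) (at s)"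
proof -
  have "((\<lambda>s::real. (max 0 s)\<^sup>2) has_real_derivative 2 * max 0 (s - a)) (at (s - a))"
    using pos_part_power_derivative[of 1 "s - a"] by (simp add: numeral_2_eq_2)
  from DERIV_chain2[where g = "\<lambda>s. s - a" and x = s and s = UNIV and Db = 1, OF this]
  show ?thesis using DERIV_diff[OF DERIV_ident DERIV_const] by force
qed

lemma ramp_derivative: "(ramp has_real_derivative tent s) (at s)"
proof -
  have "(ramp has_real_derivative
      (2 * max 0 (s - 1) - 2 * (2 * max 0 (s - 2)) + 2 * max 0 (s - 3)) / 2) (at s)"
    unfolding ramp_def[abs_def]
    by (intro DERIV_cdivide DERIV_add DERIV_diff DERIV_cmult pos_part_square_derivative)
  moreover have "(2 * max 0 (s - 1) - 2 * (2 * max 0 (s - 2)) + 2 * max 0 (s - 3)) / 2 = tent s"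
    by (simp add: tent_def field_simps)
  ultimately show ?thesis by simp
qed

lemma ramp_facts:
  "continuous_on S tent" "0 \<le> tent s" "tent s \<le> 1" "s \<notin> {1..3} \<Longrightarrow> tent s = 0"
  "s \<le> 1 \<Longrightarrow> ramp s = 0" "s \<ge> 3 \<Longrightarrow> ramp s = 1" "0 \<le> ramp s" "ramp s \<le> 1"
proof -
  show "continuous_on S tent" unfolding tent_def[abs_def] by (intro continuous_intros)
  show t: "0 \<le> tent s" "tent s \<le> 1" "s \<notin> {1..3} \<Longrightarrow> tent s = 0" for s unfolding tent_def max_def by auto
  show 1: "s \<le> 1 \<Longrightarrow> ramp s = 0" for s by (simp add: ramp_def)
  show 3: "s \<ge> 3 \<Longrightarrow> ramp s = 1" for s by (simp add: ramp_def power2_eq_square field_simps)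
  have mono: "ramp a \<le> ramp b" if "a \<le> b" for a b
    using DERIV_nonneg_imp_nondecreasing[OF that, of ramp] ramp_derivative t by blast
  show "0 \<le> ramp s" using mono[of "min s 1" s] 1[of "min s 1"] by simp
  show "ramp s \<le> 1" using mono[of s "max s 3"] 3[of "max s 3"] by simp
qed

lemma integral_tent: "integrable lborel tent" "(LINT s|lborel. tent s) = 1"
proof -
  have "has_bochner_integral lborel (\<lambda>x. tent x * indicator {1..3} x) (ramp 3 - ramp 1)"
    by (rule has_bochner_integral_FTC_Icc_real)
      (use ramp_derivative ramp_facts(1)[of UNIV] in \<open>auto simp: continuous_on_eq_continuous_at\<close>)
  moreover have "(\<lambda>x. tent x * indicator {1..3} x) = tent"
    using ramp_facts(4) by (auto simp: fun_eq_iff indicator_def)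
  ultimately show "integrable lborel tent" "(LINT s|lborel. tent s) = 1"
    using ramp_facts(5)[of 1] ramp_facts(6)[of 3] by (auto simp: has_bochner_integral_iff)
qed

section \<open>The divergence theorem in one chart\<close>

lemma continuous_on_compact_bound:
  fixes f :: "'a::topological_space \<Rightarrow> 'b::real_normed_vector"
  assumes "compact K" "continuous_on K f"
  obtains M where "M \<ge> 0" "\<And>x. x \<in> K \<Longrightarrow> norm (f x) \<le> M"
proof -
  have "bounded (f ` K)" using assms compact_continuous_image compact_imp_bounded by blast
  then obtain M where "\<forall>y\<in>f ` K. norm y \<le> M" unfolding bounded_iff by blast
  then show thesis using that[of "max 0 M"] by (auto simp: le_max_iff_disj)
qed

text \<open>Let \<open>\<sigma>(x) = x \<bullet> e - \<gamma>(x)\<close> be the height above the graph. The field \<open>ramp(\<sigma> / \<epsilon>) \<Phi>\<close> has compact support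
in \<open>U\<close>, so its divergence has integral zero, which means
\<open>\<integral> ramp(\<sigma> / \<epsilon>) div \<Phi> = \<integral> (1 / \<epsilon>) tent(\<sigma> / \<epsilon>) (\<nabla>\<gamma> - e) \<bullet> \<Phi>\<close>. As \<open>\<epsilon>\<close> tends to \<open>0\<close> the left hand side
tends to \<open>\<integral> div \<Phi>\<close>. On each line in the direction \<open>e\<close> the substitution \<open>\<sigma> = \<epsilon> \<tau>\<close> turns the weight on
the right into \<open>tent(\<tau>) d\<tau>\<close>, and the integrand tends to its value on the graph. Only the divergence of
\<open>\<Phi>\<close> has to be bounded, since its single partial derivatives never appear.\<close>

theorem divergence_chart:
  fixes U :: "'a::euclidean_space set"
  assumes U: "open U" "bounded U" and g: "graph_chart U c r e \<gamma>"
    and cont: "continuous_on (closure U) \<Phi>" and C1: "C1_field U \<Phi>"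
    and K: "compact K" "K \<subseteq> ball c r" and 0: "\<And>x. x \<notin> K \<Longrightarrow> \<Phi> x = 0"
    and M: "\<And>x. x \<in> U \<Longrightarrow> \<bar>divergence \<Phi> x\<bar> \<le> M"
  shows "(LINT x:U|lborel. divergence \<Phi> x)
    = graph_integral e \<gamma> (\<lambda>x. indicator (frontier U) x * (\<Phi> x \<bullet> outward_normal U x))"
proof -
  note gD = graph_chartD[OF g] and ginv = graph_chart_grad_invariant[OF g]
  define \<epsilon> where "\<epsilon> n = inverse (real (Suc n))" for n
  have \<epsilon>: "\<epsilon> n > 0" for n by (simp add: \<epsilon>_def)
  have \<epsilon>_lim: "\<epsilon> \<longlonglongrightarrow> 0" unfolding \<epsilon>_def[abs_def] by (rule LIMSEQ_inverse_real_of_nat)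
  define f where "f n x = (1 / \<epsilon> n) * (x \<bullet> e - \<gamma> x)" for n x
  have f_deriv: "(f n has_derivative (\<lambda>h. ((1 / \<epsilon> n) *\<^sub>R (e - grad \<gamma> x)) \<bullet> h)) (at x)" for n x
    unfolding f_def[abs_def] using \<epsilon>[of n]
    by (auto intro!: derivative_eq_intros gD(6) simp: inner_diff_left inner_commute algebra_simps)
  have f_C1: "C1_scalar UNIV (f n)" and f_grad: "grad (f n) x = (1 / \<epsilon> n) *\<^sub>R (e - grad \<gamma> x)" for n x
  proof -
    have "continuous_on UNIV (\<lambda>x. (1 / \<epsilon> n) *\<^sub>R (e - grad \<gamma> x))"
      using gD(8) by (intro continuous_on_scaleR continuous_on_diff continuous_on_const)
    note * = C1_scalarI[where U = UNIV, OF f_deriv this]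
    show "C1_scalar UNIV (f n)" "grad (f n) x = (1 / \<epsilon> n) *\<^sub>R (e - grad \<gamma> x)" using * by auto
  qed
  define \<theta> where "\<theta> n x = ramp (f n x)" for n x
  define N where "N x = grad \<gamma> x - e" for x
  have \<theta>_C1: "C1_scalar UNIV (\<theta> n)"
    and \<theta>_grad: "grad (\<theta> n) x = - ((tent (f n x) / \<epsilon> n) *\<^sub>R N x)" for n x
    using C1_scalar_compose[OF f_C1[of n] ramp_derivative ramp_facts(1)]
    by (auto simp: \<theta>_def[abs_def] f_grad N_def algebra_simps)
  have cont_N: "continuous_on S N" for S
    unfolding N_def[abs_def] using gD(8) by (intro continuous_intros) (auto intro: continuous_on_subset)
  have cont_f: "continuous_on S (f n)" for S n
    using C1_scalar_imp_continuous_on[OF f_C1] by (auto intro: continuous_on_subset)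
  have clU: "compact (closure U)" using U(2) by simp
  have "continuous_on (closure U) (\<lambda>x. N x \<bullet> \<Phi> x)"
    by (intro continuous_intros cont cont_N)
  from continuous_on_compact_bound[OF clU this] obtain M2
    where M20: "M2 \<ge> 0" and "\<And>x. x \<in> closure U \<Longrightarrow> norm (N x \<bullet> \<Phi> x) \<le> M2" by blast
  then have M2: "\<bar>N x \<bullet> \<Phi> x\<bar> \<le> M2" if "x \<in> U" for x
    using subsetD[OF closure_subset that] by simp
  obtain R where R: "\<And>x. x \<in> U \<Longrightarrow> norm x \<le> R"
    using U(2) unfolding bounded_iff by auto

  have \<theta>div_bd: "\<bar>\<theta> n x * divergence \<Phi> x\<bar> \<le> 1 * M" if "x \<in> U" for n x
    unfolding abs_mult using M[OF that] ramp_facts(7,8)[of "f n x"]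
    by (intro mult_mono) (auto simp: \<theta>_def)
  have \<theta>div_int: "set_integrable lborel U (\<lambda>x. \<theta> n x * divergence \<Phi> x)" for n
  proof (rule set_integrable_bounded_open[OF U _ \<theta>div_bd])
    show "continuous_on U (\<lambda>x. \<theta> n x * divergence \<Phi> x)"
      using C1_scalar_imp_continuous_on[OF \<theta>_C1] continuous_on_divergence[OF C1]
      by (intro continuous_intros) (auto intro: continuous_on_subset)
  qed
  have tent_cont: "continuous_on U (\<lambda>x. tent (f n x) / \<epsilon> n * (N x \<bullet> \<Phi> x))" for n
  proof -
    have "continuous_on U (\<lambda>x. tent (f n x))"
      using continuous_on_compose2[OF ramp_facts(1)[of UNIV] cont_f] by auto
    then show ?thesis
      using \<epsilon>[of n] by (intro continuous_intros cont_N C1_field_imp_continuous_on[OF C1]) auto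
  qed
  have tent_bd: "\<bar>tent (f n x) / \<epsilon> n * (N x \<bullet> \<Phi> x)\<bar> \<le> 1 / \<epsilon> n * M2" if "x \<in> U" for n x
    unfolding abs_mult using M2[OF that] ramp_facts(2,3)[of "f n x"] \<epsilon>[of n]
    by (intro mult_mono) (auto simp: abs_divide divide_simps)
  \<comment> \<open>the divergence of the cut-off field has integral zero\<close>
  have cut: "(LINT x:U|lborel. \<theta> n x * divergence \<Phi> x)
      = (LINT x:U|lborel. tent (f n x) / \<epsilon> n * (N x \<bullet> \<Phi> x))" for n
  proof -
    let ?H = "\<lambda>x. \<theta> n x *\<^sub>R \<Phi> x"
    let ?K = "K \<inter> {x. \<epsilon> n \<le> x \<bullet> e - \<gamma> x}"
    have "C1_scalar U (\<theta> n)" by (rule C1_scalar_subset[OF \<theta>_C1]) simp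
    note sc = scaled_field[OF this C1]
    have "closed {x. \<epsilon> n \<le> x \<bullet> e - \<gamma> x}"
      using gD(7) by (intro closed_Collect_le continuous_intros) auto
    then have K1: "compact ?K" using K(1) by blast
    have "x \<in> U" if "x \<in> ?K" for x
      using gD(9)[of x] that K(2) \<epsilon>[of n] by auto
    then have K2: "?K \<subseteq> U" by blast
    have H0: "?H x = 0" if "x \<notin> ?K" for x
    proof (cases "x \<in> K")
      case True
      then have "f n x \<le> 1" using that \<epsilon>[of n] by (simp add: f_def field_simps)
      then show ?thesis using ramp_facts(5) by (simp add: \<theta>_def)
    qed (simp add: 0)
    have "0 = (LINT x:U|lborel. divergence ?H x)"
      using integral_divergence_compact_support[OF sc(1) K1 K2 H0] by simp
    also have "\<dots> = (LINT x:U|lborel. \<theta> n x * divergence \<Phi> x - tent (f n x) / \<epsilon> n * (N x \<bullet> \<Phi> x))"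
      by (rule set_lebesgue_integral_cong) (use U sc(2) \<theta>_grad in auto)
    also have "\<dots> = (LINT x:U|lborel. \<theta> n x * divergence \<Phi> x)
        - (LINT x:U|lborel. tent (f n x) / \<epsilon> n * (N x \<bullet> \<Phi> x))"
    proof (rule set_integral_diff)
      show "set_integrable lborel U (\<lambda>x. \<theta> n x * divergence \<Phi> x)" by (rule \<theta>div_int)
      show "set_integrable lborel U (\<lambda>x. tent (f n x) / \<epsilon> n * (N x \<bullet> \<Phi> x))"
        by (rule set_integrable_bounded_open[OF U tent_cont tent_bd])
    qed
    finally show ?thesis by simp
  qed

  have lhs: "(\<lambda>n. LINT x:U|lborel. \<theta> n x * divergence \<Phi> x) \<longlonglongrightarrow> (LINT x:U|lborel. divergence \<Phi> x)"
  proof (rule set_integral_bounded_convergence[OF U \<theta>div_int \<theta>div_bd])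
    fix x assume x: "x \<in> U"
    have "\<forall>\<^sub>F n in sequentially. \<theta> n x * divergence \<Phi> x = divergence \<Phi> x"
    proof (cases "x \<in> K")
      case True
      define \<delta> where "\<delta> = (x \<bullet> e - \<gamma> x) / 3"
      have "\<delta> > 0" using x True K(2) gD(9)[of x] by (auto simp: \<delta>_def)
      then have "\<forall>\<^sub>F n in sequentially. \<epsilon> n < \<delta>" using \<epsilon>_lim by (rule order_tendstoD(2)[rotated])
      then show ?thesis
      proof eventually_elim
        case (elim n)
        then have "f n x \<ge> 3" using \<epsilon>[of n] by (simp add: f_def \<delta>_def field_simps)
        then show ?case using ramp_facts(6) by (simp add: \<theta>_def)
      qed
    next
      case False
      then show ?thesis
        using divergence_eq_0_outside(2)[OF compact_imp_closed[OF K(1)], of \<Phi> x] 0 by auto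
    qed
    then show "(\<lambda>n. \<theta> n x * divergence \<Phi> x) \<longlonglongrightarrow> divergence \<Phi> x"
      by (rule tendsto_eventually)
  qed

  define S where "S = {y::'a. 0 \<le> y \<bullet> e \<and> y \<bullet> e \<le> 1}"
  define G where "G n x = indicator U x * (tent (f n x) / \<epsilon> n * (N x \<bullet> \<Phi> x))" for n x
  define a where "a n y = (LINT s|lborel. G n (y + s *\<^sub>R e))" for n y
  define z where "z n y \<tau> = graph_lift e \<gamma> y + (\<epsilon> n * \<tau>) *\<^sub>R e" for n y \<tau>
  define b where "b n y \<tau> = indicator U (z n y \<tau>) * (tent \<tau> * (N y \<bullet> \<Phi> (z n y \<tau>)))" for n y \<tau>
  define b0 where "b0 y = indicator (frontier U) (graph_lift e \<gamma> y) * (N y \<bullet> \<Phi> (graph_lift e \<gamma> y))" for y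
  have S[measurable]: "S \<in> sets borel" unfolding S_def by measurable
  have G_meas[measurable]: "G n \<in> borel_measurable borel" for n
    using borel_measurable_continuous_on_indicator[OF _ tent_cont] U by (simp add: G_def[abs_def])
  have G_bd: "\<bar>G n x\<bar> \<le> 1 / \<epsilon> n * M2" for n x
    using tent_bd[of x n] \<epsilon>[of n] M20 by (auto simp: G_def indicator_def)
  have G_supp: "G n x = 0" if "norm x > R" for n x
    using R[of x] that by (auto simp: G_def indicator_def)
  have slab: "(LINT x:U|lborel. tent (f n x) / \<epsilon> n * (N x \<bullet> \<Phi> x)) = (LINT y:S|lborel. a n y)" for n
    using integral_slab_lines[OF G_meas[of n] G_bd[of n] G_supp[of _ n] gD(2)]
    unfolding S_def a_def by (simp add: set_lebesgue_integral_def G_def)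
  have z_line: "z n y \<tau> = y + (\<gamma> y - y \<bullet> e + \<epsilon> n * \<tau>) *\<^sub>R e" for n y \<tau>
    by (simp add: z_def graph_lift_def scaleR_left_distrib)
  have Nz: "N (z n y \<tau>) = N y" for n y \<tau>
    by (simp add: N_def z_line ginv(2))
  have fz: "f n (z n y \<tau>) = \<tau>" for n y \<tau>
    using \<epsilon>[of n] by (simp add: f_def z_line gD(4,3) inner_add_left)
  \<comment> \<open>the substitution \<open>s = \<gamma> y - y \<bullet> e + \<epsilon> \<tau>\<close> on the line through \<open>y\<close>\<close>
  have a_eq: "a n y = (LINT \<tau>|lborel. b n y \<tau>)" for n y
  proof -
    have "a n y = \<epsilon> n *\<^sub>R (LINT \<tau>|lborel. G n (z n y \<tau>))"
      unfolding a_def z_line using lborel_integral_real_affine[of "\<epsilon> n" "\<lambda>s. G n (y + s *\<^sub>R e)" "\<gamma> y - y \<bullet> e"] \<epsilon>[of n]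
      by simp
    also have "\<dots> = (LINT \<tau>|lborel. \<epsilon> n * G n (z n y \<tau>))" by simp
    also have "\<dots> = (LINT \<tau>|lborel. b n y \<tau>)"
      using \<epsilon>[of n] by (intro Bochner_Integration.integral_cong refl) (auto simp: G_def b_def fz Nz)
    finally show ?thesis .
  qed
  have b_meas: "b n y \<in> borel_measurable borel" for n y
  proof -
    have "b n y = (\<lambda>\<tau>. \<epsilon> n * G n (y + (\<gamma> y - y \<bullet> e + \<epsilon> n * \<tau>) *\<^sub>R e))"
      using \<epsilon>[of n] by (auto simp: fun_eq_iff G_def b_def fz Nz z_line[symmetric])
    then show ?thesis by simp
  qed
  have b_bd: "\<bar>b n y \<tau>\<bar> \<le> M2 * tent \<tau>" for n y \<tau>
  proof -
    have "tent \<tau> * \<bar>N y \<bullet> \<Phi> (z n y \<tau>)\<bar> \<le> tent \<tau> * M2" if "z n y \<tau> \<in> U"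
      using M2[OF that] ramp_facts(2) Nz by (intro mult_left_mono) auto
    then show ?thesis using ramp_facts(2)[of \<tau>] M20
      by (auto simp: b_def indicator_def abs_mult mult.commute)
  qed
  \<comment> \<open>\<open>tent\<close> is supported in \<open>\<tau> > 0\<close>, where the points of the line lie in \<open>U\<close>, so that continuity of
    \<open>\<Phi>\<close> on the closure of \<open>U\<close> applies\<close>
  have b_lim: "(\<lambda>n. b n y \<tau>) \<longlonglongrightarrow> tent \<tau> * b0 y" for y \<tau>
  proof (cases "tent \<tau> = 0")
    case True
    then show ?thesis by (simp add: b_def)
  next
    case False
    then have "\<tau> \<in> {1..3}" using ramp_facts(4)[of \<tau>] by blast
    then have \<tau>: "\<tau> > 0" by simp
    let ?l = "graph_lift e \<gamma> y"
    have l_graph: "\<gamma> ?l = ?l \<bullet> e"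
      by (simp add: graph_lift_def gD(3,4) inner_add_left)
    have z_lim: "(\<lambda>n. z n y \<tau>) \<longlonglongrightarrow> ?l"
      unfolding z_def using tendsto_add[OF tendsto_const tendsto_scaleR[OF tendsto_mult[OF \<epsilon>_lim tendsto_const] tendsto_const], of ?l \<tau> e]
      by simp
    show ?thesis
    proof (cases "?l \<in> ball c r")
      case True
      then have fr: "?l \<in> frontier U" using graph_chart_closure(2)[OF U(1) g] l_graph by blast
      have "\<forall>\<^sub>F n in sequentially. z n y \<tau> \<in> ball c r"
        using topological_tendstoD[OF z_lim open_ball True] .
      then have zU: "\<forall>\<^sub>F n in sequentially. z n y \<tau> \<in> U"
      proof eventually_elim
        case (elim n)
        have "f n (z n y \<tau>) > 0" using fz \<tau> by simp
        then have "z n y \<tau> \<bullet> e - \<gamma> (z n y \<tau>) > 0" using \<epsilon>[of n] by (simp add: f_def zero_less_divide_iff)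
        then show ?case using gD(9)[OF elim] by simp
      qed
      have "(\<Phi> \<longlongrightarrow> \<Phi> ?l) (at ?l within closure U)"
        using cont fr by (auto simp: continuous_on_def frontier_def)
      moreover have "\<forall>\<^sub>F n in sequentially. z n y \<tau> \<in> closure U \<and> z n y \<tau> \<noteq> ?l"
        using zU by eventually_elim (use fr U(1) closure_subset[of U] in \<open>auto simp: frontier_def interior_open\<close>)
      then have "filterlim (\<lambda>n. z n y \<tau>) (at ?l within closure U) sequentially"
        using z_lim unfolding filterlim_at by blast
      ultimately have "(\<lambda>n. \<Phi> (z n y \<tau>)) \<longlonglongrightarrow> \<Phi> ?l"
        by (rule filterlim_compose)
      then have "(\<lambda>n. tent \<tau> * (N y \<bullet> \<Phi> (z n y \<tau>))) \<longlonglongrightarrow> tent \<tau> * b0 y"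
        using fr by (auto simp: b0_def intro!: tendsto_intros)
      moreover have "\<forall>\<^sub>F n in sequentially. tent \<tau> * (N y \<bullet> \<Phi> (z n y \<tau>)) = b n y \<tau>"
        using zU by eventually_elim (simp add: b_def)
      ultimately show ?thesis by (rule Lim_transform_eventually)
    next
      case False
      then have l: "?l \<in> - K" using K(2) by auto
      have "open (- K)" using compact_imp_closed[OF K(1)] by auto
      from topological_tendstoD[OF z_lim this l]
      have "\<forall>\<^sub>F n in sequentially. b n y \<tau> = tent \<tau> * b0 y"
        by eventually_elim (use l in \<open>simp add: b_def b0_def 0\<close>)
      then show ?thesis by (rule tendsto_eventually)
    qed
  qed
  have a_lim: "(\<lambda>n. a n y) \<longlonglongrightarrow> b0 y" for y
  proof -
    have "(\<lambda>n. LINT \<tau>|lborel. b n y \<tau>) \<longlonglongrightarrow> (LINT \<tau>|lborel. tent \<tau> * b0 y)"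
    proof (rule integral_dominated_convergence[where w = "\<lambda>\<tau>. M2 * tent \<tau>"])
      show "(\<lambda>\<tau>. tent \<tau> * b0 y) \<in> borel_measurable lborel"
        using borel_measurable_integrable[OF integral_tent(1)] by simp
    qed (use b_meas b_bd b_lim integral_tent(1) in auto)
    then show ?thesis using integral_tent(2) by (simp add: a_eq)
  qed
  have a_meas: "a n \<in> borel_measurable borel" for n
  proof -
    have "(\<lambda>y. LINT s|lborel. G n (y + s *\<^sub>R e)) \<in> borel_measurable borel"
      by (rule lborel.borel_measurable_lebesgue_integral) measurable
    then show ?thesis by (simp add: a_def[abs_def])
  qed
  have a_bd: "\<bar>a n y\<bar> \<le> M2" for n y
  proof -
    have "norm (LINT \<tau>|lborel. b n y \<tau>) \<le> (LINT \<tau>|lborel. norm (b n y \<tau>))"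
      by (rule integral_norm_bound)
    also have "\<dots> \<le> (LINT \<tau>|lborel. M2 * tent \<tau>)"
      by (rule integral_mono') (use b_bd integral_tent(1) M20 ramp_facts(2) in auto)
    finally have "norm (LINT \<tau>|lborel. b n y \<tau>) \<le> (LINT \<tau>|lborel. M2 * tent \<tau>)" .
    then show ?thesis using integral_tent by (simp add: a_eq)
  qed
  have a_supp: "a n y = 0" if "y \<in> S" "norm y > R + (R + 1)" for n y
  proof -
    have "G n (y + s *\<^sub>R e) = 0" for s
    proof (rule ccontr)
      assume "G n (y + s *\<^sub>R e) \<noteq> 0"
      then have n: "norm (y + s *\<^sub>R e) \<le> R" using G_supp not_less by blast
      moreover have "\<bar>(y + s *\<^sub>R e) \<bullet> e\<bar> \<le> norm (y + s *\<^sub>R e)"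
        using Cauchy_Schwarz_ineq2[of "y + s *\<^sub>R e" e] gD(2) by simp
      ultimately have "\<bar>s\<bar> \<le> R + 1" using that(1) gD(3) by (auto simp: S_def inner_add_left)
      moreover have "norm y \<le> norm (y + s *\<^sub>R e) + norm (s *\<^sub>R e)"
        using norm_triangle_ineq4[of "y + s *\<^sub>R e" "s *\<^sub>R e"] by simp
      ultimately show False using n that(2) gD(2) by simp
    qed
    then show ?thesis by (simp add: a_def)
  qed
  have "(\<lambda>n. LINT y:S|lborel. a n y) \<longlonglongrightarrow> (LINT y:S|lborel. b0 y)"
    unfolding set_lebesgue_integral_def
  proof (rule integral_dominated_convergence[where w = "\<lambda>y. indicator (cball 0 (R + (R + 1))) y * M2"])
    show "integrable lborel (\<lambda>y::'a. indicator (cball 0 (R + (R + 1))) y * M2)"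
      by (rule integrable_bounded_support[where M = M2 and R = "R + (R + 1)"])
        (use M20 in \<open>auto simp: indicator_def\<close>)
    have "b0 \<in> borel_measurable borel"
      by (rule borel_measurable_LIMSEQ_metric[where f = a]) (use a_meas a_lim in auto)
    then show "(\<lambda>y. indicator S y *\<^sub>R b0 y) \<in> borel_measurable lborel" by simp
    show "(\<lambda>y. indicator S y *\<^sub>R a n y) \<in> borel_measurable lborel" for n using a_meas by simp
    show "AE y in lborel. (\<lambda>n. indicator S y *\<^sub>R a n y) \<longlonglongrightarrow> indicator S y *\<^sub>R b0 y"
      using a_lim by (intro AE_I2 tendsto_intros)
    show "AE y in lborel. norm (indicator S y *\<^sub>R a n y) \<le> indicator (cball 0 (R + (R + 1))) y * M2" for n
      using a_bd[of n] a_supp[of _ n] M20 by (intro AE_I2) (auto simp: indicator_def not_le)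
  qed
  then have "(LINT x:U|lborel. divergence \<Phi> x) = (LINT y:S|lborel. b0 y)"
    using lhs LIMSEQ_unique unfolding cut slab by blast
  also have "\<dots> = graph_integral e \<gamma> (\<lambda>x. indicator (frontier U) x * (\<Phi> x \<bullet> outward_normal U x))"
  proof -
    have "b0 y = indicator (frontier U) (graph_lift e \<gamma> y)
        * (\<Phi> (graph_lift e \<gamma> y) \<bullet> outward_normal U (graph_lift e \<gamma> y)) * sqrt (1 + (norm (grad \<gamma> y))\<^sup>2)" for y
    proof (cases "graph_lift e \<gamma> y \<in> K \<inter> frontier U")
      case True
      then have "sqrt (1 + (norm (grad \<gamma> (graph_lift e \<gamma> y)))\<^sup>2) *\<^sub>R outward_normal U (graph_lift e \<gamma> y)
          = grad \<gamma> (graph_lift e \<gamma> y) - e"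
        using K(2) by (intro outward_normal_graph[OF U(1) g]) auto
      then have "N y = sqrt (1 + (norm (grad \<gamma> y))\<^sup>2) *\<^sub>R outward_normal U (graph_lift e \<gamma> y)"
        by (simp add: graph_lift_def ginv(2) N_def)
      then show ?thesis by (simp add: b0_def inner_commute)
    qed (auto simp: b0_def 0)
    then show ?thesis unfolding graph_integral_def S_def by simp
  qed
  finally show ?thesis .
qed

section \<open>The divergence theorem\<close>

lemma integral_divergence_interior_support:
  fixes F :: "'a::euclidean_space \<Rightarrow> 'a"
  assumes U: "open U" and F: "C1_field U F" and K: "compact K" "K \<subseteq> U"
    and 0: "\<And>x. x \<in> U \<Longrightarrow> x \<notin> K \<Longrightarrow> F x = 0"
  shows "(LINT x:U|lborel. divergence F x) = 0"
proof -
  let ?G = "\<lambda>x. if x \<in> U then F x else 0"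
  have *: "C1_field U ?G" "\<And>x. x \<in> U \<Longrightarrow> divergence ?G x = divergence F x"
    using fields_agree[OF U _ F, of ?G] by auto
  have "(LINT x:U|lborel. divergence F x) = (LINT x:U|lborel. divergence ?G x)"
    by (rule set_lebesgue_integral_cong) (use U *(2) in auto)
  also have "\<dots> = 0"
    using integral_divergence_compact_support[OF *(1) K] 0 by auto
  finally show ?thesis .
qed

lemma C1_scalar_UNIV_bounds:
  assumes "bounded U" "C1_scalar UNIV f"
  obtains B where "B \<ge> 0" "\<And>x. x \<in> closure U \<Longrightarrow> \<bar>f x\<bar> \<le> B" "\<And>x. x \<in> closure U \<Longrightarrow> norm (grad f x) \<le> B"
proof -
  have c: "compact (closure U)" using assms(1) by simp
  have "continuous_on (closure U) f" "continuous_on (closure U) (grad f)"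
    using C1_scalar_imp_continuous_on[OF assms(2)] assms(2)
    by (auto simp: C1_scalar_def intro: continuous_on_subset)
  then obtain B1 B2 where "B1 \<ge> 0" "\<And>x. x \<in> closure U \<Longrightarrow> norm (f x) \<le> B1"
    "B2 \<ge> 0" "\<And>x. x \<in> closure U \<Longrightarrow> norm (grad f x) \<le> B2"
    using continuous_on_compact_bound[OF c] by metis
  then show thesis using that[of "max B1 B2"] by (auto simp: le_max_iff_disj)
qed

lemma divergence_scaleR_bounded:
  assumes U: "open U" "bounded U" and f: "C1_scalar UNIV f"
    and cont: "continuous_on (closure U) F" and C1: "C1_field U F"
    and M: "\<And>x. x \<in> U \<Longrightarrow> \<bar>divergence F x\<bar> \<le> M"
  obtains B where "\<And>x. x \<in> U \<Longrightarrow> \<bar>divergence (\<lambda>x. f x *\<^sub>R F x) x\<bar> \<le> B"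
proof -
  obtain B where B: "B \<ge> 0" "\<And>x. x \<in> closure U \<Longrightarrow> \<bar>f x\<bar> \<le> B" "\<And>x. x \<in> closure U \<Longrightarrow> norm (grad f x) \<le> B"
    using C1_scalar_UNIV_bounds[OF U(2) f] by blast
  obtain L where L: "L \<ge> 0" "\<And>x. x \<in> closure U \<Longrightarrow> norm (F x) \<le> L"
    using continuous_on_compact_bound[OF _ cont] U(2) by auto
  have "\<bar>divergence (\<lambda>x. f x *\<^sub>R F x) x\<bar> \<le> B * M + B * L" if x: "x \<in> U" for x
  proof -
    have xc: "x \<in> closure U" using x closure_subset by blast
    have "C1_scalar U f" using f by (rule C1_scalar_subset) simp
    then have "divergence (\<lambda>x. f x *\<^sub>R F x) x = f x * divergence F x + grad f x \<bullet> F x"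
      using divergence_scaleR C1 x by blast
    moreover have "\<bar>f x * divergence F x\<bar> \<le> B * M"
      unfolding abs_mult using B(1) B(2)[OF xc] M[OF x] by (intro mult_mono) auto
    moreover have "norm (grad f x) * norm (F x) \<le> B * L"
      using B(1) B(3)[OF xc] L(2)[OF xc] by (intro mult_mono) auto
    ultimately show ?thesis
      using Cauchy_Schwarz_ineq2[of "grad f x" "F x"] by linarith
  qed
  then show thesis using that by blast
qed

text \<open>Approximating \<open>z\<^sup>2\<close> by \<open>(|z| - \<epsilon>)\<^sub>+\<^sup>2\<close> gives fields with compact support in \<open>U\<close>. The square is there for
the limit: with \<open>z\<close> alone, the gradients of the approximations would converge to \<open>0\<close> instead of
\<open>\<nabla>z\<close> at interior zeros of \<open>z\<close>, while the gradient \<open>2 z \<nabla>z\<close> of the square vanishes there.\<close>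

lemma integral_divergence_vanishing_square:
  fixes F :: "'a::euclidean_space \<Rightarrow> 'a"
  assumes U: "open U" "bounded U" and z: "C1_scalar UNIV z" and z0: "\<And>x. x \<in> frontier U \<Longrightarrow> z x = 0"
    and cont: "continuous_on (closure U) F" and C1: "C1_field U F"
    and M: "\<And>x. x \<in> U \<Longrightarrow> \<bar>divergence F x\<bar> \<le> M"
  shows "(LINT x:U|lborel. divergence (\<lambda>x. (z x)\<^sup>2 *\<^sub>R F x) x) = 0"
proof -
  define \<epsilon> where "\<epsilon> n = inverse (real (Suc n))" for n
  have \<epsilon>: "\<epsilon> n > 0" for n by (simp add: \<epsilon>_def)
  have \<epsilon>_lim: "\<epsilon> \<longlonglongrightarrow> 0" unfolding \<epsilon>_def[abs_def] by (rule LIMSEQ_inverse_real_of_nat)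
  define \<phi> where "\<phi> n s = (max 0 (s - \<epsilon> n))\<^sup>2 + (max 0 (- s - \<epsilon> n))\<^sup>2" for n s
  define \<phi>' where "\<phi>' n s = 2 * max 0 (s - \<epsilon> n) - 2 * max 0 (- s - \<epsilon> n)" for n s
  have \<phi>_deriv: "(\<phi> n has_real_derivative \<phi>' n s) (at s)" for n s
  proof -
    have "((\<lambda>s. (max 0 (- s - \<epsilon> n))\<^sup>2) has_real_derivative (2 * max 0 (- s - \<epsilon> n)) * (- 1)) (at s)"
      using DERIV_chain2[OF pos_part_square_derivative, where g = "\<lambda>s. - s" and x = s and s = UNIV and Db = "- 1"]
        DERIV_minus[OF DERIV_ident] by force
    from DERIV_add[OF pos_part_square_derivative[of "\<epsilon> n" s] this]
    show ?thesis by (simp add: \<phi>_def[abs_def] \<phi>'_def)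
  qed
  have \<phi>'_cont: "continuous_on S (\<phi>' n)" for S n
    unfolding \<phi>'_def by (intro continuous_intros)
  have \<phi>'_bd: "\<bar>\<phi>' n s\<bar> \<le> 2 * \<bar>s\<bar>" for n s
    using \<epsilon>[of n] by (auto simp: \<phi>'_def max_def)
  have \<phi>_bd: "\<bar>\<phi> n s\<bar> \<le> s\<^sup>2" for n s
  proof -
    have "\<bar>\<phi> n s\<bar> = (max 0 (\<bar>s\<bar> - \<epsilon> n))\<^sup>2" using \<epsilon>[of n] by (auto simp: \<phi>_def max_def)
    also have "\<dots> \<le> \<bar>s\<bar>\<^sup>2" using \<epsilon>[of n] by (intro power_mono) auto
    finally show ?thesis by simp
  qed
  have \<phi>_0: "\<phi> n s = 0" if "\<bar>s\<bar> < \<epsilon> n" for n s using that by (auto simp: \<phi>_def max_def)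
  have \<phi>_lim: "(\<lambda>n. \<phi> n s) \<longlonglongrightarrow> s\<^sup>2" for s
  proof -
    have "(\<lambda>n. \<phi> n s) \<longlonglongrightarrow> (max 0 (s - 0))\<^sup>2 + (max 0 (- s - 0))\<^sup>2"
      unfolding \<phi>_def by (intro tendsto_intros \<epsilon>_lim)
    moreover have "(max 0 (s - 0))\<^sup>2 + (max 0 (- s - 0))\<^sup>2 = s\<^sup>2" by (auto simp: max_def)
    ultimately show ?thesis by simp
  qed
  have \<phi>'_lim: "(\<lambda>n. \<phi>' n s) \<longlonglongrightarrow> 2 * s" for s
  proof -
    have "(\<lambda>n. \<phi>' n s) \<longlonglongrightarrow> 2 * max 0 (s - 0) - 2 * max 0 (- s - 0)"
      unfolding \<phi>'_def by (intro tendsto_intros \<epsilon>_lim)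
    moreover have "2 * max 0 (s - 0) - 2 * max 0 (- s - 0) = 2 * s" by (auto simp: max_def)
    ultimately show ?thesis by simp
  qed
  have zU: "C1_scalar U z" using z by (rule C1_scalar_subset) simp
  note \<phi>z = C1_scalar_compose[OF zU \<phi>_deriv \<phi>'_cont]
  define H where "H n x = \<phi> n (z x) * divergence F x + \<phi>' n (z x) * (grad z x \<bullet> F x)" for n x
  have H: "divergence (\<lambda>x. \<phi> n (z x) *\<^sub>R F x) x = H n x" if "x \<in> U" for n x
    using divergence_scaleR[OF \<phi>z(1) C1 that, of n] \<phi>z(2)[OF that, of n] by (simp add: H_def)
  define H0 where "H0 x = (z x)\<^sup>2 * divergence F x + 2 * z x * (grad z x \<bullet> F x)" for x
  have sq: "((\<lambda>s::real. s\<^sup>2) has_real_derivative 2 * s) (at s)" for s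
    by (auto intro!: derivative_eq_intros)
  have sqc: "continuous_on S (\<lambda>s::real. 2 * s)" for S by (intro continuous_intros)
  note zz = C1_scalar_compose[OF zU sq sqc]
  have H0: "divergence (\<lambda>x. (z x)\<^sup>2 *\<^sub>R F x) x = H0 x" if "x \<in> U" for x
    using divergence_scaleR[OF zz(1) C1 that] zz(2)[OF that] by (simp add: H0_def)
  obtain B where B: "B \<ge> 0" "\<And>x. x \<in> closure U \<Longrightarrow> \<bar>z x\<bar> \<le> B" "\<And>x. x \<in> closure U \<Longrightarrow> norm (grad z x) \<le> B"
    using C1_scalar_UNIV_bounds[OF U(2) z] by blast
  obtain L where L: "L \<ge> 0" "\<And>x. x \<in> closure U \<Longrightarrow> norm (F x) \<le> L"
    using continuous_on_compact_bound[OF _ cont] U(2) by auto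
  define W where "W = max 0 (B\<^sup>2 * M + 2 * B * (B * L))"
  have W: "\<bar>H n x\<bar> \<le> W" if x: "x \<in> U" for n x
  proof -
    have xc: "x \<in> closure U" using x closure_subset by blast
    have 1: "\<bar>\<phi> n (z x)\<bar> \<le> B\<^sup>2"
      using \<phi>_bd[of n "z x"] power_mono[OF B(2)[OF xc], of 2] by simp
    have 2: "\<bar>\<phi>' n (z x)\<bar> \<le> 2 * B" using \<phi>'_bd[of n "z x"] B(2)[OF xc] by linarith
    have 3: "\<bar>grad z x \<bullet> F x\<bar> \<le> B * L"
      using Cauchy_Schwarz_ineq2[of "grad z x" "F x"] mult_mono[OF B(3)[OF xc] L(2)[OF xc] B(1)] by simp
    have "\<bar>\<phi> n (z x) * divergence F x\<bar> \<le> B\<^sup>2 * M"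
      unfolding abs_mult using 1 M[OF x] by (intro mult_mono) auto
    moreover have "\<bar>\<phi>' n (z x) * (grad z x \<bullet> F x)\<bar> \<le> 2 * B * (B * L)"
      unfolding abs_mult using 2 3 B(1) by (intro mult_mono) auto
    ultimately show ?thesis unfolding H_def W_def by linarith
  qed
  have H_int: "set_integrable lborel U (H n)" for n
  proof (rule set_integrable_bounded_open[OF U _ W])
    show "continuous_on U (H n)"
      unfolding H_def
      using zU C1_scalar_imp_continuous_on[OF zU] C1_scalar_imp_continuous_on[OF \<phi>z(1)]
        continuous_on_compose2[OF \<phi>'_cont[of UNIV] C1_scalar_imp_continuous_on[OF zU]]
      by (intro continuous_intros continuous_on_divergence[OF C1] C1_field_imp_continuous_on[OF C1])
        (auto simp: C1_scalar_def)
  qed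
  have H_0: "(LINT x:U|lborel. H n x) = 0" for n
  proof -
    define K where "K = closure U \<inter> {x. \<epsilon> n \<le> \<bar>z x\<bar>}"
    have "closed {x. \<epsilon> n \<le> \<bar>z x\<bar>}"
      using C1_scalar_imp_continuous_on[OF z] by (intro closed_Collect_le continuous_intros)
    then have "compact K" unfolding K_def using U(2) by (intro compact_Int_closed) auto
    moreover have "K \<subseteq> U"
      using z0 \<epsilon>[of n] U(1) by (force simp: K_def frontier_def interior_open)
    moreover have "\<phi> n (z x) *\<^sub>R F x = 0" if "x \<in> U" "x \<notin> K" for x
      using that \<phi>_0[of "z x" n] closure_subset[of U] by (auto simp: K_def)
    ultimately have "(LINT x:U|lborel. divergence (\<lambda>x. \<phi> n (z x) *\<^sub>R F x) x) = 0"
      using integral_divergence_interior_support[OF U(1) C1_field_scaleR[OF \<phi>z(1) C1]] by blast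
    moreover have "(LINT x:U|lborel. divergence (\<lambda>x. \<phi> n (z x) *\<^sub>R F x) x) = (LINT x:U|lborel. H n x)"
      by (rule set_lebesgue_integral_cong) (use U H in auto)
    ultimately show ?thesis by simp
  qed
  have "(\<lambda>n. LINT x:U|lborel. H n x) \<longlonglongrightarrow> (LINT x:U|lborel. H0 x)"
  proof (rule set_integral_bounded_convergence[OF U H_int W])
    show "(\<lambda>n. H n x) \<longlonglongrightarrow> H0 x" for x
      unfolding H_def H0_def by (intro tendsto_intros \<phi>_lim \<phi>'_lim)
  qed
  then have "(LINT x:U|lborel. H0 x) = 0" using H_0 by (simp add: LIMSEQ_const_iff)
  moreover have "(LINT x:U|lborel. divergence (\<lambda>x. (z x)\<^sup>2 *\<^sub>R F x) x) = (LINT x:U|lborel. H0 x)"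
    by (rule set_lebesgue_integral_cong) (use U H0 in auto)
  ultimately show ?thesis by simp
qed

lemma pos_part_power_C2:
  "((\<lambda>s::real. (max 0 s) ^ 3) has_real_derivative 3 * (max 0 s)\<^sup>2) (at s)"
  "((\<lambda>s::real. 3 * (max 0 s)\<^sup>2) has_real_derivative 6 * max 0 s) (at s)"
proof -
  show "((\<lambda>s::real. (max 0 s) ^ 3) has_real_derivative 3 * (max 0 s)\<^sup>2) (at s)"
    using pos_part_power_derivative[of 2 s] by (simp add: eval_nat_numeral)
  show "((\<lambda>s::real. 3 * (max 0 s)\<^sup>2) has_real_derivative 6 * max 0 s) (at s)"
    using DERIV_cmult[OF pos_part_square_derivative[of 0 s], of 3] by simp
qed

lemma C2_on_radial_bump: "C2_on UNIV (\<lambda>x::'a::euclidean_space. (max 0 (a - (norm (x - c))\<^sup>2)) ^ 3)"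
proof -
  have d: "((\<lambda>x. a - (norm (x - c))\<^sup>2) has_derivative (\<lambda>h. (- 2 *\<^sub>R (x - c)) \<bullet> h)) (at x)" for x :: 'a
    unfolding power2_norm_eq_inner
    by (auto intro!: derivative_eq_intros simp: inner_commute)
  have "C1_field UNIV (\<lambda>x::'a. - 2 *\<^sub>R (x - c))"
    by (rule C1_fieldI[where F' = "\<lambda>x h. - 2 *\<^sub>R h"]) (auto intro!: derivative_eq_intros)
  then have "C2_on UNIV (\<lambda>x::'a. a - (norm (x - c))\<^sup>2)"
    by (rule C2_onI(1)[OF open_UNIV d])
  then show ?thesis
    by (rule C2_on_compose[OF open_UNIV _ pos_part_power_C2]) (intro continuous_intros)
qed

text \<open>Finitely many balls of half the chart radius cover the boundary, and bump functions \<open>\<phi>\<^sub>k\<close> on these balls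
have a sum \<open>\<sigma> \<ge> \<delta> > 0\<close> there. Dividing by \<open>\<sigma>\<close> is only possible near the boundary; the denominator
\<open>\<sigma> + (\<delta> - \<sigma>)\<^sub>+\<^sup>3 / \<delta>\<^sup>2\<close> is positive everywhere, of class \<open>C\<^sup>2\<close>, and equal to \<open>\<sigma>\<close> where \<open>\<sigma> \<ge> \<delta>\<close>.\<close>

lemma boundary_atlas_exists:
  assumes U: "bounded_C2_domain U"
  shows "\<exists>m c r e \<gamma> \<eta>. boundary_atlas U m c r e \<gamma> \<eta>"
proof -
  have bU: "bounded U" using U by (simp add: bounded_C2_domain_def)
  have "\<forall>x\<in>frontier U. \<exists>r e \<gamma>. graph_chart U x r e \<gamma>"
    using U by (simp add: bounded_C2_domain_def)
  then obtain R E Gm where ch: "\<And>x. x \<in> frontier U \<Longrightarrow> graph_chart U x (R x) (E x) (Gm x)"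
    by metis
  have comp: "compact (frontier U)" using bU compact_frontier_bounded by blast
  have cover: "frontier U \<subseteq> (\<Union>x\<in>frontier U. ball x (R x / 2))"
    using ch graph_chartD(1) by force
  obtain D where D: "D \<subseteq> frontier U" "finite D" "frontier U \<subseteq> (\<Union>x\<in>D. ball x (R x / 2))"
    using compactE_image[OF comp _ cover] by (metis open_ball)
  obtain h :: "nat \<Rightarrow> 'a" where h: "bij_betw h {..<card D} D"
    using ex_bij_betw_nat_finite[OF D(2)] by (auto simp: atLeast0LessThan)
  define m where "m = card D"
  have hD: "h k \<in> frontier U" if "k < m" for k
    using h D(1) that unfolding m_def bij_betw_def by blast
  define \<phi> where "\<phi> k x = (max 0 ((R (h k) / 2)\<^sup>2 - (norm (x - h k))\<^sup>2)) ^ 3" for k x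
  define \<sigma> where "\<sigma> x = (\<Sum>k<m. \<phi> k x)" for x
  have \<phi>_C2: "C2_on UNIV (\<phi> k)" for k unfolding \<phi>_def by (rule C2_on_radial_bump)
  have \<sigma>_C2: "C2_on UNIV \<sigma>" unfolding \<sigma>_def by (rule C2_on_sum) (auto intro: \<phi>_C2)
  have \<phi>_nonneg: "\<phi> k x \<ge> 0" for k x by (simp add: \<phi>_def)
  have \<sigma>_nonneg: "\<sigma> x \<ge> 0" for x unfolding \<sigma>_def by (intro sum_nonneg \<phi>_nonneg)
  have \<sigma>_pos: "\<sigma> x > 0" if x: "x \<in> frontier U" for x
  proof -
    obtain y where y: "y \<in> D" "x \<in> ball y (R y / 2)" using D(3) x by blast
    then obtain k where k: "k < m" "y = h k" using h unfolding m_def bij_betw_def by blast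
    have "norm (x - h k) < R (h k) / 2" using y k by (simp add: dist_norm norm_minus_commute)
    then have "(norm (x - h k))\<^sup>2 < (R (h k) / 2)\<^sup>2" by (intro power_strict_mono) auto
    then have "\<phi> k x > 0" unfolding \<phi>_def
      by (intro zero_less_power) (simp only: less_max_iff_disj diff_gt_0_iff_gt simp_thms)
    then show ?thesis unfolding \<sigma>_def using k \<phi>_nonneg by (intro sum_pos2[of _ k]) auto
  qed
  have "\<exists>\<delta>>0. \<forall>x\<in>frontier U. \<delta> \<le> \<sigma> x"
  proof (cases "frontier U = {}")
    case False
    have "continuous_on (frontier U) \<sigma>"
      using C1_scalar_imp_continuous_on[OF C2_on_imp_C1_scalar[OF \<sigma>_C2]] by (rule continuous_on_subset) simp
    from continuous_attains_inf[OF comp False this] show ?thesis using \<sigma>_pos by blast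
  qed (auto intro: exI[of _ 1])
  then obtain \<delta> where \<delta>: "\<delta> > 0" "\<And>x. x \<in> frontier U \<Longrightarrow> \<delta> \<le> \<sigma> x" by blast
  define den where "den s = s + (max 0 (\<delta> - s)) ^ 3 / \<delta>\<^sup>2" for s
  have den_pos: "den s > 0" if "s \<ge> 0" for s
  proof (cases "s = 0")
    case False
    then show ?thesis using that \<delta> by (simp add: den_def add_pos_nonneg)
  qed (use \<delta> in \<open>simp add: den_def\<close>)
  have flip: "((\<lambda>s. g (\<delta> - s)) has_real_derivative - g' (\<delta> - s)) (at s)"
    if "\<And>s. (g has_real_derivative g' s) (at s)" for g g' :: "real \<Rightarrow> real" and s
    using DERIV_chain2[OF that, where g = "\<lambda>s. \<delta> - s" and x = s and s = UNIV and Db = "- 1"]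
      DERIV_diff[OF DERIV_const DERIV_ident] by force
  have den1: "(den has_real_derivative 1 + (- (3 * (max 0 (\<delta> - s))\<^sup>2)) / \<delta>\<^sup>2) (at s)" for s
    unfolding den_def[abs_def]
    by (intro DERIV_add DERIV_ident DERIV_cdivide flip[of _ "\<lambda>s. 3 * (max 0 s)\<^sup>2"] pos_part_power_C2)
  have den2: "((\<lambda>s. 1 + (- (3 * (max 0 (\<delta> - s))\<^sup>2)) / \<delta>\<^sup>2)
      has_real_derivative 0 + (- (- (6 * max 0 (\<delta> - s)))) / \<delta>\<^sup>2) (at s)" for s
    by (intro DERIV_add DERIV_const DERIV_cdivide DERIV_minus flip[of _ "\<lambda>s. 6 * max 0 s"] pos_part_power_C2)
  have "C2_on UNIV (\<lambda>x. den (\<sigma> x))"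
    by (rule C2_on_compose[OF open_UNIV \<sigma>_C2 den1 den2]) (use \<delta> in \<open>intro continuous_intros; simp\<close>)
  then have den_C2: "C2_on UNIV (\<lambda>x. inverse (den (\<sigma> x)))"
  proof (rule C2_on_compose[OF open_UNIV])
    fix s assume "s \<in> range (\<lambda>x. den (\<sigma> x))"
    then have s: "s > 0" using den_pos \<sigma>_nonneg by auto
    show "(inverse has_real_derivative - inverse (s\<^sup>2)) (at s)"
      using s DERIV_inverse[of s UNIV] by (simp add: numeral_2_eq_2)
    show "((\<lambda>s. - inverse (s\<^sup>2)) has_real_derivative 2 * inverse (s ^ 3)) (at s)"
      using s by (auto intro!: derivative_eq_intros simp: field_simps eval_nat_numeral)
  next
    show "continuous_on (range (\<lambda>x. den (\<sigma> x))) (\<lambda>s. 2 * inverse (s ^ 3))"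
      using den_pos \<sigma>_nonneg by (intro continuous_intros) (force simp: less_le)
  qed
  define \<eta> where "\<eta> k x = \<phi> k x * inverse (den (\<sigma> x))" for k x
  have "boundary_atlas U m h (\<lambda>k. R (h k)) (\<lambda>k. E (h k)) (\<lambda>k. Gm (h k)) \<eta>"
    unfolding boundary_atlas_def
  proof (intro conjI allI impI ballI)
    fix k assume k: "k < m"
    show gk: "graph_chart U (h k) (R (h k)) (E (h k)) (Gm (h k))" using ch[OF hD[OF k]] .
    show "C2_on UNIV (\<eta> k)" unfolding \<eta>_def by (rule C2_on_mult(1)[OF open_UNIV \<phi>_C2 den_C2])
    show "0 \<le> \<eta> k x" for x
      using \<phi>_nonneg[of k x] den_pos[OF \<sigma>_nonneg, of x] by (simp add: \<eta>_def)
    have Rk: "R (h k) > 0" using graph_chartD(1)[OF gk] .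
    have "{x. \<eta> k x \<noteq> 0} \<subseteq> cball (h k) (R (h k) / 2)"
    proof
      fix x assume "x \<in> {x. \<eta> k x \<noteq> 0}"
      then have "(norm (x - h k))\<^sup>2 < (R (h k) / 2)\<^sup>2" by (auto simp: \<eta>_def \<phi>_def max_def split: if_splits)
      then have "norm (x - h k) < R (h k) / 2" by (rule power2_less_imp_less) (use Rk in simp)
      then show "x \<in> cball (h k) (R (h k) / 2)" by (simp add: dist_norm norm_minus_commute)
    qed
    then have "closure {x. \<eta> k x \<noteq> 0} \<subseteq> cball (h k) (R (h k) / 2)"
      by (rule closure_minimal) simp
    then show "closure {x. \<eta> k x \<noteq> 0} \<subseteq> ball (h k) (R (h k))" using Rk by force
  next
    fix x assume x: "x \<in> frontier U"
    have "den (\<sigma> x) = \<sigma> x" using \<delta>(2)[OF x] by (simp add: den_def)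
    then show "(\<Sum>k<m. \<eta> k x) = 1"
      using \<sigma>_pos[OF x] by (simp add: \<eta>_def sum_distrib_right[symmetric] \<sigma>_def[symmetric])
  qed
  then show ?thesis by blast
qed

lemma surface_integral_atlas:
  assumes "bounded_C2_domain U"
  obtains m c r e \<gamma> \<eta> where "boundary_atlas U m c r e \<gamma> \<eta>"
    and "\<And>\<Gamma> f. surface_integral U \<Gamma> f
      = (\<Sum>k<m. graph_integral (e k) (\<gamma> k) (\<lambda>x. indicator \<Gamma> x * \<eta> k x * f x))"
proof -
  let ?P = "\<lambda>(m, c, r, e, \<gamma>, \<eta>). boundary_atlas U m c r e \<gamma> \<eta>"
  obtain m c r e \<gamma> \<eta> where s: "(SOME z. ?P z) = (m, c, r, e, \<gamma>, \<eta>)"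
    using prod_cases6 by blast
  have "\<exists>z. ?P z" using boundary_atlas_exists[OF assms] by auto
  then have "?P (SOME z. ?P z)" by (rule someI_ex)
  then have "boundary_atlas U m c r e \<gamma> \<eta>" unfolding s by simp
  then show thesis
    by (rule that) (simp add: surface_integral_def s)
qed

text \<open>The functions \<open>\<eta>\<^sub>k\<close> of the atlas have the sum \<open>\<sigma> = 1\<close> on the boundary only, and \<open>1 - \<sigma>\<close> may change sign
inside. Therefore the decomposition of unity \<open>(1 - \<sigma>)\<^sup>2 + \<Sum>\<^sub>k \<eta>\<^sub>k (2 - \<sigma>) = 1\<close> is used: its first term is
a square that vanishes on the boundary, and its other weights agree with \<open>\<eta>\<^sub>k\<close> on the boundary.\<close>

theorem divergence_theorem:
  fixes F :: "'a::euclidean_space \<Rightarrow> 'a"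
  assumes U: "bounded_C2_domain U"
    and cont: "continuous_on (closure U) F" and C1: "C1_field U F"
    and M: "\<And>x. x \<in> U \<Longrightarrow> \<bar>divergence F x\<bar> \<le> M"
  shows "(LINT x:U|lborel. divergence F x)
    = surface_integral U (frontier U) (\<lambda>x. F x \<bullet> outward_normal U x)"
proof -
  have oU: "open U" and bU: "bounded U" using U by (auto simp: bounded_C2_domain_def)
  obtain m c r e \<gamma> \<eta> where at: "boundary_atlas U m c r e \<gamma> \<eta>"
    and S: "\<And>\<Gamma> f. surface_integral U \<Gamma> f
      = (\<Sum>k<m. graph_integral (e k) (\<gamma> k) (\<lambda>x. indicator \<Gamma> x * \<eta> k x * f x))"
    using surface_integral_atlas[OF U] by blast
  define \<sigma> where "\<sigma> x = (\<Sum>k<m. \<eta> k x)" for x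
  have \<sigma>1: "\<sigma> x = 1" if "x \<in> frontier U" for x using at that by (simp add: boundary_atlas_def \<sigma>_def)
  have \<eta>_C2: "C2_on UNIV (\<eta> k)" if "k < m" for k using at that by (simp add: boundary_atlas_def)
  have \<sigma>_C2: "C2_on UNIV \<sigma>" unfolding \<sigma>_def by (rule C2_on_sum) (auto intro: \<eta>_C2)
  have s_C2: "C2_on UNIV (\<lambda>x. a + (- 1) * \<sigma> x)" for a
    by (intro C2_on_add C2_on_mult(1) C2_on_const \<sigma>_C2 open_UNIV)
  define w where "w k x = \<eta> k x * (2 + (- 1) * \<sigma> x)" for k x
  have w_C1: "C1_scalar UNIV (w k)" if "k < m" for k
    unfolding w_def by (intro C2_on_imp_C1_scalar C2_on_mult(1) \<eta>_C2 that s_C2 open_UNIV)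
  define z where "z x = 1 + (- 1) * \<sigma> x" for x
  have z_C1: "C1_scalar UNIV z" unfolding z_def by (intro C2_on_imp_C1_scalar s_C2)
  have z2_C1: "C1_scalar UNIV (\<lambda>x. (z x)\<^sup>2)"
    unfolding z_def power2_eq_square by (intro C2_on_imp_C1_scalar C2_on_mult(1) s_C2 open_UNIV)
  define f where "f i x = (if i = m then (z x)\<^sup>2 else w i x)" for i x
  have f_C1: "C1_scalar UNIV (f i)" if "i \<le> m" for i
    using z2_C1 w_C1[of i] that by (cases "i = m") (auto simp: f_def[abs_def])
  have f_sum: "(\<Sum>i\<le>m. f i x) = 1" for x
  proof -
    have "(\<Sum>i\<le>m. f i x) = (\<Sum>i<m. f i x) + f m x"
      by (simp add: lessThan_Suc_atMost[symmetric])
    also have "(\<Sum>i<m. f i x) = (\<Sum>i<m. w i x)" by (rule sum.cong) (auto simp: f_def)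
    also have "\<dots> = \<sigma> x * (2 - \<sigma> x)" by (simp add: w_def \<sigma>_def sum_distrib_right)
    finally show ?thesis by (simp add: f_def z_def power2_eq_square algebra_simps)
  qed
  have fU: "C1_scalar U (f i)" if "i \<le> m" for i using f_C1[OF that] by (rule C1_scalar_subset) simp
  have fF: "C1_field U (\<lambda>x. f i x *\<^sub>R F x)" if "i \<le> m" for i
    using C1_field_scaleR[OF fU[OF that] C1] .
  have F_split: "F x = (\<Sum>i\<le>m. f i x *\<^sub>R F x)" for x
    using f_sum[of x] by (simp add: scaleR_left.sum[symmetric])
  have div_split: "divergence F x = (\<Sum>i\<le>m. divergence (\<lambda>x. f i x *\<^sub>R F x) x)" if "x \<in> U" for x
  proof -
    have "divergence F x = divergence (\<lambda>x. \<Sum>i\<le>m. f i x *\<^sub>R F x) x" using F_split by simp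
    also have "\<dots> = (\<Sum>i\<le>m. divergence (\<lambda>x. f i x *\<^sub>R F x) x)"
      by (rule divergence_sum[OF _ that]) (auto intro: fF)
    finally show ?thesis .
  qed
  have int: "set_integrable lborel U (divergence (\<lambda>x. f i x *\<^sub>R F x))" if i: "i \<le> m" for i
  proof -
    obtain B where "\<And>x. x \<in> U \<Longrightarrow> \<bar>divergence (\<lambda>x. f i x *\<^sub>R F x) x\<bar> \<le> B"
      using divergence_scaleR_bounded[OF oU bU f_C1[OF i] cont C1 M] by blast
    then show ?thesis
      by (intro set_integrable_bounded_open[OF oU bU continuous_on_divergence[OF fF[OF i]]])
  qed
  have "(LINT x:U|lborel. divergence F x) = (LINT x:U|lborel. \<Sum>i\<le>m. divergence (\<lambda>x. f i x *\<^sub>R F x) x)"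
    by (rule set_lebesgue_integral_cong) (use oU div_split in auto)
  also have "\<dots> = (\<Sum>i\<le>m. LINT x:U|lborel. divergence (\<lambda>x. f i x *\<^sub>R F x) x)"
    unfolding set_lebesgue_integral_def scaleR_sum_right
    by (rule Bochner_Integration.integral_sum) (use int in \<open>auto simp: set_integrable_def\<close>)
  also have "\<dots> = (\<Sum>i<m. LINT x:U|lborel. divergence (\<lambda>x. f i x *\<^sub>R F x) x)
      + (LINT x:U|lborel. divergence (\<lambda>x. f m x *\<^sub>R F x) x)"
    by (simp add: lessThan_Suc_atMost[symmetric])
  also have "(LINT x:U|lborel. divergence (\<lambda>x. f m x *\<^sub>R F x) x) = 0"
    unfolding f_def using integral_divergence_vanishing_square[OF oU bU z_C1 _ cont C1 M] \<sigma>1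
    by (simp add: z_def)
  also have "(\<Sum>i<m. LINT x:U|lborel. divergence (\<lambda>x. f i x *\<^sub>R F x) x)
      = (\<Sum>i<m. graph_integral (e i) (\<gamma> i) (\<lambda>x. indicator (frontier U) x * \<eta> i x * (F x \<bullet> outward_normal U x)))"
  proof (rule sum.cong[OF refl])
    fix k assume "k \<in> {..<m}"
    then have k: "k < m" by simp
    let ?K = "closure {x. \<eta> k x \<noteq> 0}"
    have fk: "f k = w k" using k by (simp add: f_def[abs_def])
    have g: "graph_chart U (c k) (r k) (e k) (\<gamma> k)" and K: "?K \<subseteq> ball (c k) (r k)"
      using at k by (auto simp: boundary_atlas_def)
    have cK: "compact ?K" using K bounded_subset[OF bounded_ball] by (auto simp: compact_eq_bounded_closed)
    have K0: "f k x *\<^sub>R F x = 0" if "x \<notin> ?K" for x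
      using that closure_subset[of "{x. \<eta> k x \<noteq> 0}"] by (auto simp: fk w_def)
    obtain B where B: "\<And>x. x \<in> U \<Longrightarrow> \<bar>divergence (\<lambda>x. f k x *\<^sub>R F x) x\<bar> \<le> B"
      using divergence_scaleR_bounded[OF oU bU f_C1 cont C1 M, of k] k by auto
    have cf: "continuous_on (closure U) (\<lambda>x. f k x *\<^sub>R F x)"
      using C1_scalar_imp_continuous_on[OF f_C1, of k] k cont
      by (intro continuous_intros) (auto intro: continuous_on_subset)
    have "(LINT x:U|lborel. divergence (\<lambda>x. f k x *\<^sub>R F x) x)
        = graph_integral (e k) (\<gamma> k) (\<lambda>x. indicator (frontier U) x * ((f k x *\<^sub>R F x) \<bullet> outward_normal U x))"
      using divergence_chart[OF oU bU g cf _ cK K K0 B] fF[of k] k by simp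
    also have "(\<lambda>x. indicator (frontier U) x * ((f k x *\<^sub>R F x) \<bullet> outward_normal U x))
        = (\<lambda>x. indicator (frontier U) x * \<eta> k x * (F x \<bullet> outward_normal U x))"
      using \<sigma>1 by (auto simp: fun_eq_iff indicator_def fk w_def)
    finally show "(LINT x:U|lborel. divergence (\<lambda>x. f k x *\<^sub>R F x) x)
        = graph_integral (e k) (\<gamma> k) (\<lambda>x. indicator (frontier U) x * \<eta> k x * (F x \<bullet> outward_normal U x))" .
  qed
  finally show ?thesis by (simp add: S)
qed

section \<open>Green's identity\<close>

lemma surface_integral_eqI:
  assumes "\<And>x. indicator \<Gamma> x * f x = indicator \<Gamma>' x * g x"
  shows "surface_integral U \<Gamma> f = surface_integral U \<Gamma>' g"
proof -
  have "(\<lambda>x. indicator \<Gamma> x * \<eta> x * f x) = (\<lambda>x. indicator \<Gamma>' x * \<eta> x * g x)" for \<eta> :: "'a \<Rightarrow> real"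
    using assms by (metis mult.assoc mult.commute)
  then show ?thesis unfolding surface_integral_def by (simp only:)
qed

lemma surface_integral_cmult: "surface_integral U \<Gamma> (\<lambda>x. c * f x) = c * surface_integral U \<Gamma> f"
proof -
  have "graph_integral e \<gamma> (\<lambda>x. indicator \<Gamma> x * \<eta> x * (c * f x))
      = c * graph_integral e \<gamma> (\<lambda>x. indicator \<Gamma> x * \<eta> x * f x)" for e \<gamma> and \<eta> :: "'a \<Rightarrow> real"
    unfolding graph_integral_def set_integral_mult_right[symmetric]
    by (simp add: mult_ac)
  then show ?thesis
    by (simp add: surface_integral_def split_beta sum_distrib_left)
qed

text \<open>The functions for which Green's identity is used. Only the Laplacian is bounded, since the flow
equation gives no control of the other second derivatives near the boundary.\<close>

definition regular_on :: "'a::euclidean_space set \<Rightarrow> ('a \<Rightarrow> real) \<Rightarrow> bool" where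
  "regular_on U f \<longleftrightarrow> C2_on U f \<and> C1_closure U f \<and> (\<exists>M. \<forall>x\<in>U. \<bar>laplacian f x\<bar> \<le> M)"

lemma grad_bd_eq:
  assumes U: "open U" and G: "continuous_on (closure U) G" "\<And>x. x \<in> U \<Longrightarrow> G x = grad f x"
    and x: "x \<in> frontier U"
  shows "grad_bd U f x = G x"
proof -
  have xU: "x \<in> closure U" "x \<notin> U" using x U by (auto simp: frontier_def interior_open)
  then have "x islimpt U" by (simp add: closure_def)
  then have nt: "at x within U \<noteq> bot" by (simp add: trivial_limit_within)
  have "(G \<longlongrightarrow> G x) (at x within closure U)" using G(1) xU by (simp add: continuous_on_def)
  then have "(G \<longlongrightarrow> G x) (at x within U)" by (rule tendsto_within_subset) (rule closure_subset)
  moreover have "\<forall>\<^sub>F y in at x within U. G y = grad f y"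
    using G(2) by (simp add: eventually_at_filter)
  ultimately have "(grad f \<longlongrightarrow> G x) (at x within U)" by (rule Lim_transform_eventually)
  then show ?thesis unfolding grad_bd_def using nt by (rule tendsto_Lim[rotated])
qed

lemma C1_closureE:
  assumes "open U" "C1_closure U f"
  obtains G where "continuous_on (closure U) G" "\<And>x. x \<in> U \<Longrightarrow> G x = grad f x"
      "\<And>x. x \<in> frontier U \<Longrightarrow> grad_bd U f x = G x"
  using assms grad_bd_eq unfolding C1_closure_def by metis

lemma regular_on_lincomb:
  assumes U: "open U" and f: "regular_on U f" and g: "regular_on U g"
  shows "regular_on U (\<lambda>x. a * f x + b * g x + c)"
    and "\<And>x. x \<in> U \<Longrightarrow> laplacian (\<lambda>x. a * f x + b * g x + c) x = a * laplacian f x + b * laplacian g x"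
    and "\<And>x. x \<in> frontier U \<Longrightarrow>
      grad_bd U (\<lambda>x. a * f x + b * g x + c) x = a *\<^sub>R grad_bd U f x + b *\<^sub>R grad_bd U g x"
proof -
  let ?h = "\<lambda>x. a * f x + b * g x + c"
  have f2: "C2_on U f" and g2: "C2_on U g" and f1: "C1_closure U f" and g1: "C1_closure U g"
    using f g by (auto simp: regular_on_def)
  note fU = C2_on_grad_field[OF f2] and gU = C2_on_grad_field[OF g2]
  have d: "(?h has_derivative (\<lambda>k. (a *\<^sub>R grad f x + b *\<^sub>R grad g x) \<bullet> k)) (at x)" if "x \<in> U" for x
    using has_derivative_grad[of f x] has_derivative_grad[of g x] f2 g2 that
    by (auto intro!: derivative_eq_intros simp: C2_on_def inner_add_left)
  have e: "((\<lambda>x. a *\<^sub>R grad f x + b *\<^sub>R grad g x) has_derivative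
      (\<lambda>k. a *\<^sub>R frechet_derivative (grad f) (at x) k + b *\<^sub>R frechet_derivative (grad g) (at x) k)) (at x)"
    if "x \<in> U" for x
    using C1_fieldD[OF fU that] C1_fieldD[OF gU that] by (auto intro!: derivative_eq_intros)
  have C1: "C1_field U (\<lambda>x. a *\<^sub>R grad f x + b *\<^sub>R grad g x)"
    by (rule C1_fieldI[OF e]) (use fU gU in \<open>auto simp: C1_field_def intro!: continuous_intros\<close>)
  note r = C2_onI[OF U d C1]
  show lap: "laplacian ?h x = a * laplacian f x + b * laplacian g x" if "x \<in> U" for x
  proof -
    have "laplacian ?h x = divergence (\<lambda>x. a *\<^sub>R grad f x + b *\<^sub>R grad g x) x"
      using r(3) that by blast
    then show ?thesis
      unfolding divergence_eqI[OF e[OF that]] laplacian_def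
      unfolding divergence_def by (simp add: inner_add_left sum.distrib sum_distrib_left)
  qed
  obtain F G where F: "continuous_on (closure U) F" "\<And>x. x \<in> U \<Longrightarrow> F x = grad f x"
      "\<And>x. x \<in> frontier U \<Longrightarrow> grad_bd U f x = F x"
    and G: "continuous_on (closure U) G" "\<And>x. x \<in> U \<Longrightarrow> G x = grad g x"
      "\<And>x. x \<in> frontier U \<Longrightarrow> grad_bd U g x = G x"
    using C1_closureE[OF U f1] C1_closureE[OF U g1] by metis
  have H: "continuous_on (closure U) (\<lambda>x. a *\<^sub>R F x + b *\<^sub>R G x)"
    using F(1) G(1) by (intro continuous_intros)
  have HU: "a *\<^sub>R F x + b *\<^sub>R G x = grad ?h x" if "x \<in> U" for x
    using F(2) G(2) r(2) that by simp
  show "grad_bd U ?h x = a *\<^sub>R grad_bd U f x + b *\<^sub>R grad_bd U g x" if "x \<in> frontier U" for x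
    using grad_bd_eq[OF U H HU that] F(3) G(3) that by simp
  have "C1_closure U ?h"
    unfolding C1_closure_def
    using f1 g1 d H HU by (auto simp: C1_closure_def differentiable_def intro!: continuous_intros)
  moreover obtain M N where M: "\<And>x. x \<in> U \<Longrightarrow> \<bar>laplacian f x\<bar> \<le> M" and N: "\<And>x. x \<in> U \<Longrightarrow> \<bar>laplacian g x\<bar> \<le> N"
    using f g by (auto simp: regular_on_def)
  have "\<bar>laplacian ?h x\<bar> \<le> \<bar>a\<bar> * M + \<bar>b\<bar> * N" if "x \<in> U" for x
  proof -
    have "\<bar>a\<bar> * \<bar>laplacian f x\<bar> \<le> \<bar>a\<bar> * M" "\<bar>b\<bar> * \<bar>laplacian g x\<bar> \<le> \<bar>b\<bar> * N"
      using M[OF that] N[OF that] by (auto intro: mult_left_mono)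
    then show ?thesis unfolding lap[OF that] 
      by (metis abs_mult abs_triangle_ineq add_mono order_trans)
  qed
  ultimately show "regular_on U ?h" using r(1) unfolding regular_on_def by blast
qed

lemma grad_const: "grad (\<lambda>x. c) = (\<lambda>x. 0)"
  by (rule ext, rule grad_eqI) simp

lemma regular_on_const:
  assumes "open U"
  shows "regular_on U (\<lambda>x. c)"
proof -
  have "laplacian (\<lambda>x::'a. c) x = 0" for x
    unfolding laplacian_def grad_const by (subst divergence_eqI[where F' = "\<lambda>h. 0"]) auto
  then show ?thesis
    unfolding regular_on_def C1_closure_def using C2_on_const[OF assms]
    by (auto simp: grad_const intro!: exI[of _ "\<lambda>x. 0"] exI[of _ 0])
qed

lemma regular_on_integrable:
  assumes U: "open U" "bounded U" and f: "regular_on U f"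
  shows "set_integrable lborel U f"
proof -
  have c: "continuous_on (closure U) f" using f by (simp add: regular_on_def C1_closure_def)
  then obtain M where "\<And>x. x \<in> closure U \<Longrightarrow> norm (f x) \<le> M"
    using continuous_on_compact_bound[of "closure U" f] U(2) by auto
  then show ?thesis
    using subsetD[OF closure_subset, of _ U]
    by (intro set_integrable_bounded_open[OF U continuous_on_subset[OF c closure_subset], where M = M]) auto
qed

theorem green_identity:
  assumes dom: "bounded_C2_domain U" and f: "regular_on U f" and g: "regular_on U g"
  shows "set_integrable lborel U (\<lambda>x. grad f x \<bullet> grad g x)"
    and "set_integrable lborel U (\<lambda>x. f x * laplacian g x)"
    and "(LINT x:U|lborel. grad f x \<bullet> grad g x) + (LINT x:U|lborel. f x * laplacian g x)
      = surface_integral U (frontier U) (\<lambda>x. f x * (grad_bd U g x \<bullet> outward_normal U x))"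
proof -
  have U: "open U" "bounded U" using dom by (auto simp: bounded_C2_domain_def)
  have cU: "compact (closure U)" using U by simp
  have f2: "C2_on U f" and g2: "C2_on U g" and f1: "C1_closure U f" and g1: "C1_closure U g"
    using f g by (auto simp: regular_on_def)
  note fU = C2_on_imp_C1_scalar[OF f2] and gU = C2_on_grad_field[OF g2]
  have fc: "continuous_on (closure U) f" using f1 by (simp add: C1_closure_def)
  obtain F G where F: "continuous_on (closure U) F" "\<And>x. x \<in> U \<Longrightarrow> F x = grad f x"
    and G: "continuous_on (closure U) G" "\<And>x. x \<in> U \<Longrightarrow> G x = grad g x"
      "\<And>x. x \<in> frontier U \<Longrightarrow> grad_bd U g x = G x"
    using C1_closureE[OF U(1) f1] C1_closureE[OF U(1) g1] by metis
  obtain L where L: "L \<ge> 0" "\<And>x. x \<in> closure U \<Longrightarrow> norm (f x) \<le> L"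
    using continuous_on_compact_bound[OF cU fc] by blast
  obtain N where N: "N \<ge> 0" "\<And>x. x \<in> closure U \<Longrightarrow> norm (F x \<bullet> G x) \<le> N"
    using continuous_on_compact_bound[OF cU, of "\<lambda>x. F x \<bullet> G x"] F(1) G(1) continuous_on_inner by blast
  obtain M where M: "\<And>x. x \<in> U \<Longrightarrow> \<bar>laplacian g x\<bar> \<le> M" using g by (auto simp: regular_on_def)
  have b1: "\<bar>grad f x \<bullet> grad g x\<bar> \<le> N" if "x \<in> U" for x
    using N(2)[of x] F(2)[OF that] G(2)[OF that] subsetD[OF closure_subset that] by simp
  have b2: "\<bar>f x * laplacian g x\<bar> \<le> L * M" if "x \<in> U" for x
    unfolding abs_mult using L M[OF that] subsetD[OF closure_subset that] by (intro mult_mono) auto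
  show i1: "set_integrable lborel U (\<lambda>x. grad f x \<bullet> grad g x)"
    using fU C1_field_imp_continuous_on[OF gU] b1
    by (intro set_integrable_bounded_open[OF U]) (auto simp: C1_scalar_def intro!: continuous_intros)
  show i2: "set_integrable lborel U (\<lambda>x. f x * laplacian g x)"
    using C1_scalar_imp_continuous_on[OF fU] continuous_on_divergence[OF gU] b2
    by (intro set_integrable_bounded_open[OF U]) (auto simp: laplacian_def intro!: continuous_intros)
  have GU: "C1_field U G" and divG: "\<And>x. x \<in> U \<Longrightarrow> divergence G x = laplacian g x"
    using fields_agree[OF U(1) G(2)[symmetric] gU] by (auto simp: laplacian_def)
  have div: "divergence (\<lambda>x. f x *\<^sub>R G x) x = grad f x \<bullet> grad g x + f x * laplacian g x" if "x \<in> U" for x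
    using divergence_scaleR[OF fU GU that] divG[OF that] G(2)[OF that] by simp
  have "(LINT x:U|lborel. grad f x \<bullet> grad g x) + (LINT x:U|lborel. f x * laplacian g x)
      = (LINT x:U|lborel. grad f x \<bullet> grad g x + f x * laplacian g x)"
    using set_integral_add(2)[OF i1 i2] by simp
  also have "\<dots> = (LINT x:U|lborel. divergence (\<lambda>x. f x *\<^sub>R G x) x)"
    by (rule set_lebesgue_integral_cong) (use U div in auto)
  also have "\<dots> = surface_integral U (frontier U) (\<lambda>x. (f x *\<^sub>R G x) \<bullet> outward_normal U x)"
  proof (rule divergence_theorem[OF dom])
    show "continuous_on (closure U) (\<lambda>x. f x *\<^sub>R G x)" using fc G(1) by (intro continuous_intros)
    show "C1_field U (\<lambda>x. f x *\<^sub>R G x)" by (rule C1_field_scaleR[OF fU GU])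
    show "\<bar>divergence (\<lambda>x. f x *\<^sub>R G x) x\<bar> \<le> N + L * M" if "x \<in> U" for x
      unfolding div[OF that] using b1[OF that] b2[OF that] by linarith
  qed
  also have "\<dots> = surface_integral U (frontier U) (\<lambda>x. f x * (grad_bd U g x \<bullet> outward_normal U x))"
    by (rule surface_integral_eqI) (use G(3) in \<open>auto simp: indicator_def\<close>)
  finally show "(LINT x:U|lborel. grad f x \<bullet> grad g x) + (LINT x:U|lborel. f x * laplacian g x)
      = surface_integral U (frontier U) (\<lambda>x. f x * (grad_bd U g x \<bullet> outward_normal U x))" .
qed

corollary green_identity_no_flux:
  assumes dom: "bounded_C2_domain U" and f: "regular_on U f" and g: "regular_on U g"
    and bd: "\<And>x. x \<in> frontier U \<Longrightarrow> f x * (grad_bd U g x \<bullet> outward_normal U x) = 0"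
  shows "(LINT x:U|lborel. grad f x \<bullet> grad g x) = - (LINT x:U|lborel. f x * laplacian g x)"
proof -
  have "surface_integral U (frontier U) (\<lambda>x. f x * (grad_bd U g x \<bullet> outward_normal U x))
      = surface_integral U (frontier U) (\<lambda>x. 0 * 0)"
    by (rule surface_integral_eqI) (use bd in \<open>auto simp: indicator_def\<close>)
  then show ?thesis
    using green_identity(3)[OF dom f g] surface_integral_cmult[of U "frontier U" 0 "\<lambda>x. 0"] by simp
qed

corollary integral_laplacian:
  assumes dom: "bounded_C2_domain U" and g: "regular_on U g"
  shows "(LINT x:U|lborel. laplacian g x)
      = surface_integral U (frontier U) (\<lambda>x. grad_bd U g x \<bullet> outward_normal U x)"
proof -
  have "open U" using dom by (simp add: bounded_C2_domain_def)
  from green_identity(3)[OF dom regular_on_const[OF this, of 1] g]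
  show ?thesis by (simp add: grad_const)
qed

lemma set_integral_nonneg:
  fixes f :: "'a \<Rightarrow> real"
  shows "(\<And>x. x \<in> U \<Longrightarrow> 0 \<le> f x) \<Longrightarrow> 0 \<le> (LINT x:U|M. f x)"
  unfolding set_lebesgue_integral_def by (rule Bochner_Integration.integral_nonneg) (auto simp: indicator_def)

section \<open>Parameter integrals and positive integrals\<close>

lemma has_real_derivative_set_integral:
  fixes g g' :: "'a::euclidean_space \<Rightarrow> real \<Rightarrow> real"
  assumes U: "open U" "bounded U"
    and d: "\<And>x s. x \<in> U \<Longrightarrow> s \<in> {a..b} \<Longrightarrow> (g x has_real_derivative g' x s) (at s within {a..b})"
    and M: "\<And>x s. x \<in> U \<Longrightarrow> s \<in> {a..b} \<Longrightarrow> \<bar>g' x s\<bar> \<le> M"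
    and int: "\<And>s. s \<in> {a..b} \<Longrightarrow> set_integrable lborel U (\<lambda>x. g x s)"
    and t: "t \<in> {a..b}"
  shows "((\<lambda>s. LINT x:U|lborel. g x s) has_real_derivative (LINT x:U|lborel. g' x t)) (at t within {a..b})"
  unfolding has_field_derivative_iff tendsto_at_iff_sequentially o_def
proof (intro allI impI)
  fix X :: "nat \<Rightarrow> real" assume X: "\<forall>i. X i \<in> {a..b} - {t}" "X \<longlonglongrightarrow> t"
  define q where "q i x = (g x (X i) - g x t) / (X i - t)" for i x
  have Xi: "X i \<in> {a..b}" "X i \<noteq> t" for i using X(1) by auto
  have qi: "set_integrable lborel U (q i)" for i
    unfolding q_def by (intro set_integrable_divide set_integral_diff int Xi t)
  have "(LINT x:U|lborel. q i x) = ((LINT x:U|lborel. g x (X i)) - (LINT x:U|lborel. g x t)) / (X i - t)" for i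
    unfolding q_def set_integral_divide_zero by (subst set_integral_diff) (use int Xi t in auto)
  moreover have "(\<lambda>i. LINT x:U|lborel. q i x) \<longlonglongrightarrow> (LINT x:U|lborel. g' x t)"
  proof (rule set_integral_bounded_convergence[OF U qi])
    fix x assume x: "x \<in> U"
    show "\<bar>q i x\<bar> \<le> M" for i
    proof -
      have "norm (g x (X i) - g x t) \<le> M * norm (X i - t)"
        by (rule field_differentiable_bound[where S = "{a..b}" and f' = "g' x"])
          (use d[OF x] M[OF x] Xi t in auto)
      then show ?thesis using Xi(2)[of i] by (simp add: q_def abs_divide pos_divide_le_eq)
    qed
    have "((\<lambda>y. (g x y - g x t) / (y - t)) \<longlongrightarrow> g' x t) (at t within {a..b})"
      using d[OF x t] by (simp add: has_field_derivative_iff)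
    then show "(\<lambda>i. q i x) \<longlonglongrightarrow> g' x t"
      unfolding tendsto_at_iff_sequentially o_def q_def using X by blast
  qed
  ultimately show "(\<lambda>i. ((LINT x:U|lborel. g x (X i)) - (LINT x:U|lborel. g x t)) / (X i - t))
      \<longlonglongrightarrow> (LINT x:U|lborel. g' x t)" by simp
qed

lemma measure_open_pos:
  fixes U :: "'a::euclidean_space set"
  assumes "open U" "bounded U" "U \<noteq> {}"
  shows "measure lborel U > 0"
proof -
  have "emeasure lborel U \<noteq> 0"
  proof
    assume "emeasure lborel U = 0"
    then have "U \<in> null_sets lborel" using assms(1) by (intro null_setsI) auto
    then have "negligible U" by (simp add: negligible_iff_null_sets null_sets_completionI)
    then show False using open_not_negligible assms by blast
  qed
  moreover have "emeasure lborel U < \<infinity>" using emeasure_bounded_finite[OF assms(2)] .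
  ultimately show ?thesis by (simp add: measure_def enn2real_positive_iff top.not_eq_extremum zero_less_iff_neq_zero)
qed

lemma set_integral_pos:
  fixes f :: "'a::euclidean_space \<Rightarrow> real"
  assumes U: "open U" and c: "continuous_on U f" and i: "set_integrable lborel U f"
    and nn: "\<And>x. x \<in> U \<Longrightarrow> f x \<ge> 0" and x: "x \<in> U" "f x > 0"
  shows "(LINT x:U|lborel. f x) > 0"
proof -
  let ?V = "U \<inter> f -` {f x / 2 <..}"
  have "open ?V" using continuous_open_preimage[OF c U, of "{f x / 2 <..}"] by simp
  moreover have "x \<in> ?V" using x by simp
  ultimately obtain r where r: "r > 0" "ball x r \<subseteq> ?V" by (rule openE)
  have "0 < f x / 2 * measure lborel (ball x r)"
    using measure_open_pos[of "ball x r"] r(1) x(2) by simp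
  also have "\<dots> = (LINT y:ball x r|lborel. f x / 2)"
    using set_integral_const_bounded(2)[of "ball x r" "f x / 2"] by simp
  also have "\<dots> \<le> (LINT y:U|lborel. f y)"
    unfolding set_lebesgue_integral_def
  proof (rule integral_mono')
    show "integrable lborel (\<lambda>x. indicat_real U x *\<^sub>R f x)" using i by (simp add: set_integrable_def)
    show "indicator (ball x r) y *\<^sub>R (f x / 2) \<le> indicator U y *\<^sub>R f y" for y
      using r(2) nn[of y] by (auto simp: indicator_def)
    show "0 \<le> indicator U y *\<^sub>R f y" for y using nn by (auto simp: indicator_def)
  qed
  finally show ?thesis .
qed

section \<open>The gas flow for one large boundary pressure\<close>

text \<open>One boundary pressure \<open>B\<close> is kept fixed here. The number \<open>\<omega>\<close> bounds \<open>W\<close>, and the last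
condition makes the auxiliary pressure positive for either sign of \<open>W\<close>. The constants \<open>K\<close> and \<open>\<kappa>\<close>
below do not depend on \<open>B\<close>, which is what makes the limit possible.\<close>

locale gas_flow =
  fixes U \<Gamma>e \<Gamma>i :: "'a::euclidean_space set" and A T B C \<omega> :: real
    and W :: "'a \<Rightarrow> real" and p :: "'a \<Rightarrow> real \<Rightarrow> real"
  assumes dom: "bounded_C2_domain U" and fr: "frontier U = \<Gamma>e \<union> \<Gamma>i"
    and A: "A > 0" and T: "T > 0"
    and steady: "steady_solution U \<Gamma>e \<Gamma>i A W"
    and sol: "gas_solution U \<Gamma>e \<Gamma>i A W T B p"
    and rate: "\<And>x t. x \<in> U \<Longrightarrow> 0 \<le> t \<Longrightarrow> t \<le> T \<Longrightarrow> \<bar>time_deriv T p x t\<bar> \<le> C"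
    and W_bound: "\<And>x. x \<in> closure U \<Longrightarrow> \<bar>W x\<bar> \<le> \<omega>"
    and B1: "B \<ge> 1" and B_large: "A * T < B" "2 * \<omega> < (B - A * T)\<^sup>2"
begin

abbreviation pt :: "'a \<Rightarrow> real \<Rightarrow> real" where "pt \<equiv> time_deriv T p"

definition v :: "real \<Rightarrow> 'a \<Rightarrow> real" where "v t x = (p x t)\<^sup>2"

text \<open>The bound for the distance of \<open>p\<close> from its boundary value \<open>B - A t\<close>.\<close>

definition K :: real where "K = 2 * \<omega> + (A + C) * T"

lemma U: "open U" "bounded U" "U \<noteq> {}"
  using dom by (auto simp: bounded_C2_domain_def)

lemma C0: "C \<ge> 0"
proof -
  obtain x where "x \<in> U" using U by blast
  then show ?thesis using rate[of x 0] T by simp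
qed

lemma omega_nonneg: "\<omega> \<ge> 0"
proof -
  obtain x where "x \<in> closure U" using U closure_subset by blast
  then show ?thesis using W_bound[of x] by simp
qed

lemma K0: "K \<ge> 0"
  using omega_nonneg A C0 T by (simp add: K_def)

lemma regularity: "classical_regularity U T p"
  using sol by (simp add: gas_solution_def)

lemma p_deriv:
  assumes "x \<in> U" "t \<in> {0..T}"
  shows "(p x has_real_derivative pt x t) (at t within {0..T})"
  using regularity assms
  by (simp add: classical_regularity_def time_deriv_def has_real_derivative_iff_has_vector_derivative
      vector_derivative_works[symmetric])

lemma p_slice:
  assumes t: "t \<in> {0..T}"
  shows "C2_on U (\<lambda>y. p y t)" "continuous_on (closure U) (\<lambda>y. p y t)" "continuous_on U (\<lambda>y. pt y t)"
proof -
  show "C2_on U (\<lambda>y. p y t)" using regularity t by (simp add: classical_regularity_def)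
  have slice: "continuous_on V (\<lambda>x. f x t)" if "continuous_on (V \<times> {0..T}) (\<lambda>(x, t). f x t)"
    for V and f :: "'a \<Rightarrow> real \<Rightarrow> real"
  proof -
    have "continuous_on V (\<lambda>x. case (x, t) of (x, t) \<Rightarrow> f x t)"
      by (rule continuous_on_compose2[OF that]) (use t in \<open>auto intro!: continuous_intros\<close>)
    then show ?thesis by simp
  qed
  show "continuous_on (closure U) (\<lambda>y. p y t)" "continuous_on U (\<lambda>y. pt y t)"
    using regularity by (auto simp: classical_regularity_def intro!: slice)
qed

lemma p_continuous_U: "t \<in> {0..T} \<Longrightarrow> continuous_on U (\<lambda>y. p y t)"
  by (rule continuous_on_subset[OF p_slice(2) closure_subset])

lemma p_C1_closure:
  assumes t: "t \<in> {0<..T}"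
  shows "C1_closure U (\<lambda>y. p y t)"
proof -
  have t': "t \<in> {0..T}" using t by simp
  obtain G where G: "continuous_on (closure U \<times> {0<..T}) G"
    "\<And>x t. x \<in> U \<Longrightarrow> t \<in> {0<..T} \<Longrightarrow> G (x, t) = grad (\<lambda>y. p y t) x"
    using regularity unfolding classical_regularity_def by blast
  have "continuous_on (closure U) (G \<circ> (\<lambda>x. (x, t)))"
    using G(1) t by (intro continuous_on_compose continuous_intros) (auto intro: continuous_on_subset)
  then have "continuous_on (closure U) (\<lambda>x. G (x, t)) \<and> (\<forall>x\<in>U. G (x, t) = grad (\<lambda>y. p y t) x)"
    using G(2) t by (simp add: o_def)
  then have "\<exists>H. continuous_on (closure U) H \<and> (\<forall>x\<in>U. H x = grad (\<lambda>y. p y t) x)"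
    by (rule exI[of _ "\<lambda>x. G (x, t)"])
  then show ?thesis
    using p_slice(1,2)[OF t'] unfolding C1_closure_def C2_on_def by blast
qed

lemma v_interior:
  assumes t: "t \<in> {0..T}"
  shows "C2_on U (v t)"
    and "\<And>x. x \<in> U \<Longrightarrow> grad (v t) x = (2 * p x t) *\<^sub>R grad (\<lambda>y. p y t) x"
    and "\<And>x. x \<in> U \<Longrightarrow> laplacian (v t) x = 2 * divergence (\<lambda>y. p y t *\<^sub>R grad (\<lambda>z. p z t) y) x"
proof -
  have v: "v t = (\<lambda>x. p x t * p x t)" by (simp add: v_def power2_eq_square fun_eq_iff)
  note p2 = p_slice(1)[OF t]
  note m = C2_on_mult[OF U(1) p2 p2]
  show "C2_on U (v t)" unfolding v by (rule m(1))
  show "grad (v t) x = (2 * p x t) *\<^sub>R grad (\<lambda>y. p y t) x" if "x \<in> U" for x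
    unfolding v using m(2)[OF that] by (simp add: scaleR_left.add[symmetric])
  show "laplacian (v t) x = 2 * divergence (\<lambda>y. p y t *\<^sub>R grad (\<lambda>z. p z t) y) x" if "x \<in> U" for x
    unfolding v using m(3)[OF that]
      divergence_scaleR[OF C2_on_imp_C1_scalar[OF p2] C2_on_grad_field[OF p2] that]
    by (simp add: laplacian_def)
qed

lemma laplacian_v:
  assumes "t \<in> {0<..T}" "x \<in> U"
  shows "laplacian (v t) x = 2 * pt x t"
  using v_interior(3)[of t x] assms sol by (simp add: gas_solution_def)

lemma v_regular:
  assumes t: "t \<in> {0<..T}"
  shows "regular_on U (v t)"
    and "\<And>x. x \<in> frontier U \<Longrightarrow> grad_bd U (v t) x = (2 * p x t) *\<^sub>R grad_bd U (\<lambda>y. p y t) x"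
proof -
  have t': "t \<in> {0..T}" using t by simp
  obtain G where G: "continuous_on (closure U) G" "\<And>x. x \<in> U \<Longrightarrow> G x = grad (\<lambda>y. p y t) x"
    "\<And>x. x \<in> frontier U \<Longrightarrow> grad_bd U (\<lambda>y. p y t) x = G x"
    using C1_closureE[OF U(1) p_C1_closure[OF t]] by blast
  have H: "continuous_on (closure U) (\<lambda>x. (2 * p x t) *\<^sub>R G x)"
    using p_slice(2)[OF t'] G(1) by (intro continuous_intros)
  have HU: "(2 * p x t) *\<^sub>R G x = grad (v t) x" if "x \<in> U" for x
    using G(2) v_interior(2)[OF t'] that by simp
  show "grad_bd U (v t) x = (2 * p x t) *\<^sub>R grad_bd U (\<lambda>y. p y t) x" if "x \<in> frontier U" for x
    using grad_bd_eq[OF U(1) H HU that] G(3)[OF that] by simp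
  have "continuous_on (closure U) (v t)"
    unfolding v_def using p_slice(2)[OF t'] by (intro continuous_intros)
  then have "C1_closure U (v t)"
    unfolding C1_closure_def using H HU v_interior(1)[OF t'] by (auto simp: C2_on_def)
  moreover have "\<bar>laplacian (v t) x\<bar> \<le> 2 * C" if "x \<in> U" for x
    using laplacian_v[OF t that] rate[OF that, of t] t by simp
  ultimately show "regular_on U (v t)"
    using v_interior(1)[OF t'] unfolding regular_on_def by blast
qed

lemma v_boundary:
  assumes t: "t \<in> {0<..T}"
  shows "x \<in> \<Gamma>i \<Longrightarrow> v t x = (B - A * t)\<^sup>2"
    and "x \<in> \<Gamma>e \<Longrightarrow> grad_bd U (v t) x \<bullet> outward_normal U x = 0"
  using sol v_regular(2)[OF t, of x] t fr by (auto simp: gas_solution_def v_def)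

lemma laplacian_W: "x \<in> U \<Longrightarrow> laplacian W x = - A"
  using steady unfolding steady_solution_def by fastforce

lemma W_regular: "regular_on U W"
proof -
  have "\<forall>x\<in>U. \<bar>laplacian W x\<bar> \<le> A" using laplacian_W A by simp
  then show ?thesis using steady unfolding steady_solution_def regular_on_def by blast
qed

lemma W_boundary:
  shows "x \<in> \<Gamma>i \<Longrightarrow> W x = 0" and "x \<in> \<Gamma>e \<Longrightarrow> grad_bd U W x \<bullet> outward_normal U x = 0"
  using steady by (auto simp: steady_solution_def)

lemma B_At: "t \<in> {0..T} \<Longrightarrow> B - A * T \<le> B - A * t \<and> B - A * t \<le> B"
  using A by auto

lemma aux_sq:
  assumes "t \<in> {0..T}" "x \<in> closure U"
  shows "(B - A * t)\<^sup>2 + 2 * W x > 0" "(aux_pressure A W B x t)\<^sup>2 = (B - A * t)\<^sup>2 + 2 * W x"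
    "aux_pressure A W B x t > 0"
proof -
  have "(B - A * T)\<^sup>2 \<le> (B - A * t)\<^sup>2" using B_At[OF assms(1)] B_large by (intro power_mono) auto
  then show *: "(B - A * t)\<^sup>2 + 2 * W x > 0" using W_bound[OF assms(2)] B_large by linarith
  then show "(aux_pressure A W B x t)\<^sup>2 = (B - A * t)\<^sup>2 + 2 * W x" "aux_pressure A W B x t > 0"
    by (simp_all add: aux_pressure_def)
qed

lemma p_Lipschitz:
  assumes "x \<in> U" "s \<in> {0..T}" "t \<in> {0..T}"
  shows "\<bar>p x t - p x s\<bar> \<le> C * \<bar>t - s\<bar>"
proof -
  have "norm (p x t - p x s) \<le> C * norm (t - s)"
    by (rule field_differentiable_bound[where S = "{0..T}" and f' = "pt x"])
      (use p_deriv rate assms in auto)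
  then show ?thesis by simp
qed

text \<open>Initially \<open>p - B = 2 W / (p + B)\<close> is bounded, and both \<open>p\<close> and \<open>B - A t\<close> change at bounded rates.\<close>

lemma p_near:
  assumes x: "x \<in> U" and t: "t \<in> {0..T}"
  shows "\<bar>p x t - (B - A * t)\<bar> \<le> K"
proof -
  have xc: "x \<in> closure U" using x closure_subset by blast
  have "C * \<bar>t - 0\<bar> \<le> C * T" using C0 t by (intro mult_left_mono) auto
  then have 1: "\<bar>p x t - p x 0\<bar> \<le> C * T" using p_Lipschitz[OF x _ t, of 0] T by force
  have p0: "p x 0 = aux_pressure A W B x 0" using sol x by (simp add: gas_solution_def)
  have "\<bar>p x 0 - B\<bar> \<le> 2 * \<omega>"
  proof -
    have z: "(0::real) \<in> {0..T}" using T by simp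
    have "(p x 0 - B) * (p x 0 + B) = 2 * W x"
      using aux_sq(2)[OF z xc] by (simp add: p0 algebra_simps power2_eq_square)
    then have "\<bar>p x 0 - B\<bar> * (p x 0 + B) = 2 * \<bar>W x\<bar>"
      using aux_sq(3)[OF z xc] B1 abs_mult[of "p x 0 - B" "p x 0 + B"] abs_mult[of 2 "W x"] by (simp add: p0)
    moreover have "\<bar>p x 0 - B\<bar> * 1 \<le> \<bar>p x 0 - B\<bar> * (p x 0 + B)"
      using aux_sq(3)[OF z xc] B1 by (intro mult_left_mono) (auto simp: p0)
    ultimately show ?thesis using W_bound[OF xc] by simp
  qed
  moreover have "0 \<le> A * t" "A * t \<le> A * T" using A t by auto
  ultimately show ?thesis using 1 unfolding K_def by (simp add: algebra_simps)
qed

lemma p_bounds: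
  assumes "x \<in> U" "t \<in> {0..T}"
  shows "B - A * T - K \<le> p x t" "p x t \<le> B + K"
  using p_near[OF assms] B_At[OF assms(2)] unfolding abs_le_iff by linarith+

text \<open>The equation is only imposed for \<open>t > 0\<close>, but both of its sides are continuous down to \<open>t = 0\<close>, where the
square of \<open>p\<close> is \<open>B\<^sup>2 + 2 W\<close>.\<close>

lemma p_initial_rate:
  assumes x: "x \<in> U"
  shows "pt x 0 = - A"
proof -
  define r where "r t = p x t * (\<Sum>b\<in>Basis. frechet_derivative (grad (\<lambda>y. p y t)) (at x) b \<bullet> b)
      + grad (\<lambda>y. p y t) x \<bullet> grad (\<lambda>y. p y t) x" for t
  have r: "divergence (\<lambda>y. p y t *\<^sub>R grad (\<lambda>z. p z t) y) x = r t" if "t \<in> {0..T}" for t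
    using divergence_scaleR[OF C2_on_imp_C1_scalar C2_on_grad_field x, OF p_slice(1)[OF that] p_slice(1)[OF that]]
    by (simp add: r_def divergence_def)
  have sl: "continuous_on {0..T} (\<lambda>t. f (x, t))" if "continuous_on (U \<times> {0..T}) f" for f :: "'a \<times> real \<Rightarrow> 'b::topological_space"
  proof -
    have "continuous_on {0..T} (f \<circ> (\<lambda>t. (x, t)))"
      using that x by (intro continuous_on_compose continuous_intros) (auto intro: continuous_on_subset)
    then show ?thesis by (simp add: o_def)
  qed
  have c1: "continuous_on {0..T} (\<lambda>t. grad (\<lambda>y. p y t) x)"
    using sl[of "\<lambda>(x, t). grad (\<lambda>y. p y t) x"] regularity by (simp add: classical_regularity_def)
  have c2: "continuous_on {0..T} (\<lambda>t. frechet_derivative (grad (\<lambda>y. p y t)) (at x) b)" if "b \<in> Basis" for b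
    using sl[of "\<lambda>(x, t). frechet_derivative (grad (\<lambda>y. p y t)) (at x) b"] regularity that
    by (simp add: classical_regularity_def)
  have c3: "continuous_on {0..T} (p x)"
    using p_deriv[OF x] by (rule DERIV_continuous_on)
  have c4: "continuous_on {0..T} (pt x)"
    using sl[of "\<lambda>(x, t). pt x t"] regularity by (simp add: classical_regularity_def)
  have "continuous_on (closure {0<..T}) (\<lambda>t. pt x t - r t)"
    using T c1 c2 c3 c4 unfolding r_def by (auto intro!: continuous_intros)
  moreover have "pt x t - r t = 0" if "t \<in> {0<..T}" for t
    using that r[of t] sol x by (simp add: gas_solution_def)
  moreover have "0 \<in> closure {0<..T}" using T by simp
  ultimately have "pt x 0 - r 0 = 0" by (rule continuous_constant_on_closure)
  moreover have "2 * r 0 = - (2 * A)"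
  proof -
    have z: "(0::real) \<in> {0..T}" using T by simp
    have eq: "1 * W y + 1 * W y + B\<^sup>2 = v 0 y" if "y \<in> U" for y
    proof -
      have "y \<in> closure U" using that closure_subset by blast
      then show ?thesis using aux_sq(2)[OF z, of y] sol that by (simp add: v_def gas_solution_def)
    qed
    note l = regular_on_lincomb[OF U(1) W_regular W_regular, where a = 1 and b = 1 and c = "B\<^sup>2"]
    have "grad (v 0) y = grad (\<lambda>y. 1 * W y + 1 * W y + B\<^sup>2) y" if "y \<in> U" for y
    proof (rule grad_eqI)
      have "((\<lambda>y. 1 * W y + 1 * W y + B\<^sup>2) has_derivative (\<lambda>h. grad (\<lambda>y. 1 * W y + 1 * W y + B\<^sup>2) y \<bullet> h)) (at y)"
        using l(1) that by (intro has_derivative_grad) (auto simp: regular_on_def C2_on_def)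
      from has_derivative_transform_within_open[OF this U(1) that eq]
      show "(v 0 has_derivative (\<lambda>h. grad (\<lambda>y. 1 * W y + 1 * W y + B\<^sup>2) y \<bullet> h)) (at y)" by simp
    qed
    then have "laplacian (v 0) x = laplacian (\<lambda>y. 1 * W y + 1 * W y + B\<^sup>2) x"
      unfolding laplacian_def
      using divergence_cong[OF U(1) _ C2_on_grad_field _, of "\<lambda>y. 1 * W y + 1 * W y + B\<^sup>2" "grad (v 0)" x] l(1) x
      by (simp add: regular_on_def)
    also have "\<dots> = - (2 * A)" using l(2)[OF x] laplacian_W[OF x] by simp
    finally show ?thesis using v_interior(3)[OF z x] r[OF z] by simp
  qed
  ultimately show ?thesis by simp
qed

text \<open>The function \<open>w = v(s) - v(t) - const\<close> vanishes on \<open>\<Gamma>i\<close>, has no flux through \<open>\<Gamma>e\<close>, and its Laplacian is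
twice the second factor; the integral is \<open>- 1/2 \<integral>|\<nabla>w|\<^sup>2\<close>.\<close>

lemma energy_dissipation:
  assumes s: "s \<in> {0<..T}" and t: "t \<in> {0<..T}"
  shows "(LINT x:U|lborel. (v s x - v t x - ((B - A * s)\<^sup>2 - (B - A * t)\<^sup>2)) * (pt x s - pt x t)) \<le> 0"
proof -
  define c where "c = (B - A * s)\<^sup>2 - (B - A * t)\<^sup>2"
  let ?w = "\<lambda>x. 1 * v s x + (- 1) * v t x + (- c)"
  note l = regular_on_lincomb[OF U(1) v_regular(1)[OF s] v_regular(1)[OF t], where a = 1 and b = "- 1" and c = "- c"]
  have "?w x * (grad_bd U ?w x \<bullet> outward_normal U x) = 0" if x: "x \<in> frontier U" for x
  proof (cases "x \<in> \<Gamma>i")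
    case True
    then show ?thesis using v_boundary(1)[OF s] v_boundary(1)[OF t] by (simp add: c_def)
  next
    case False
    then have "x \<in> \<Gamma>e" using x fr by blast
    then show ?thesis unfolding l(3)[OF x] using v_boundary(2)[OF s] v_boundary(2)[OF t]
      by (simp add: inner_diff_left)
  qed
  from green_identity_no_flux[OF dom l(1) l(1) this]
  have "(LINT x:U|lborel. ?w x * laplacian ?w x) = - (LINT x:U|lborel. grad ?w x \<bullet> grad ?w x)" by simp
  also have "\<dots> \<le> 0" by (simp add: set_integral_nonneg)
  finally have "(LINT x:U|lborel. ?w x * laplacian ?w x) \<le> 0" .
  moreover have "(LINT x:U|lborel. ?w x * laplacian ?w x)
      = (LINT x:U|lborel. 2 * ((v s x - v t x - c) * (pt x s - pt x t)))"
  proof (rule set_lebesgue_integral_cong)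
    show "\<forall>x. x \<in> U \<longrightarrow> ?w x * laplacian ?w x = 2 * ((v s x - v t x - c) * (pt x s - pt x t))"
    proof (intro allI impI)
      fix x assume x: "x \<in> U"
      show "?w x * laplacian ?w x = 2 * ((v s x - v t x - c) * (pt x s - pt x t))"
        unfolding l(2)[OF x] laplacian_v[OF s x] laplacian_v[OF t x] by (simp add: algebra_simps)
    qed
  qed (use U in auto)
  ultimately show ?thesis by (simp add: c_def)
qed

text \<open>The first term bounds the growth over the time \<open>T\<close> of the corrected energy \<open>\<integral>\<Phi>\<close> in the proof below,
the second one its distance from the energy at the two end points of the time interval.\<close>

definition \<kappa> :: real where "\<kappa> = 6 * (A + C) ^ 3 * T + 8 * A * K * (A + C)"

text \<open>Let \<open>\<Phi> = P d\<^sup>2 - 2 A h S d\<close>. Its time derivative is \<open>2 w d\<^sub>t + R\<close> with \<open>w = P d - A h S\<close> and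
\<open>R = P\<^sub>t d\<^sup>2 - 2 A h S\<^sub>t d = O(h\<^sup>2)\<close>. The term \<open>2 w d\<^sub>t\<close> has an integral \<open>\<le> 0\<close>, and \<open>\<Phi>\<close> differs from \<open>P d\<^sup>2\<close>
by \<open>O(h\<^sup>2)\<close>. The term subtracted from \<open>P d\<^sup>2\<close> is the one that completes \<open>2 P d d\<^sub>t\<close> to \<open>2 w d\<^sub>t\<close>; the
difference could not be estimated directly, since \<open>d\<^sub>t\<close> is bounded but not of order \<open>h\<close>.\<close>

lemma shifted_energy:
  assumes h: "0 < h" "h < t" and t: "t \<le> T"
  shows "(LINT x:U|lborel. (p x t + p x (t - h)) * (p x t - p x (t - h) + A * h)\<^sup>2)
    \<le> (LINT x:U|lborel. (p x h + p x 0) * (p x h - p x 0 + A * h)\<^sup>2) + h\<^sup>2 * \<kappa> * measure lborel U"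
proof -
  let ?a = "A + C"
  have a: "?a \<ge> 0" using A C0 by simp
  define I where "I = {0..t - h}"
  have I: "s \<in> {0..T}" "s + h \<in> {0..T}" if "s \<in> I" for s using that h t by (auto simp: I_def)
  define d where "d x s = p x (s + h) - p x s + A * h" for x s
  define P where "P x s = p x (s + h) + p x s" for x s
  define S where "S x s = P x s - (2 * B - 2 * A * s - A * h)" for x s
  define d' where "d' x s = pt x (s + h) - pt x s" for x s
  define P' where "P' x s = pt x (s + h) + pt x s" for x s
  define w where "w x s = P x s * d x s - A * h * S x s" for x s
  define R where "R x s = P' x s * (d x s)\<^sup>2 - 2 * A * h * (P' x s + 2 * A) * d x s" for x s
  define \<Phi> where "\<Phi> x s = P x s * (d x s)\<^sup>2 - 2 * A * h * S x s * d x s" for x s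
  define \<Phi>' where "\<Phi>' x s = 2 * (w x s * d' x s) + R x s" for x s
  have d_bd: "\<bar>d x s\<bar> \<le> ?a * h" if x: "x \<in> U" and s: "s \<in> I" for x s
  proof -
    have "\<bar>p x (s + h) - p x s\<bar> \<le> C * h" using p_Lipschitz[OF x I[OF s]] h by simp
    moreover have "0 \<le> A * h" using A h by simp
    ultimately show ?thesis unfolding d_def distrib_right by linarith
  qed
  have S_bd: "\<bar>S x s\<bar> \<le> 2 * K" if x: "x \<in> U" and s: "s \<in> I" for x s
  proof -
    have "S x s = (p x (s + h) - (B - A * (s + h))) + (p x s - (B - A * s))"
      by (simp add: S_def P_def algebra_simps)
    then show ?thesis using p_near[OF x I(1)[OF s]] p_near[OF x I(2)[OF s]] by linarith
  qed
  have P_bd: "\<bar>P x s\<bar> \<le> 2 * (B + K)" if x: "x \<in> U" and s: "s \<in> I" for x s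
    using p_bounds[OF x I(1)[OF s]] p_bounds[OF x I(2)[OF s]] B_large(1) B1 K0
    unfolding P_def distrib_left by linarith
  have pt_bd: "\<bar>P' x s\<bar> \<le> 2 * C" "\<bar>d' x s\<bar> \<le> 2 * C" if x: "x \<in> U" and s: "s \<in> I" for x s
    using rate[OF x, of s] rate[OF x, of "s + h"] I[OF s] by (auto simp: P'_def d'_def)
  have R_bd: "\<bar>R x s\<bar> \<le> 6 * ?a ^ 3 * h\<^sup>2" if x: "x \<in> U" and s: "s \<in> I" for x s
  proof -
    have "\<bar>P' x s * (d x s)\<^sup>2\<bar> \<le> (2 * ?a) * (?a * h)\<^sup>2"
      unfolding abs_mult abs_power2 power2_abs[of "d x s", symmetric]
      using pt_bd(1)[OF x s] d_bd[OF x s] A C0 by (intro mult_mono power_mono) auto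
    moreover have "\<bar>2 * A * h * (P' x s + 2 * A) * d x s\<bar> \<le> (2 * ?a * h) * (2 * ?a) * (?a * h)"
      unfolding abs_mult[of _ "d x s"] abs_mult[of _ "P' x s + 2 * A"]
      using pt_bd(1)[OF x s] d_bd[OF x s] A C0 h by (intro mult_mono) auto
    ultimately have "\<bar>R x s\<bar> \<le> (2 * ?a) * (?a * h)\<^sup>2 + (2 * ?a * h) * (2 * ?a) * (?a * h)"
      unfolding R_def by linarith
    also have "\<dots> = 6 * ?a ^ 3 * h\<^sup>2"
      by (simp add: power2_eq_square power3_eq_cube algebra_simps)
    finally show ?thesis .
  qed
  have w_bd: "\<bar>w x s\<bar> \<le> 2 * (B + K) * (?a * h) + A * h * (2 * K)" if x: "x \<in> U" and s: "s \<in> I" for x s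
  proof -
    have "\<bar>P x s * d x s\<bar> \<le> 2 * (B + K) * (?a * h)"
      unfolding abs_mult using P_bd[OF x s] d_bd[OF x s] B1 K0 by (intro mult_mono) auto
    moreover have "\<bar>A * h * S x s\<bar> \<le> A * h * (2 * K)"
      unfolding abs_mult using S_bd[OF x s] A h by (intro mult_mono) auto
    ultimately show ?thesis unfolding w_def by linarith
  qed
  \<comment> \<open>\<open>w\<close> is the increment of \<open>v\<close> less its value on \<open>\<Gamma>i\<close>\<close>
  have w_v: "w x s = v (s + h) x - v s x - ((B - A * (s + h))\<^sup>2 - (B - A * s)\<^sup>2)" for x s
    by (simp add: w_def P_def d_def S_def v_def power2_eq_square algebra_simps)
  have cont: "continuous_on U (\<lambda>x. p x s)" "continuous_on U (\<lambda>x. p x (s + h))"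
      "continuous_on U (\<lambda>x. pt x s)" "continuous_on U (\<lambda>x. pt x (s + h))" if "s \<in> I" for s
    using p_continuous_U[OF I(1)[OF that]] p_continuous_U[OF I(2)[OF that]]
      p_slice(3)[OF I(1)[OF that]] p_slice(3)[OF I(2)[OF that]] by auto
  have c: "continuous_on U (\<lambda>x. P x s)" "continuous_on U (\<lambda>x. d x s)" "continuous_on U (\<lambda>x. S x s)"
      "continuous_on U (\<lambda>x. P' x s)" "continuous_on U (\<lambda>x. d' x s)" if "s \<in> I" for s
    unfolding P_def d_def S_def P'_def d'_def using cont[OF that] by (auto intro!: continuous_intros)
  have wd_int: "set_integrable lborel U (\<lambda>x. w x s * d' x s)" if s: "s \<in> I" for s
  proof (rule set_integrable_bounded_open[OF U(1,2)])
    show "continuous_on U (\<lambda>x. w x s * d' x s)"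
      unfolding w_def using c[OF s] by (auto intro!: continuous_intros)
    show "\<bar>w x s * d' x s\<bar> \<le> (2 * (B + K) * (?a * h) + A * h * (2 * K)) * (2 * C)" if "x \<in> U" for x
      unfolding abs_mult using w_bd[OF that s] pt_bd(2)[OF that s] by (intro mult_mono) auto
  qed
  have R_int: "set_integrable lborel U (\<lambda>x. R x s)" if s: "s \<in> I" for s
  proof (rule set_integrable_bounded_open[OF U(1,2)])
    show "continuous_on U (\<lambda>x. R x s)"
      unfolding R_def using c[OF s] by (auto intro!: continuous_intros)
  qed (use R_bd[OF _ s] in auto)
  have Y_int: "set_integrable lborel U (\<lambda>x. P x s * (d x s)\<^sup>2)" if s: "s \<in> I" for s
  proof (rule set_integrable_bounded_open[OF U(1,2)])
    show "continuous_on U (\<lambda>x. P x s * (d x s)\<^sup>2)"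
      using c[OF s] by (auto intro!: continuous_intros)
    show "\<bar>P x s * (d x s)\<^sup>2\<bar> \<le> 2 * (B + K) * (?a * h)\<^sup>2" if "x \<in> U" for x
      unfolding abs_mult abs_power2 power2_abs[of "d x s", symmetric]
      using P_bd[OF that s] d_bd[OF that s] B1 K0 by (intro mult_mono power_mono) auto
  qed
  have Sd_bd: "\<bar>2 * A * h * S x s * d x s\<bar> \<le> 4 * A * K * ?a * h\<^sup>2" if x: "x \<in> U" and s: "s \<in> I" for x s
  proof -
    have "\<bar>2 * A * h * S x s * d x s\<bar> \<le> (2 * A * h) * (2 * K) * (?a * h)"
      unfolding abs_mult[of _ "d x s"] abs_mult[of _ "S x s"]
      using S_bd[OF x s] d_bd[OF x s] A K0 h by (intro mult_mono) auto
    also have "\<dots> = 4 * A * K * ?a * h\<^sup>2" by (simp add: power2_eq_square)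
    finally show ?thesis .
  qed
  have Sd_int: "set_integrable lborel U (\<lambda>x. 2 * A * h * S x s * d x s)" if s: "s \<in> I" for s
  proof (rule set_integrable_bounded_open[OF U(1,2)])
    show "continuous_on U (\<lambda>x. 2 * A * h * S x s * d x s)"
      using c[OF s] by (auto intro!: continuous_intros)
  qed (use Sd_bd[OF _ s] in auto)
  have \<Phi>_int: "set_integrable lborel U (\<lambda>x. \<Phi> x s)" if s: "s \<in> I" for s
    unfolding \<Phi>_def by (intro set_integral_diff Y_int Sd_int s)
  have \<Phi>_deriv: "(\<Phi> x has_real_derivative \<Phi>' x s) (at s within I)" if x: "x \<in> U" and s: "s \<in> I" for x s
  proof -
    have sub: "I \<subseteq> {0..T}" "(\<lambda>s. s + h) ` I \<subseteq> {0..T}" using I by auto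
    have 1: "(p x has_real_derivative pt x s) (at s within I)"
      using p_deriv[OF x I(1)[OF s]] sub(1) by (rule DERIV_subset)
    have "(p x has_real_derivative pt x (s + h)) (at (s + h) within (\<lambda>s. s + h) ` I)"
      using p_deriv[OF x I(2)[OF s]] sub(2) by (rule DERIV_subset)
    moreover have "((\<lambda>s. s + h) has_real_derivative 1) (at s within I)"
      by (auto intro!: derivative_eq_intros)
    ultimately have 2: "((\<lambda>s. p x (s + h)) has_real_derivative pt x (s + h)) (at s within I)"
      using DERIV_image_chain[of "p x" "pt x (s + h)" "\<lambda>s. s + h" s I 1] by (simp add: o_def)
    show ?thesis
      unfolding \<Phi>_def \<Phi>'_def w_def R_def S_def P_def P'_def d_def d'_def
      by (rule derivative_eq_intros 1 2 refl)+ (simp add: power2_eq_square algebra_simps)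
  qed
  define J where "J s = (LINT x:U|lborel. \<Phi> x s)" for s
  have \<Phi>'_bd: "\<bar>\<Phi>' x s\<bar> \<le> 2 * ((2 * (B + K) * (?a * h) + A * h * (2 * K)) * (2 * C)) + 6 * ?a ^ 3 * h\<^sup>2"
    if x: "x \<in> U" and s: "s \<in> I" for x s
  proof -
    have "\<bar>w x s * d' x s\<bar> \<le> (2 * (B + K) * (?a * h) + A * h * (2 * K)) * (2 * C)"
      unfolding abs_mult using w_bd[OF x s] pt_bd(2)[OF x s] by (intro mult_mono) auto
    then show ?thesis using R_bd[OF x s] unfolding \<Phi>'_def by linarith
  qed
  have J_deriv: "(J has_real_derivative (LINT x:U|lborel. \<Phi>' x s)) (at s within I)" if "s \<in> I" for s
    unfolding J_def[abs_def] using \<Phi>_deriv \<Phi>'_bd \<Phi>_int that unfolding I_def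
    by (intro has_real_derivative_set_integral[OF U(1,2)]) auto
  have "\<exists>s\<in>{0<..<t - h}. J (t - h) - J 0 = (LINT x:U|lborel. \<Phi>' x s) * (t - h - 0)"
    using h J_deriv unfolding I_def
    by (intro mvt_simple) (auto simp: has_field_derivative_def)
  then obtain s where s: "0 < s" "s < t - h" and J: "J (t - h) - J 0 = (LINT x:U|lborel. \<Phi>' x s) * (t - h)"
    by auto
  have sI: "s \<in> I" using s by (simp add: I_def)
  let ?m = "measure lborel U"
  have "(LINT x:U|lborel. \<Phi>' x s) = 2 * (LINT x:U|lborel. w x s * d' x s) + (LINT x:U|lborel. R x s)"
    unfolding \<Phi>'_def using wd_int[OF sI] R_int[OF sI]
    by (subst set_integral_add(2)) auto
  also have "(LINT x:U|lborel. w x s * d' x s) \<le> 0"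
    unfolding w_v d'_def using energy_dissipation[of "s + h" s] s h t by simp
  also have "(LINT x:U|lborel. R x s) \<le> (LINT x:U|lborel. 6 * ?a ^ 3 * h\<^sup>2)"
    using R_bd[OF _ sI]
    by (intro set_integral_mono R_int[OF sI] set_integral_const_bounded[OF U(1,2)]) (simp add: abs_le_iff)
  also have "\<dots> = 6 * ?a ^ 3 * h\<^sup>2 * ?m" by (rule set_integral_const_bounded(2)[OF U(1,2)])
  finally have "(LINT x:U|lborel. \<Phi>' x s) \<le> 6 * ?a ^ 3 * h\<^sup>2 * ?m" by simp
  then have "J (t - h) - J 0 \<le> 6 * ?a ^ 3 * h\<^sup>2 * ?m * (t - h)"
    unfolding J using h by (intro mult_right_mono) auto
  also have "\<dots> \<le> 6 * ?a ^ 3 * h\<^sup>2 * ?m * T"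
    using a h t by (intro mult_left_mono) auto
  finally have JJ: "J (t - h) - J 0 \<le> 6 * ?a ^ 3 * h\<^sup>2 * ?m * T" .
  have near: "\<bar>J s - (LINT x:U|lborel. P x s * (d x s)\<^sup>2)\<bar> \<le> 4 * A * K * ?a * h\<^sup>2 * ?m" if s: "s \<in> I" for s
  proof -
    let ?E = "LINT x:U|lborel. 2 * A * h * S x s * d x s"
    have "J s - (LINT x:U|lborel. P x s * (d x s)\<^sup>2) = - ?E"
      unfolding J_def \<Phi>_def by (subst set_integral_diff(2)[OF Y_int Sd_int]) (use s in auto)
    moreover have "?E \<le> (LINT x:U|lborel. 4 * A * K * ?a * h\<^sup>2)"
      using Sd_bd[OF _ s]
      by (intro set_integral_mono Sd_int s set_integral_const_bounded[OF U(1,2)]) (simp add: abs_le_iff)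
    moreover have "(LINT x:U|lborel. - (4 * A * K * ?a * h\<^sup>2)) \<le> ?E"
    proof (intro set_integral_mono Sd_int s set_integral_const_bounded[OF U(1,2)])
      show "- (4 * A * K * ?a * h\<^sup>2) \<le> 2 * A * h * S x s * d x s" if "x \<in> U" for x
        using Sd_bd[OF that s] by linarith
    qed
    ultimately show ?thesis
      unfolding set_integral_const_bounded(2)[OF U(1,2)] mult_minus_left by linarith
  qed
  have "(LINT x:U|lborel. P x (t - h) * (d x (t - h))\<^sup>2)
      \<le> (LINT x:U|lborel. P x 0 * (d x 0)\<^sup>2) + 6 * ?a ^ 3 * h\<^sup>2 * ?m * T + 2 * (4 * A * K * ?a * h\<^sup>2 * ?m)"
    using near[of "t - h"] near[of 0] JJ h by (simp add: I_def abs_le_iff)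
  then show ?thesis by (simp add: P_def d_def \<kappa>_def algebra_simps)
qed

lemma difference_quotient_limit:
  assumes x: "x \<in> U" and t: "t \<in> {0..T}" and s: "\<And>n. s n \<in> {0..T}" "\<And>n. s n \<noteq> t" "s \<longlonglongrightarrow> t"
  shows "(\<lambda>n. (p x (s n) - p x t) / (s n - t)) \<longlonglongrightarrow> pt x t"
proof -
  have "((\<lambda>y. (p x y - p x t) / (y - t)) \<longlongrightarrow> pt x t) (at t within {0..T})"
    using p_deriv[OF x t] by (simp add: has_field_derivative_iff)
  then show ?thesis unfolding tendsto_at_iff_sequentially o_def using s by blast
qed

text \<open>The function \<open>Z\<close> is the square of the difference quotient that approximates \<open>p\<^sub>t + A\<close>. The weight
\<open>p x s + p x r\<close> differs from \<open>2 B\<close> by an amount that is bounded independently of \<open>B\<close>, so that the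
energy \<open>E\<close> is \<open>(s - r)\<^sup>2 (2 B + O(1)) \<integral>Z\<close>.\<close>

lemma quotient_energy:
  assumes s: "s \<in> {0..T}" and r: "r \<in> {0..T}" and rs: "r < s"
  defines "Z \<equiv> \<lambda>x. ((p x s - p x r) / (s - r) + A)\<^sup>2"
    and "E \<equiv> LINT x:U|lborel. (p x s + p x r) * (p x s - p x r + A * (s - r))\<^sup>2"
  shows "set_integrable lborel U Z" "\<And>x. x \<in> U \<Longrightarrow> \<bar>Z x\<bar> \<le> (A + C)\<^sup>2"
    and "2 * (B - A * T - K) * ((s - r)\<^sup>2 * (LINT x:U|lborel. Z x)) \<le> E"
    and "E \<le> 2 * (B + K) * ((s - r)\<^sup>2 * (LINT x:U|lborel. Z x))"
proof -
  let ?\<beta> = "B - A * T - K"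
  show Z_bd: "\<bar>Z x\<bar> \<le> (A + C)\<^sup>2" if "x \<in> U" for x
  proof -
    have "\<bar>(p x s - p x r) / (s - r)\<bar> \<le> C"
      using p_Lipschitz[OF that r s] rs by (simp add: abs_divide pos_divide_le_eq)
    then have "\<bar>(p x s - p x r) / (s - r) + A\<bar> \<le> A + C" using A by linarith
    then show ?thesis unfolding Z_def by (metis abs_ge_zero abs_power2 power2_abs power_mono)
  qed
  have Zc: "continuous_on U Z"
    unfolding Z_def using rs p_continuous_U[OF s] p_continuous_U[OF r]
    by (intro continuous_intros) auto
  show Zi: "set_integrable lborel U Z"
    by (rule set_integrable_bounded_open[OF U(1,2) Zc Z_bd])
  define P where "P x = p x s + p x r" for x
  have P: "2 * ?\<beta> \<le> P x" "P x \<le> 2 * (B + K)" if "x \<in> U" for x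
    using p_bounds[OF that s] p_bounds[OF that r] unfolding P_def by auto
  define N where "N = max \<bar>2 * ?\<beta>\<bar> \<bar>2 * (B + K)\<bar>"
  have PZ: "set_integrable lborel U (\<lambda>x. P x * Z x)"
  proof (rule set_integrable_bounded_open[OF U(1,2), where M = "N * (A + C)\<^sup>2"])
    show "continuous_on U (\<lambda>x. P x * Z x)"
      unfolding P_def using Zc p_continuous_U[OF s] p_continuous_U[OF r] by (intro continuous_intros)
    show "\<bar>P x * Z x\<bar> \<le> N * (A + C)\<^sup>2" if "x \<in> U" for x
      unfolding abs_mult using P[OF that] Z_bd[OF that] by (intro mult_mono) (auto simp: N_def)
  qed
  have "(p x s - p x r + A * (s - r))\<^sup>2 = (s - r)\<^sup>2 * Z x" for x
    using rs by (simp add: Z_def power_mult_distrib[symmetric] field_simps)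
  then have E: "E = (s - r)\<^sup>2 * (LINT x:U|lborel. P x * Z x)"
    unfolding E_def P_def set_integral_mult_right[symmetric] by (simp add: mult_ac)
  have "2 * ?\<beta> * (LINT x:U|lborel. Z x) \<le> (LINT x:U|lborel. P x * Z x)"
    unfolding set_integral_mult_right[symmetric]
    using P(1) by (intro set_integral_mono PZ set_integrable_mult_right Zi mult_right_mono) (auto simp: Z_def)
  then show "2 * ?\<beta> * ((s - r)\<^sup>2 * (LINT x:U|lborel. Z x)) \<le> E"
    unfolding E using mult_left_mono[of _ _ "(s - r)\<^sup>2"] by (fastforce simp: mult_ac)
  have "(LINT x:U|lborel. P x * Z x) \<le> 2 * (B + K) * (LINT x:U|lborel. Z x)"
    unfolding set_integral_mult_right[symmetric]
    using P(2) by (intro set_integral_mono PZ set_integrable_mult_right Zi mult_right_mono) (auto simp: Z_def)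
  then show "E \<le> 2 * (B + K) * ((s - r)\<^sup>2 * (LINT x:U|lborel. Z x))"
    unfolding E using mult_left_mono[of _ _ "(s - r)\<^sup>2"] by (fastforce simp: mult_ac)
qed

text \<open>Divide \<open>shifted_energy\<close> by \<open>h\<^sup>2\<close>. The backward quotients at \<open>t\<close> tend to \<open>p\<^sub>t + A\<close>, also for \<open>t = T\<close>, and
the forward quotients at \<open>0\<close> tend to the initial value \<open>0\<close> of \<open>p\<^sub>t + A\<close>.\<close>

lemma rate_L2:
  assumes t: "t \<in> {0<..T}"
  shows "2 * (B - A * T - K) * (LINT x:U|lborel. (pt x t + A)\<^sup>2) \<le> \<kappa> * measure lborel U"
proof -
  let ?m = "measure lborel U" and ?\<beta> = "B - A * T - K"
  have t': "t \<in> {0..T}" and z: "0 \<in> {0..T}" using t by auto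
  \<comment> \<open>the second successor keeps \<open>h n\<close> strictly below \<open>t\<close>\<close>
  define h where "h n = t * inverse (real (Suc (Suc n)))" for n :: nat
  have h: "0 < h n" "h n < t" for n using t by (simp_all add: h_def divide_inverse[symmetric] pos_divide_less_eq)
  have h_lim: "h \<longlonglongrightarrow> 0" unfolding h_def
    using tendsto_mult_right_zero[OF LIMSEQ_Suc[OF LIMSEQ_inverse_real_of_nat], of t] by simp
  have hT: "h n \<in> {0..T}" "t - h n \<in> {0..T}" for n using h[of n] t by auto
  have th: "t - h n < t" for n using h(1)[of n] by simp
  define X where "X n x = ((p x t - p x (t - h n)) / (t - (t - h n)) + A)\<^sup>2" for n x
  define Y where "Y n x = ((p x (h n) - p x 0) / (h n - 0) + A)\<^sup>2" for n x
  note qX = quotient_energy[OF t' hT(2) th, folded X_def]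
  note qY = quotient_energy[OF hT(1) z h(1), folded Y_def]
  have main: "2 * ?\<beta> * (LINT x:U|lborel. X n x) \<le> 2 * (B + K) * (LINT x:U|lborel. Y n x) + \<kappa> * ?m" for n
  proof -
    have "2 * ?\<beta> * ((h n)\<^sup>2 * (LINT x:U|lborel. X n x))
        \<le> 2 * (B + K) * ((h n)\<^sup>2 * (LINT x:U|lborel. Y n x)) + (h n)\<^sup>2 * \<kappa> * ?m"
      using shifted_energy[of "h n" t] h[of n] t qX(3)[of n] qY(4)[of n] by simp
    then have "(h n)\<^sup>2 * (2 * ?\<beta> * (LINT x:U|lborel. X n x))
        \<le> (h n)\<^sup>2 * (2 * (B + K) * (LINT x:U|lborel. Y n x) + \<kappa> * ?m)"
      by (simp only: distrib_left mult_ac)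
    moreover have "0 < (h n)\<^sup>2" using h(1)[of n] by simp
    ultimately show ?thesis by (rule mult_left_le_imp_le)
  qed
  have X_lim: "(\<lambda>n. LINT x:U|lborel. X n x) \<longlonglongrightarrow> (LINT x:U|lborel. (pt x t + A)\<^sup>2)"
  proof (rule set_integral_bounded_convergence[OF U(1,2) qX(1,2)])
    fix x assume x: "x \<in> U"
    have "(\<lambda>n. t - h n) \<longlonglongrightarrow> t" using tendsto_diff[OF tendsto_const h_lim, of t] by simp
    moreover have "t - h n \<noteq> t" for n using h(1)[of n] by simp
    moreover have "X n x = ((p x (t - h n) - p x t) / (t - h n - t) + A)\<^sup>2" for n
      unfolding X_def by (metis minus_diff_eq minus_divide_divide)
    ultimately show "(\<lambda>n. X n x) \<longlonglongrightarrow> (pt x t + A)\<^sup>2"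
      by (simp only:) (intro tendsto_intros difference_quotient_limit x t' hT)
  qed
  have Y_lim: "(\<lambda>n. LINT x:U|lborel. Y n x) \<longlonglongrightarrow> (LINT x:U|lborel. 0)"
  proof (rule set_integral_bounded_convergence[OF U(1,2) qY(1,2)])
    fix x assume x: "x \<in> U"
    have "h n \<noteq> 0" for n using h(1)[of n] by simp
    then have "(\<lambda>n. Y n x) \<longlonglongrightarrow> (pt x 0 + A)\<^sup>2"
      unfolding Y_def by (intro tendsto_intros difference_quotient_limit x z hT h_lim)
    then show "(\<lambda>n. Y n x) \<longlonglongrightarrow> 0" using p_initial_rate[OF x] by simp
  qed
  have "(\<lambda>n. 2 * ?\<beta> * (LINT x:U|lborel. X n x)) \<longlonglongrightarrow> 2 * ?\<beta> * (LINT x:U|lborel. (pt x t + A)\<^sup>2)"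
    by (intro tendsto_intros X_lim)
  moreover have "(\<lambda>n. 2 * (B + K) * (LINT x:U|lborel. Y n x) + \<kappa> * ?m) \<longlonglongrightarrow> 2 * (B + K) * (LINT x:U|lborel. 0) + \<kappa> * ?m"
    by (intro tendsto_intros Y_lim)
  ultimately show ?thesis
    using main LIMSEQ_le[of _ _ _ "2 * (B + K) * (LINT x:U|lborel. 0) + \<kappa> * ?m"] by fastforce
qed

text \<open>The bound for \<open>\<integral>|p\<^sub>t + A|\<close>, the amount by which the flux can miss its limit \<open>A |U|\<close>; it tends to \<open>0\<close> as
\<open>B\<close> grows.\<close>

definition deficit :: real where
  "deficit = (\<kappa> / 2 + 1) * measure lborel U / sqrt (B - A * T - K)"

lemma rate_integrable:
  assumes t: "t \<in> {0..T}"
  shows "set_integrable lborel U (\<lambda>x. pt x t)" "set_integrable lborel U (\<lambda>x. \<bar>pt x t + A\<bar>)"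
    "set_integrable lborel U (\<lambda>x. (pt x t + A)\<^sup>2)"
proof -
  note c = p_slice(3)[OF t]
  have b: "\<bar>pt x t\<bar> \<le> C" if "x \<in> U" for x using rate[OF that] t by simp
  have b': "\<bar>pt x t + A\<bar> \<le> C + A" if "x \<in> U" for x using b[OF that] A by linarith
  show "set_integrable lborel U (\<lambda>x. pt x t)"
    by (rule set_integrable_bounded_open[OF U(1,2) c b])
  show "set_integrable lborel U (\<lambda>x. \<bar>pt x t + A\<bar>)"
    by (rule set_integrable_bounded_open[OF U(1,2), where M = "C + A"]) (use b' c in \<open>auto intro!: continuous_intros\<close>)
  show "set_integrable lborel U (\<lambda>x. (pt x t + A)\<^sup>2)"
  proof (rule set_integrable_bounded_open[OF U(1,2), where M = "(C + A)\<^sup>2"])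
    show "\<bar>(pt x t + A)\<^sup>2\<bar> \<le> (C + A)\<^sup>2" if "x \<in> U" for x
      using b'[OF that] by (metis abs_ge_zero abs_power2 power2_abs power_mono)
  qed (use c in \<open>auto intro!: continuous_intros\<close>)
qed

text \<open>The L2 estimate is inserted into \<open>|y| \<le> r y\<^sup>2 + 1 / r\<close> with \<open>r\<close> the square root of \<open>B - A T - K\<close>, which
balances the two terms.\<close>

lemma rate_L1:
  assumes t: "t \<in> {0<..T}" and large: "A * T + K < B"
  shows "(LINT x:U|lborel. \<bar>pt x t + A\<bar>) \<le> deficit"
proof -
  let ?m = "measure lborel U"
  define r where "r = sqrt (B - A * T - K)"
  have l: "r > 0" "r\<^sup>2 = B - A * T - K" using large by (auto simp: r_def)
  have t': "t \<in> {0..T}" using t by simp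
  note i = rate_integrable[OF t']
  have "\<bar>y\<bar> \<le> r * y\<^sup>2 + 1 / r" for y :: real
  proof -
    have "0 \<le> (r * \<bar>y\<bar> - 1)\<^sup>2" "0 \<le> (r * \<bar>y\<bar>)" using l by auto
    then have "r * \<bar>y\<bar> \<le> r\<^sup>2 * y\<^sup>2 + 1" by (simp add: power2_eq_square algebra_simps) 
    then show ?thesis using l(1) by (simp add: field_simps power2_eq_square)
  qed
  then have "(LINT x:U|lborel. \<bar>pt x t + A\<bar>) \<le> (LINT x:U|lborel. r * (pt x t + A)\<^sup>2 + 1 / r)"
    by (intro set_integral_mono i(2) set_integral_add(1) set_integrable_mult_right i(3)
        set_integral_const_bounded[OF U(1,2)])
  also have "\<dots> = r * (LINT x:U|lborel. (pt x t + A)\<^sup>2) + 1 / r * ?m"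
    by (subst set_integral_add(2)) (use i(3) set_integral_const_bounded[OF U(1,2)] in auto)
  also have "r * (LINT x:U|lborel. (pt x t + A)\<^sup>2) = 1 / (2 * r) * (2 * r\<^sup>2 * (LINT x:U|lborel. (pt x t + A)\<^sup>2))"
    using l(1) by (simp add: power2_eq_square)
  also have "\<dots> \<le> 1 / (2 * r) * (\<kappa> * ?m)"
    using rate_L2[OF t] l by (intro mult_left_mono) auto
  also have "1 / (2 * r) * (\<kappa> * ?m) + 1 / r * ?m = deficit"
    unfolding deficit_def r_def[symmetric] using l(1) by (simp add: field_simps)
  finally show ?thesis by simp
qed

lemma flux_eq:
  assumes t: "t \<in> {0<..T}"
  shows "flux U \<Gamma>i p t = A * measure lborel U - (LINT x:U|lborel. pt x t + A)"
proof -
  have t': "t \<in> {0..T}" using t by simp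
  have "2 * surface_integral U \<Gamma>i (\<lambda>x. p x t * (grad_bd U (\<lambda>y. p y t) x \<bullet> outward_normal U x))
      = surface_integral U (frontier U) (\<lambda>x. grad_bd U (v t) x \<bullet> outward_normal U x)"
    unfolding surface_integral_cmult[symmetric]
  proof (rule surface_integral_eqI)
    fix x
    show "indicator \<Gamma>i x * (2 * (p x t * (grad_bd U (\<lambda>y. p y t) x \<bullet> outward_normal U x)))
        = indicator (frontier U) x * (grad_bd U (v t) x \<bullet> outward_normal U x)"
      using v_regular(2)[OF t, of x] v_boundary(2)[OF t, of x] fr by (auto simp: indicator_def)
  qed
  also have "\<dots> = (LINT x:U|lborel. laplacian (v t) x)"
    by (rule integral_laplacian[OF dom v_regular(1)[OF t], symmetric])
  also have "\<dots> = (LINT x:U|lborel. 2 * pt x t)"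
    by (rule set_lebesgue_integral_cong) (use U laplacian_v[OF t] in auto)
  finally have "flux U \<Gamma>i p t = - (LINT x:U|lborel. pt x t)" by (simp add: flux_def)
  moreover have "(LINT x:U|lborel. pt x t + A) = (LINT x:U|lborel. pt x t) + A * measure lborel U"
    by (subst set_integral_add(2)) (use rate_integrable(1)[OF t'] set_integral_const_bounded[OF U(1,2)] in auto)
  ultimately show ?thesis by simp
qed

lemma flux_near:
  assumes t: "t \<in> {0<..T}" and large: "A * T + K < B"
  shows "\<bar>flux U \<Gamma>i p t - A * measure lborel U\<bar> \<le> deficit"
proof -
  have "\<bar>LINT x:U|lborel. pt x t + A\<bar> \<le> (LINT x:U|lborel. \<bar>pt x t + A\<bar>)"
    using set_integral_norm_bound[of lborel U "\<lambda>x. pt x t + A"] set_integral_add(1)[OF rate_integrable(1)[of t]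
      set_integral_const_bounded(1)[OF U(1,2), of A]] t by simp
  then show ?thesis using rate_L1[OF assms] flux_eq[OF t] by simp
qed

text \<open>Green's second identity for \<open>W\<close> and \<open>u = p\<^sup>2 - (B - A t)\<^sup>2 - 2 W\<close>: the function \<open>W\<close> acts as the test
function whose Laplacian is constant, which turns \<open>\<integral>u\<close> into an integral of \<open>p\<^sub>t + A\<close>.\<close>

lemma mean_square_near:
  assumes t: "t \<in> {0<..T}" and large: "A * T + K < B"
  shows "\<bar>(LINT x:U|lborel. (p x t)\<^sup>2) - ((B - A * t)\<^sup>2 * measure lborel U + 2 * (LINT x:U|lborel. W x))\<bar>
    \<le> 2 * \<omega> / A * deficit"
proof -
  have t': "t \<in> {0..T}" using t by simp
  let ?u = "\<lambda>x. 1 * v t x + (- 2) * W x + (- (B - A * t)\<^sup>2)"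
  note l = regular_on_lincomb[OF U(1) v_regular(1)[OF t] W_regular, where a = 1 and b = "- 2" and c = "- (B - A * t)\<^sup>2"]
  have lap_u: "laplacian ?u x = 2 * (pt x t + A)" if "x \<in> U" for x
    unfolding l(2)[OF that] laplacian_v[OF t that] laplacian_W[OF that] by simp
  have bd: "?u x * (grad_bd U W x \<bullet> outward_normal U x) = 0 \<and> W x * (grad_bd U ?u x \<bullet> outward_normal U x) = 0"
    if x: "x \<in> frontier U" for x
  proof (cases "x \<in> \<Gamma>i")
    case True
    then show ?thesis using v_boundary(1)[OF t] W_boundary(1) by simp
  next
    case False
    then have "x \<in> \<Gamma>e" using x fr by blast
    then show ?thesis unfolding l(3)[OF x] using v_boundary(2)[OF t] W_boundary(2)
      by (simp add: inner_diff_left)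
  qed
  have "(LINT x:U|lborel. ?u x * laplacian W x) = (LINT x:U|lborel. W x * laplacian ?u x)"
    using green_identity_no_flux[OF dom l(1) W_regular] green_identity_no_flux[OF dom W_regular l(1)] bd
    by (simp add: inner_commute)
  moreover have "(LINT x:U|lborel. ?u x * laplacian W x) = (LINT x:U|lborel. - A * ?u x)"
    by (rule set_lebesgue_integral_cong) (use U laplacian_W in auto)
  ultimately have key: "- A * (LINT x:U|lborel. ?u x) = (LINT x:U|lborel. W x * laplacian ?u x)"
    by (simp only: set_integral_mult_right)
  note Wu = green_identity(2)[OF dom W_regular l(1)]
  have "A * \<bar>LINT x:U|lborel. ?u x\<bar> = \<bar>LINT x:U|lborel. W x * laplacian ?u x\<bar>"
    using A unfolding key[symmetric] by (simp add: abs_mult)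
  also have "\<dots> \<le> (LINT x:U|lborel. \<bar>W x * laplacian ?u x\<bar>)"
    using set_integral_norm_bound[OF Wu] by simp
  also have "\<dots> \<le> (LINT x:U|lborel. 2 * \<omega> * \<bar>pt x t + A\<bar>)"
  proof (rule set_integral_mono)
    show "set_integrable lborel U (\<lambda>x. \<bar>W x * laplacian ?u x\<bar>)"
      using Wu by (rule set_integrable_abs)
    show "set_integrable lborel U (\<lambda>x. 2 * \<omega> * \<bar>pt x t + A\<bar>)"
      using rate_integrable(2)[OF t'] by simp
    show "\<bar>W x * laplacian ?u x\<bar> \<le> 2 * \<omega> * \<bar>pt x t + A\<bar>" if "x \<in> U" for x
    proof -
      have "\<bar>W x\<bar> * (2 * \<bar>pt x t + A\<bar>) \<le> \<omega> * (2 * \<bar>pt x t + A\<bar>)"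
        using W_bound[of x] subsetD[OF closure_subset that] by (intro mult_right_mono) auto
      then show ?thesis unfolding lap_u[OF that] by (simp only: abs_mult abs_numeral mult_ac)
    qed
  qed
  also have "\<dots> \<le> 2 * \<omega> * deficit"
    using rate_L1[OF assms] omega_nonneg by (simp add: mult_left_mono)
  finally have "\<bar>LINT x:U|lborel. ?u x\<bar> \<le> 2 * \<omega> / A * deficit"
    using A by (simp add: field_simps)
  moreover have "(LINT x:U|lborel. ?u x)
      = (LINT x:U|lborel. (p x t)\<^sup>2) - ((B - A * t)\<^sup>2 * measure lborel U + 2 * (LINT x:U|lborel. W x))"
  proof -
    have vi: "set_integrable lborel U (v t)" by (rule regular_on_integrable[OF U(1,2) v_regular(1)[OF t]])
    have "(LINT x:U|lborel. ?u x) = (LINT x:U|lborel. v t x - 2 * W x - (B - A * t)\<^sup>2)" by simp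
    also have "\<dots> = (LINT x:U|lborel. v t x) - 2 * (LINT x:U|lborel. W x) - (B - A * t)\<^sup>2 * measure lborel U"
      using vi regular_on_integrable[OF U(1,2) W_regular] set_integral_const_bounded[OF U(1,2)]
      by (simp add: set_integral_diff)
    finally show ?thesis by (simp add: v_def)
  qed
  ultimately show ?thesis by simp
qed

lemma surface_mean_square:
  assumes t: "t \<in> {0<..T}"
  shows "surface_integral U \<Gamma>i (\<lambda>x. (p x t)\<^sup>2) = (B - A * t)\<^sup>2 * surface_integral U \<Gamma>i (\<lambda>_. 1)"
  unfolding surface_integral_cmult[symmetric]
  by (rule surface_integral_eqI) (use v_boundary(1)[OF t] in \<open>auto simp: indicator_def v_def\<close>)

text \<open>Testing the equation of \<open>W\<close> with \<open>W\<close> gives \<open>A \<integral>W = \<integral>|\<nabla>W|\<^sup>2\<close>, and \<open>\<nabla>W\<close> cannot vanish identically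
since \<open>\<Delta>W = - A\<close>.\<close>

lemma integral_W_pos: "(LINT x:U|lborel. W x) > 0"
proof -
  have W2: "C2_on U W" using W_regular by (simp add: regular_on_def)
  have "\<exists>x\<in>U. grad W x \<noteq> 0"
  proof (rule ccontr)
    assume "\<not> (\<exists>x\<in>U. grad W x \<noteq> 0)"
    then have 0: "\<And>x. x \<in> U \<Longrightarrow> grad W x = 0" by blast
    obtain x where x: "x \<in> U" using U by blast
    have "divergence (\<lambda>x. 0 :: 'a) x = divergence (grad W) x"
      by (rule divergence_cong[OF U(1) 0 C2_on_grad_field[OF W2] x])
    moreover have "divergence (\<lambda>x. 0 :: 'a) x = 0"
      by (subst divergence_eqI[where F' = "\<lambda>h. 0"]) auto
    ultimately show False using laplacian_W[OF x] A by (simp add: laplacian_def)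
  qed
  then obtain x where x: "x \<in> U" "grad W x \<noteq> 0" by blast
  have "0 < (LINT x:U|lborel. grad W x \<bullet> grad W x)"
  proof (rule set_integral_pos[OF U(1) _ _ _ x(1)])
    show "continuous_on U (\<lambda>x. grad W x \<bullet> grad W x)"
      using C1_field_imp_continuous_on[OF C2_on_grad_field[OF W2]] by (intro continuous_intros)
    show "set_integrable lborel U (\<lambda>x. grad W x \<bullet> grad W x)"
      by (rule green_identity(1)[OF dom W_regular W_regular])
  qed (use x in auto)
  also have "\<dots> = - (LINT x:U|lborel. W x * laplacian W x)"
  proof (rule green_identity_no_flux[OF dom W_regular W_regular])
    show "W x * (grad_bd U W x \<bullet> outward_normal U x) = 0" if "x \<in> frontier U" for x
      using W_boundary[of x] fr that by auto
  qed
  also have "(LINT x:U|lborel. W x * laplacian W x) = (LINT x:U|lborel. - A * W x)"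
    by (rule set_lebesgue_integral_cong) (use U laplacian_W in auto)
  also have "- \<dots> = A * (LINT x:U|lborel. W x)"
    unfolding set_integral_mult_right by simp
  finally show ?thesis using A by (simp add: zero_less_mult_iff)
qed

lemma aux_flux:
  assumes t: "t \<in> {0..T}"
  shows "flux U \<Gamma>i (aux_pressure A W B) t = A * measure lborel U"
proof -
  let ?f = "\<lambda>x. aux_pressure A W B x t"
  have W1: "C1_closure U W" and W2: "C2_on U W" using W_regular by (auto simp: regular_on_def)
  obtain G where G: "continuous_on (closure U) G" "\<And>x. x \<in> U \<Longrightarrow> G x = grad W x"
    "\<And>x. x \<in> frontier U \<Longrightarrow> grad_bd U W x = G x"
    using C1_closureE[OF U(1) W1] by blast
  have Wc: "continuous_on (closure U) W" using W1 by (simp add: C1_closure_def)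
  have "continuous_on (closure U) ?f"
    unfolding aux_pressure_def by (intro continuous_intros Wc)
  then have H: "continuous_on (closure U) (\<lambda>x. inverse (?f x) *\<^sub>R G x)"
    using aux_sq(3)[OF t] G(1) by (intro continuous_intros) (auto simp: less_le)
  have HU: "inverse (?f x) *\<^sub>R G x = grad ?f x" if x: "x \<in> U" for x
  proof (rule grad_eqI[symmetric])
    have xc: "x \<in> closure U" using x closure_subset by blast
    have dW: "(W has_derivative (\<lambda>h. grad W x \<bullet> h)) (at x)"
      using W2 x by (intro has_derivative_grad) (auto simp: C2_on_def)
    have "((\<lambda>s. sqrt ((B - A * t)\<^sup>2 + 2 * s)) has_real_derivative inverse (?f x)) (at (W x))"
      using aux_sq(1)[OF t xc] unfolding aux_pressure_def
      by (auto intro!: derivative_eq_intros simp: field_simps)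
    then have "((\<lambda>s. sqrt ((B - A * t)\<^sup>2 + 2 * s)) has_derivative (*) (inverse (?f x))) (at (W x))"
      by (simp add: has_field_derivative_def)
    from has_derivative_compose[OF dW this]
    show "(?f has_derivative (\<lambda>h. (inverse (?f x) *\<^sub>R G x) \<bullet> h)) (at x)"
      by (simp add: aux_pressure_def G(2)[OF x])
  qed
  have gb: "?f x * (grad_bd U ?f x \<bullet> outward_normal U x) = grad_bd U W x \<bullet> outward_normal U x"
    if x: "x \<in> frontier U" for x
  proof -
    have "x \<in> closure U" using x by (simp add: frontier_def)
    then have "?f x > 0" by (rule aux_sq(3)[OF t])
    then show ?thesis using grad_bd_eq[OF U(1) H HU x] G(3)[OF x] by simp
  qed
  have "surface_integral U \<Gamma>i (\<lambda>x. ?f x * (grad_bd U ?f x \<bullet> outward_normal U x))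
      = surface_integral U (frontier U) (\<lambda>x. grad_bd U W x \<bullet> outward_normal U x)"
  proof (rule surface_integral_eqI)
    fix x
    show "indicator \<Gamma>i x * (?f x * (grad_bd U ?f x \<bullet> outward_normal U x))
        = indicator (frontier U) x * (grad_bd U W x \<bullet> outward_normal U x)"
      using gb[of x] W_boundary(2)[of x] fr by (auto simp: indicator_def)
  qed
  also have "\<dots> = (LINT x:U|lborel. laplacian W x)"
    by (rule integral_laplacian[OF dom W_regular, symmetric])
  also have "\<dots> = (LINT x:U|lborel. - A)"
    by (rule set_lebesgue_integral_cong) (use U laplacian_W in auto)
  also have "\<dots> = - A * measure lborel U" by (rule set_integral_const_bounded(2)[OF U(1,2)])
  finally show ?thesis by (simp add: flux_def)
qed

lemma aux_mean_square:
  assumes t: "t \<in> {0..T}"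
  shows "(LINT x:U|lborel. (aux_pressure A W B x t)\<^sup>2) = (B - A * t)\<^sup>2 * measure lborel U + 2 * (LINT x:U|lborel. W x)"
proof -
  have "(LINT x:U|lborel. (aux_pressure A W B x t)\<^sup>2) = (LINT x:U|lborel. (B - A * t)\<^sup>2 + 2 * W x)"
    by (rule set_lebesgue_integral_cong) (use U aux_sq(2)[OF t] closure_subset in auto)
  also have "\<dots> = (B - A * t)\<^sup>2 * measure lborel U + 2 * (LINT x:U|lborel. W x)"
    by (subst set_integral_add(2)) (use regular_on_integrable[OF U(1,2) W_regular] set_integral_const_bounded[OF U(1,2)] in auto)
  finally show ?thesis .
qed

lemma aux_surface_mean_square:
  assumes t: "t \<in> {0..T}"
  shows "surface_integral U \<Gamma>i (\<lambda>x. (aux_pressure A W B x t)\<^sup>2)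
    = (B - A * t)\<^sup>2 * surface_integral U \<Gamma>i (\<lambda>_. 1)"
  unfolding surface_integral_cmult[symmetric]
proof (rule surface_integral_eqI)
  fix x
  have "\<Gamma>i \<subseteq> closure U" using fr by (auto simp: frontier_def)
  then show "indicator \<Gamma>i x * (aux_pressure A W B x t)\<^sup>2 = indicator \<Gamma>i x * ((B - A * t)\<^sup>2 * 1)"
    using aux_sq(2)[OF t, of x] W_boundary(1)[of x] by (auto simp: indicator_def)
qed

text \<open>Both pressures agree on \<open>U\<close>, hence by continuity on its closure, and the boundary values of the gradients
are limits from inside \<open>U\<close>.\<close>

lemma productivity_index_initial:
  "productivity_index U \<Gamma>i p 0 = productivity_index U \<Gamma>i (aux_pressure A W B) 0"
proof -
  let ?f = "\<lambda>x. aux_pressure A W B x 0"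
  have z: "0 \<in> {0..T}" using T by simp
  have pU: "p x 0 = ?f x" if "x \<in> U" for x using sol that by (simp add: gas_solution_def)
  have Wc: "continuous_on (closure U) W" using W_regular by (simp add: regular_on_def C1_closure_def)
  have "continuous_on (closure U) (\<lambda>x. p x 0 - ?f x)"
    unfolding aux_pressure_def by (intro continuous_intros Wc p_slice(2)[OF z])
  then have pc: "p x 0 - ?f x = 0" if "x \<in> closure U" for x
    by (rule continuous_constant_on_closure[OF _ _ that]) (simp add: pU)
  have pG: "p x 0 = ?f x" if "x \<in> \<Gamma>i" for x using pc[of x] that fr by (auto simp: frontier_def)
  have "grad (\<lambda>y. p y 0) x = grad ?f x" if x: "x \<in> U" for x
  proof -
    have "((\<lambda>y. p y 0) has_derivative (\<lambda>h. grad (\<lambda>y. p y 0) x \<bullet> h)) (at x)"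
      using p_slice(1)[OF z] x by (intro has_derivative_grad) (auto simp: C2_on_def)
    from has_derivative_transform_within_open[OF this U(1) x pU]
    show ?thesis by (rule grad_eqI[symmetric])
  qed
  then have "(grad (\<lambda>y. p y 0) \<longlongrightarrow> l) (at x within U) \<longleftrightarrow> (grad ?f \<longlongrightarrow> l) (at x within U)" for l x
    by (intro tendsto_cong) (simp add: eventually_at_filter)
  then have gb: "grad_bd U (\<lambda>y. p y 0) x = grad_bd U ?f x" for x
    by (simp add: grad_bd_def Topological_Spaces.Lim_def)
  have "flux U \<Gamma>i p 0 = flux U \<Gamma>i (aux_pressure A W B) 0"
    unfolding flux_def gb by (intro arg_cong[of _ _ uminus] surface_integral_eqI) (auto simp: indicator_def pG)
  moreover have "(LINT x:U|lborel. (p x 0)\<^sup>2) = (LINT x:U|lborel. (?f x)\<^sup>2)"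
    by (rule set_lebesgue_integral_cong) (use U pU in auto)
  moreover have "surface_integral U \<Gamma>i (\<lambda>x. (p x 0)\<^sup>2) = surface_integral U \<Gamma>i (\<lambda>x. (?f x)\<^sup>2)"
    by (rule surface_integral_eqI) (auto simp: indicator_def pG)
  ultimately show ?thesis by (simp add: productivity_index_def)
qed

end

section \<open>Convergence of the productivity index\<close>

text \<open>Here \<open>S\<close> stands for the surface measure of \<open>\<Gamma>i\<close>, \<open>c B\<close> for the square of the boundary pressure and \<open>w\<close> for
\<open>2 \<integral>W\<close>. If \<open>S\<close> is not zero, then the large numbers \<open>c B\<close> cancel and both denominators tend to \<open>w / m\<close>.
If \<open>S = 0\<close>, then \<open>1 / S\<close> is \<open>0\<close> as well, both denominators tend to infinity, and both quotients
tend to \<open>0\<close>.\<close>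

lemma productivity_difference_tendsto_0:
  fixes N V c :: "real \<Rightarrow> real" and m w S Q :: real
  assumes m: "m > 0" and w: "w > 0"
    and N: "(N \<longlongrightarrow> Q) at_top" and V: "((\<lambda>B. V B - (c B * m + w)) \<longlongrightarrow> 0) at_top"
    and c: "filterlim c at_top at_top"
  shows "((\<lambda>B. N B / (1 / m * V B - 1 / S * (c B * S))
      - Q / (1 / m * (c B * m + w) - 1 / S * (c B * S))) \<longlongrightarrow> 0) at_top"
proof (cases "S = 0")
  case False
  have "((\<lambda>B. (V B - (c B * m + w)) / m + w / m) \<longlongrightarrow> 0 / m + w / m) at_top"
    using m by (intro tendsto_intros V) auto
  moreover have "(V B - (c B * m + w)) / m + w / m = 1 / m * V B - 1 / S * (c B * S)" for B
    using m False by (simp add: field_simps)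
  ultimately have D: "((\<lambda>B. 1 / m * V B - 1 / S * (c B * S)) \<longlongrightarrow> w / m) at_top" by simp
  have "1 / m * (c B * m + w) - 1 / S * (c B * S) = w / m" for B
    using m False by (simp add: field_simps)
  moreover have "((\<lambda>B. N B / (1 / m * V B - 1 / S * (c B * S)) - Q / (w / m)) \<longlongrightarrow> Q / (w / m) - Q / (w / m)) at_top"
    using m w by (intro tendsto_intros N D) auto
  ultimately show ?thesis by simp
next
  case True
  have lim: "filterlim (\<lambda>B. w / m + c B) at_infinity at_top"
    by (intro filterlim_at_top_imp_at_infinity filterlim_tendsto_add_at_top[OF tendsto_const c])
  then have 1: "((\<lambda>B. Q / (w / m + c B)) \<longlongrightarrow> 0) at_top"
    by (rule tendsto_divide_0[OF tendsto_const])
  have "((\<lambda>B. (V B - (c B * m + w)) / m + w / m) \<longlongrightarrow> 0 / m + w / m) at_top"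
    using m by (intro tendsto_intros V) auto
  then have "filterlim (\<lambda>B. ((V B - (c B * m + w)) / m + w / m) + c B) at_infinity at_top"
    using c by (intro filterlim_at_top_imp_at_infinity filterlim_tendsto_add_at_top)
  then have 2: "((\<lambda>B. N B / (((V B - (c B * m + w)) / m + w / m) + c B)) \<longlongrightarrow> 0) at_top"
    by (rule tendsto_divide_0[OF N])
  have "((V B - (c B * m + w)) / m + w / m) + c B = 1 / m * V B" "w / m + c B = 1 / m * (c B * m + w)" for B
    using m by (simp_all add: field_simps)
  then show ?thesis using tendsto_diff[OF 2 1] True by simp
qed

theorem theorem6p10:
  fixes U \<Gamma>e \<Gamma>i :: "(real ^ 'n) set"
    and A T0 C :: real
    and W :: "real ^ 'n \<Rightarrow> real"
    and p :: "real \<Rightarrow> real ^ 'n \<Rightarrow> real \<Rightarrow> real"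
  assumes "bounded_C2_domain U"
    and "frontier U = \<Gamma>e \<union> \<Gamma>i" and "\<Gamma>i \<in> sets borel"
    and "A > 0" and "T0 > 0"
    and "steady_solution U \<Gamma>e \<Gamma>i A W"
    and "\<And>B. B > A * T0 \<Longrightarrow> gas_solution U \<Gamma>e \<Gamma>i A W T0 B (p B)"
    and "\<And>B x t. B > A * T0 \<Longrightarrow> x \<in> U \<Longrightarrow> 0 \<le> t \<Longrightarrow> t \<le> T0 \<Longrightarrow>
           norm (grad (\<lambda>y. p B y t) x) + laplacian (\<lambda>y. p B y t) x \<le> C"
    and "\<And>B x t. B > A * T0 \<Longrightarrow> x \<in> U \<Longrightarrow> 0 \<le> t \<Longrightarrow> t \<le> T0 \<Longrightarrow>
           \<bar>time_deriv T0 (p B) x t\<bar> \<le> C"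
  shows "\<forall>t\<in>{0..T0}.
           ((\<lambda>B. productivity_index U \<Gamma>i (p B) t
                - productivity_index U \<Gamma>i (aux_pressure A W B) t) \<longlongrightarrow> 0) at_top"
proof
  fix t assume t: "t \<in> {0..T0}"
  note dom = assms(1) and A = assms(4)
  have U: "open U" "bounded U" "U \<noteq> {}" using dom by (auto simp: bounded_C2_domain_def)
  have "continuous_on (closure U) W"
    using assms(6) by (simp add: steady_solution_def C1_closure_def)
  then obtain \<omega> where \<omega>: "\<omega> \<ge> 0" "\<And>x. x \<in> closure U \<Longrightarrow> norm (W x) \<le> \<omega>"
    using continuous_on_compact_bound[of "closure U" W] U(2) by auto
  have flow: "gas_flow U \<Gamma>e \<Gamma>i A T0 B C \<omega> W (p B)" if B: "B > A * T0 + 2 * \<omega> + 1" for B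
  proof
    have AT: "A * T0 > 0" using A assms(5) by simp
    then show "1 \<le> B" "A * T0 < B" using B \<omega>(1) by linarith+
    have "2 * \<omega> < B - A * T0" "1 \<le> B - A * T0" using B \<omega>(1) by linarith+
    then have "2 * \<omega> < (B - A * T0) * 1" "(B - A * T0) * 1 \<le> (B - A * T0) * (B - A * T0)"
      by (auto intro!: mult_left_mono)
    then show "2 * \<omega> < (B - A * T0)\<^sup>2" by (simp add: power2_eq_square)
    show "gas_solution U \<Gamma>e \<Gamma>i A W T0 B (p B)" by (rule assms(7)) fact
    show "\<bar>time_deriv T0 (p B) x t\<bar> \<le> C" if "x \<in> U" "0 \<le> t" "t \<le> T0" for x t
      using assms(9)[OF _ that] \<open>A * T0 < B\<close> by blast
    show "\<bar>W x\<bar> \<le> \<omega>" if "x \<in> closure U" for x using \<omega>(2)[OF that] by simp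
  qed (use assms in auto)
  \<comment> \<open>pressures above \<open>B1\<close> satisfy the conditions of the locale\<close>
  define B1 where "B1 = A * T0 + 2 * \<omega> + 1"
  show "((\<lambda>B. productivity_index U \<Gamma>i (p B) t
      - productivity_index U \<Gamma>i (aux_pressure A W B) t) \<longlongrightarrow> 0) at_top"
  proof (cases "t = 0")
    case True
    have "\<forall>\<^sub>F B in at_top. productivity_index U \<Gamma>i (p B) t
        - productivity_index U \<Gamma>i (aux_pressure A W B) t = 0"
      using eventually_gt_at_top[of B1]
      by eventually_elim (simp add: True gas_flow.productivity_index_initial[OF flow] B1_def)
    then show ?thesis by (rule tendsto_eventually)
  next
    case False
    then have t': "t \<in> {0<..T0}" using t by simp
    define m where "m = measure lborel U"
    define w where "w = 2 * (LINT x:U|lborel. W x)"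
    define S where "S = surface_integral U \<Gamma>i (\<lambda>_. 1)"
    define K where "K = gas_flow.K A T0 C \<omega>"
    define \<kappa> where "\<kappa> = gas_flow.\<kappa> A T0 C \<omega>"
    define E where "E B = (\<kappa> / 2 + 1) * m / sqrt (B - A * T0 - K)" for B
    have E: "gas_flow.deficit U A T0 B C \<omega> = E B" if "B > B1" for B
      using gas_flow.deficit_def[OF flow] that by (simp add: B1_def E_def m_def K_def \<kappa>_def)
    have E_lim: "(E \<longlongrightarrow> 0) at_top"
    proof -
      have "filterlim (\<lambda>B. (- A * T0 - K) + B) at_top at_top"
        by (rule filterlim_tendsto_add_at_top[OF tendsto_const filterlim_ident])
      then have "filterlim (\<lambda>B. sqrt (B - A * T0 - K)) at_infinity at_top"
        by (intro filterlim_at_top_imp_at_infinity filterlim_compose[OF sqrt_at_top]) (simp add: algebra_simps)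
      then show ?thesis unfolding E_def by (rule tendsto_divide_0[OF tendsto_const])
    qed
    have ev: "\<forall>\<^sub>F B in at_top. B > B1 \<and> B > A * T0 + K"
      by (intro eventually_conj eventually_gt_at_top)
    have N: "((\<lambda>B. flux U \<Gamma>i (p B) t) \<longlongrightarrow> A * m) at_top"
    proof (rule LIM_zero_cancel, rule Lim_null_comparison[OF _ E_lim])
      show "\<forall>\<^sub>F B in at_top. norm (flux U \<Gamma>i (p B) t - A * m) \<le> E B"
        using ev
      proof eventually_elim
        case (elim B)
        then show ?case
          using gas_flow.flux_near[OF flow t', of B] E[of B] by (simp add: B1_def m_def K_def)
      qed
    qed
    have V: "((\<lambda>B. (LINT x:U|lborel. (p B x t)\<^sup>2) - ((B - A * t)\<^sup>2 * m + w)) \<longlongrightarrow> 0) at_top"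
    proof (rule Lim_null_comparison)
      show "\<forall>\<^sub>F B in at_top. norm ((LINT x:U|lborel. (p B x t)\<^sup>2) - ((B - A * t)\<^sup>2 * m + w)) \<le> 2 * \<omega> / A * E B"
        using ev
      proof eventually_elim
        case (elim B)
        then show ?case
          using gas_flow.mean_square_near[OF flow t', of B] E[of B] by (simp add: B1_def m_def K_def w_def)
      qed
      show "((\<lambda>B. 2 * \<omega> / A * E B) \<longlongrightarrow> 0) at_top"
        by (rule tendsto_mult_right_zero[OF E_lim])
    qed
    have "filterlim (\<lambda>B. (- A * t) + B) at_top at_top"
      by (rule filterlim_tendsto_add_at_top[OF tendsto_const filterlim_ident])
    then have c: "filterlim (\<lambda>B. (B - A * t)\<^sup>2) at_top at_top"
      by (intro filterlim_pow_at_top) (simp_all add: algebra_simps)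
    have m: "m > 0" unfolding m_def by (rule measure_open_pos[OF U])
    have w: "w > 0" using gas_flow.integral_W_pos[OF flow[of "B1 + 1"]] by (simp add: w_def B1_def)
    have "\<forall>\<^sub>F B in at_top.
        flux U \<Gamma>i (p B) t / (1 / m * (LINT x:U|lborel. (p B x t)\<^sup>2) - 1 / S * ((B - A * t)\<^sup>2 * S))
          - A * m / (1 / m * ((B - A * t)\<^sup>2 * m + w) - 1 / S * ((B - A * t)\<^sup>2 * S))
        = productivity_index U \<Gamma>i (p B) t - productivity_index U \<Gamma>i (aux_pressure A W B) t"
      using ev
    proof eventually_elim
      case (elim B)
      then interpret gas_flow U \<Gamma>e \<Gamma>i A T0 B C \<omega> W "p B" by (intro flow) (simp add: B1_def)
      show ?case
        unfolding productivity_index_def surface_mean_square[OF t'] aux_flux[OF t]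
          aux_mean_square[OF t] aux_surface_mean_square[OF t] m_def S_def w_def ..
    qed
    then show ?thesis
      by (rule Lim_transform_eventually[OF productivity_difference_tendsto_0[OF m w N V c], rotated])
  qed
qed

end
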